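(* Consider the extended stochastic ball model (ESBM) in $\mathbb{R}^m$ with $m\ge2$, with $k$ balls $B^m_{r_i}(c_i)$, probability measures $\mu_i$ and sample sizes $n_i$, $i\in[k]$, as defined in the context. For every $i\in[k]$, assume that the probability space $(\mu_i,B^m_{r_i}(c_i))$ satisfies (a1), (a2), (a3). For every $i\in[k]$, assume $n_i=n$, $r_i=1$, and denote $E_i:=\mathbb{E}\,d(x,c_i)$, where $x$ is a random vector drawn according to $\mu_i$. Further assume $E_1=\cdots=E_k$. If for every $i\ne j$ we have $d(c_i,c_j)>2+1.29$, then (LP) achieves exact recovery with high probability.
   Context: Notation: $d$ is the Euclidean distance, $B^m_r(c)$ the closed ball of radius $r>0$ and center $c$ in $\mathbb{R}^m$, $[k]=\{1,\dots,k\}$. ESBM: for every $i\in[k]$, $(\mu_i,B^m_{r_i}(c_i))$ is a probability space (i.e. $\mu_i$ is a Borel probability measure on the ball) and $\beta_i\ge1$ is fixed. For each $i\in[k]$ one draws $n_i:=\beta_i n$ i.i.d. random vectors $x^{(i)}_\ell$, $\ell\in[n_i]$, according to $\mu_i$ (draws from different balls being independent). Here $\beta_i=1$. Assumptions: (a1) $\mu_i$ is invariant under rotations centered in $c_i$; (a2) every open subset of $B^m_{r_i}(c_i)$ containing $c_i$ has positive probability measure; (a3) every subset of $B^m_{r_i}(c_i)$ with zero Lebesgue measure has zero probability measure. With $P$ the set of all sampled points, (LP) is \[ \min \sum_{p,q\in P} d(p,q)z_{pq}\ \text{ s.t. }\ \sum_{p\in P}z_{pq}=1\ \forall q\in P;\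 z_{pq}\le y_p\ \forall p,q\in P;\ \sum_{p\in P}y_p=k;\ y_p,z_{pq}\ge0\ \forall p,q\in P, \] and (IP) is the same program with $y_p,z_{pq}\in\{0,1\}$. (LP) achieves exact recovery if it has a unique optimal solution, this solution is also feasible (thus optimal) to (IP), and it assigns each point to the ball from which it is drawn (exactly one point drawn from each ball has $y_p=1$, and $z_{pq}=1$ only if $p,q$ are drawn from the same ball). An event $A_n$ depending on the parameter $n$ happens with high probability if for every $\delta\in(0,1)$ there exists $N>0$ such that $\mathbb{P}(A_n)>1-\delta$ whenever $n>N$. *)

theory Defs
  imports "HOL-Probability.Probability"
begin

section \<open>Probability measures on balls\<close>

text \<open>The sigma-algebra is the Borel one on the ball itself, so \<open>space \<mu> = cball c r\<close>.\<close>

definition prob_on_ball :: "real ^ 'm \<Rightarrow> real \<Rightarrow> (real ^ 'm) measure \<Rightarrow> bool" where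
  "prob_on_ball c r \<mu> \<longleftrightarrow> prob_space \<mu> \<and> sets \<mu> = sets (restrict_space borel (cball c r))"

definition rotation_invariant :: "real ^ 'm \<Rightarrow> (real ^ 'm) measure \<Rightarrow> bool" where
  "rotation_invariant c \<mu> \<longleftrightarrow>
     (\<forall>Q :: real ^ 'm ^ 'm. rotation_matrix Q \<longrightarrow> distr \<mu> \<mu> (\<lambda>x. c + Q *v (x - c)) = \<mu>)"

definition charges_center :: "real ^ 'm \<Rightarrow> real \<Rightarrow> (real ^ 'm) measure \<Rightarrow> bool" where
  "charges_center c r \<mu> \<longleftrightarrow>
     (\<forall>U. openin (top_of_set (cball c r)) U \<and> c \<in> U \<longrightarrow> 0 < measure \<mu> U)"

text \<open>
  The library's \<open>absolutely_continuous lborel \<mu>\<close> does not apply, since \<open>lborel\<close> has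
  null sets outside of the ball. Quantifying over Borel null sets is no restriction: every
  Lebesgue null subset of the ball is contained in a Borel null subset of the ball.
\<close>

definition lebesgue_null_imp_null :: "(real ^ 'm) measure \<Rightarrow> bool" where
  "lebesgue_null_imp_null \<mu> \<longleftrightarrow>
     (\<forall>A \<in> sets \<mu>. emeasure lborel A = 0 \<longrightarrow> emeasure \<mu> A = 0)"

definition mean_dist :: "real ^ 'm \<Rightarrow> (real ^ 'm) measure \<Rightarrow> real" where
  "mean_dist c \<mu> = (\<integral>x. dist x c \<partial>\<mu>)"


section \<open>The extended stochastic ball model\<close>

text \<open>
  An outcome \<open>\<omega>\<close> assigns to \<open>(i, l)\<close> the \<open>l\<close>-th of the \<open>ns i\<close> points drawn from the \<open>i\<close>-th
  ball; under the product measure all draws are independent.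
\<close>

definition esbm ::
  "nat \<Rightarrow> (nat \<Rightarrow> (real ^ 'm) measure) \<Rightarrow> (nat \<Rightarrow> nat) \<Rightarrow> (nat \<times> nat \<Rightarrow> real ^ 'm) measure" where
  "esbm k \<mu> ns = (\<Pi>\<^sub>M (i, l) \<in> (SIGMA i:{1..k}. {1..ns i}). \<mu> i)"

definition drawn :: "(nat \<Rightarrow> nat) \<Rightarrow> (nat \<times> nat \<Rightarrow> 'a) \<Rightarrow> nat \<Rightarrow> 'a set" where
  "drawn ns \<omega> i = {\<omega> (i, l) | l. l \<in> {1..ns i}}"

definition whp :: "(nat \<Rightarrow> 'a measure) \<Rightarrow> (nat \<Rightarrow> 'a \<Rightarrow> bool) \<Rightarrow> bool" where
  "whp M A \<longleftrightarrow>
     (\<forall>\<delta> \<in> {0<..<1::real}. \<exists>N>0. \<forall>n>N. measure (M n) {\<omega> \<in> space (M n). A n \<omega>} > 1 - \<delta>)"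


section \<open>The linear and the integer program\<close>

definition lp_feasible ::
  "'a set \<Rightarrow> nat \<Rightarrow> ('a \<Rightarrow> real) \<Rightarrow> ('a \<Rightarrow> 'a \<Rightarrow> real) \<Rightarrow> bool" where
  "lp_feasible P k y z \<longleftrightarrow>
     (\<forall>q\<in>P. (\<Sum>p\<in>P. z p q) = 1) \<and>
     (\<forall>p\<in>P. \<forall>q\<in>P. z p q \<le> y p) \<and>
     (\<Sum>p\<in>P. y p) = real k \<and>
     (\<forall>p\<in>P. 0 \<le> y p) \<and>
     (\<forall>p\<in>P. \<forall>q\<in>P. 0 \<le> z p q)"

definition ip_feasible ::
  "'a set \<Rightarrow> nat \<Rightarrow> ('a \<Rightarrow> real) \<Rightarrow> ('a \<Rightarrow> 'a \<Rightarrow> real) \<Rightarrow> bool" where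
  "ip_feasible P k y z \<longleftrightarrow>
     lp_feasible P k y z \<and> (\<forall>p\<in>P. y p \<in> {0, 1}) \<and> (\<forall>p\<in>P. \<forall>q\<in>P. z p q \<in> {0, 1})"

definition lp_cost :: "'a::metric_space set \<Rightarrow> ('a \<Rightarrow> 'a \<Rightarrow> real) \<Rightarrow> real" where
  "lp_cost P z = (\<Sum>p\<in>P. \<Sum>q\<in>P. dist p q * z p q)"

definition lp_optimal ::
  "'a::metric_space set \<Rightarrow> nat \<Rightarrow> ('a \<Rightarrow> real) \<Rightarrow> ('a \<Rightarrow> 'a \<Rightarrow> real) \<Rightarrow> bool" where
  "lp_optimal P k y z \<longleftrightarrow>
     lp_feasible P k y z \<and> (\<forall>y' z'. lp_feasible P k y' z' \<longrightarrow> lp_cost P z \<le> lp_cost P z')"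

text \<open>
  \<open>S i\<close> is the set of points drawn from the \<open>i\<close>-th ball. The variables are total functions,
  so uniqueness of the solution means agreement on \<open>P\<close>.
\<close>

definition exact_recovery :: "nat \<Rightarrow> (nat \<Rightarrow> 'a::metric_space set) \<Rightarrow> bool" where
  "exact_recovery k S \<longleftrightarrow>
     (let P = (\<Union>i\<in>{1..k}. S i) in
      \<exists>y z. lp_optimal P k y z \<and>
        (\<forall>y' z'. lp_optimal P k y' z' \<longrightarrow>
           (\<forall>p\<in>P. y' p = y p) \<and> (\<forall>p\<in>P. \<forall>q\<in>P. z' p q = z p q)) \<and>
        ip_feasible P k y z \<and>
        (\<forall>i\<in>{1..k}. \<exists>!p. p \<in> S i \<and> y p = 1) \<and>
        (\<forall>p\<in>P. \<forall>q\<in>P. z p q = 1 \<longrightarrow> (\<exists>i\<in>{1..k}. p \<in> S i \<and> q \<in> S i)))"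

end

theory Submission
  imports Defs "HOL-Library.Periodic_Fun"
begin

text \<open>
  LP duality with the dual solution \<open>\<alpha>\<^sub>q = a - E + OPT\<^sub>i / n\<close> for \<open>q\<close> in the \<open>i\<close>-th sample, where \<open>OPT\<^sub>i\<close>
  is the cost of its medoid, and \<open>\<xi> = n (a - E)\<close>, with \<open>a = 1.47\<close>. Since \<open>OPT\<^sub>i / n\<close> tends to \<open>E\<close>,
  dual feasibility and strict complementarity reduce to
  \<open>\<Sum>\<^sub>j \<integral> max 0 (a - \<bar>p - x\<bar>) d\<mu>\<^sub>j < a - E\<close> for all \<open>p\<close> of a ball at distance \<open>s \<ge> 0.465\<close> from its center.
  Closer to the center no point of another ball matters, and uniqueness of the medoid suffices.

  By rotation invariance each integrand may be averaged over the six rotations by multiples of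
  \<open>\<pi>/3\<close> in a plane through \<open>p\<close> and the center of the ball. For the own ball this gives
  \<open>a - E - 0.002 - max 0 (s - 0.82) / 3\<close>; a ball with center at distance \<open>R\<close> from \<open>p\<close> contributes at most
  \<open>max 0 (a + 1 - R) / 3\<close>, and for at most one of the other balls this is nonzero.
\<close>

text \<open>Equal means let a single \<open>\<xi>\<close> be the price of a medoid in every ball. A
  sample point near its center may compete with the medoid at an arbitrarily small margin, so no law
  of large numbers separates the two; there strictness comes from (a3), which excludes ties almost
  surely. Away from the center the estimate must hold for every rotation-invariant measure. Pushing
  a point x radially to the unit sphere changes distances by at most 1 - |x| (origin at the center),
  with mean 1 - E, so only points of the sphere remain to be treated. Six points instead of the
  whole circle keep the averages free of elliptic integrals. The constants are coupled: 1 + 0.465 <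
  a, so a sample point within 0.465 of its center reaches its whole ball, while points of other
  balls are farther than 3.29 - 1 - 0.465 = 1.825 > a from it. Moreover 0.82 = 3.29 - (a + 1), and
  the margin 0.002 has to absorb all sampling errors. Since \<open>measure\<close> is 0 on
  non-measurable sets, the recovery event must also be shown measurable.\<close>

section \<open>A dual certificate for exact recovery\<close>

text \<open>Weak duality as an identity: the duality gap is a sum of complementary slackness
  products. Optimality follows when all products vanish, uniqueness from products with a strictly
  positive factor.\<close>

lemma lp_dual_gap:
  fixes P :: "'a::metric_space set"
  assumes feas: "lp_feasible P k y z"
  shows "lp_cost P z - (\<Sum>q\<in>P. \<alpha> q) + real k * \<xi> =
    (\<Sum>p\<in>P. \<Sum>q\<in>P. z p q * (dist p q - \<alpha> q + \<beta> p q)) +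
    (\<Sum>p\<in>P. \<Sum>q\<in>P. \<beta> p q * (y p - z p q)) + (\<Sum>p\<in>P. y p * (\<xi> - (\<Sum>q\<in>P. \<beta> p q)))"
proof -
  have "(\<Sum>p\<in>P. \<Sum>q\<in>P. z p q * \<alpha> q) = (\<Sum>q\<in>P. \<Sum>p\<in>P. z p q * \<alpha> q)"
    by (rule sum.swap)
  also have "\<dots> = (\<Sum>q\<in>P. \<alpha> q)"
    using feas by (simp add: lp_feasible_def flip: sum_distrib_right)
  finally have 1: "(\<Sum>p\<in>P. \<Sum>q\<in>P. z p q * \<alpha> q) = (\<Sum>q\<in>P. \<alpha> q)" .
  have 2: "(\<Sum>p\<in>P. y p * \<xi>) = real k * \<xi>"
    using feas by (simp add: lp_feasible_def flip: sum_distrib_right)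
  have 3: "(\<Sum>p\<in>P. \<Sum>q\<in>P. \<beta> p q * y p) = (\<Sum>p\<in>P. y p * (\<Sum>q\<in>P. \<beta> p q))"
    by (simp add: sum_distrib_left mult.commute)
  show ?thesis
    unfolding lp_cost_def using 1 2 3
    by (simp add: sum.distrib sum_subtractf algebra_simps)
qed

text \<open>\<open>M i\<close> is the medoid of the i-th sample and
  \<open>max 0 (\<alpha> j - dist p q)\<close> the dual variable of \<open>z p q \<le> y p\<close>.
  Strictness in \<open>slack\<close> forces \<open>y\<close> to vanish off the medoids, strictness
  in \<open>far\<close> forbids assigning a point to the medoid of another ball; so the optimal
  solution is unique.\<close>

lemma exact_recovery_of_dual_certificate:
  fixes S :: "nat \<Rightarrow> 'a::metric_space set"
  assumes fin: "\<And>i. i \<in> {1..k} \<Longrightarrow> finite (S i)"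
    and disj: "\<And>i j. i \<in> {1..k} \<Longrightarrow> j \<in> {1..k} \<Longrightarrow> i \<noteq> j \<Longrightarrow> S i \<inter> S j = {}"
    and M: "\<And>i. i \<in> {1..k} \<Longrightarrow> M i \<in> S i"
    and tight: "\<And>i. i \<in> {1..k} \<Longrightarrow> (\<Sum>q\<in>S i. \<alpha> i - dist (M i) q) = \<xi>"
    and near: "\<And>i q. i \<in> {1..k} \<Longrightarrow> q \<in> S i \<Longrightarrow> dist (M i) q \<le> \<alpha> i"
    and far: "\<And>i j q. i \<in> {1..k} \<Longrightarrow> j \<in> {1..k} \<Longrightarrow> i \<noteq> j \<Longrightarrow> q \<in> S j \<Longrightarrow> \<alpha> j < dist (M i) q"
    and slack: "\<And>i p. i \<in> {1..k} \<Longrightarrow> p \<in> S i \<Longrightarrow> p \<noteq> M i \<Longrightarrow>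
      (\<Sum>j\<in>{1..k}. \<Sum>q\<in>S j. max 0 (\<alpha> j - dist p q)) < \<xi>"
  shows "exact_recovery k S"
proof -
  define P where "P = (\<Union>i\<in>{1..k}. S i)"
  have finP: "finite P" using fin by (auto simp: P_def)
  have SP: "q \<in> P" if "i \<in> {1..k}" "q \<in> S i" for q i using that by (auto simp: P_def)
  have ex1: "\<exists>!i. i \<in> {1..k} \<and> q \<in> S i" if "q \<in> P" for q
    using that disj unfolding P_def by blast
  define b where "b q = (THE i. i \<in> {1..k} \<and> q \<in> S i)" for q
  have b: "b q \<in> {1..k}" "q \<in> S (b q)" if "q \<in> P" for q
    using theI'[OF ex1[OF that]] by (auto simp: b_def)
  have b_eq: "b q = i" if "i \<in> {1..k}" "q \<in> S i" for q i
    using b[OF SP[OF that]] ex1[OF SP[OF that]] that by blast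
  have sumP: "(\<Sum>q\<in>P. f (b q) q) = (\<Sum>j\<in>{1..k}. \<Sum>q\<in>S j. f j q)" for f :: "nat \<Rightarrow> 'a \<Rightarrow> real"
  proof -
    have "(\<Sum>q\<in>P. f (b q) q) = (\<Sum>j\<in>{1..k}. \<Sum>q\<in>S j. f (b q) q)"
      unfolding P_def by (rule sum.UNION_disjoint) (use fin disj in auto)
    also have "\<dots> = (\<Sum>j\<in>{1..k}. \<Sum>q\<in>S j. f j q)"
      by (intro sum.cong refl) (simp add: b_eq)
    finally show ?thesis .
  qed
  define A where "A q = \<alpha> (b q)" for q
  define \<beta> where "\<beta> p q = max 0 (A q - dist p q)" for p q
  define y0 where "y0 p = (if p = M (b p) then 1 else 0::real)" for p
  define z0 where "z0 p q = (if p = M (b q) then 1 else 0::real)" for p q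
  have Minj: "M i = M j \<longleftrightarrow> i = j" if "i \<in> {1..k}" "j \<in> {1..k}" for i j
    using M[OF that(1)] M[OF that(2)] disj[OF that] by (metis disjoint_iff)
  have bM: "b (M i) = i" if "i \<in> {1..k}" for i using M[OF that] that b_eq by auto
  have MP: "M i \<in> P" if "i \<in> {1..k}" for i using M[OF that] that SP by auto
  have sumM: "(\<Sum>j\<in>{1..k}. \<Sum>q\<in>S j. max 0 (\<alpha> j - dist (M i) q)) = \<xi>" if i: "i \<in> {1..k}" for i
  proof -
    have "(\<Sum>q\<in>S j. max 0 (\<alpha> j - dist (M i) q)) = (if j = i then \<xi> else 0)" if j: "j \<in> {1..k}" for j
    proof (cases "j = i")
      case True
      have "(\<Sum>q\<in>S i. max 0 (\<alpha> i - dist (M i) q)) = (\<Sum>q\<in>S i. \<alpha> i - dist (M i) q)"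
        by (intro sum.cong refl) (use near[OF i] in force)
      with True tight[OF i] show ?thesis by simp
    next
      case False
      have "(\<Sum>q\<in>S j. max 0 (\<alpha> j - dist (M i) q)) = (\<Sum>q\<in>S j. 0)"
        by (intro sum.cong refl) (use far[OF i j] False in force)
      with False show ?thesis by simp
    qed
    then have "(\<Sum>j\<in>{1..k}. \<Sum>q\<in>S j. max 0 (\<alpha> j - dist (M i) q)) = (\<Sum>j\<in>{1..k}. if j = i then \<xi> else 0)"
      by (intro sum.cong) auto
    also have "\<dots> = \<xi>" using i by simp
    finally show ?thesis .
  qed
  have beta_sum: "(\<Sum>q\<in>P. \<beta> p q) = (\<Sum>j\<in>{1..k}. \<Sum>q\<in>S j. max 0 (\<alpha> j - dist p q))" for p
    unfolding \<beta>_def A_def by (rule sumP[of "\<lambda>j q. max 0 (\<alpha> j - dist p q)"])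
  have beta_le: "(\<Sum>q\<in>P. \<beta> p q) \<le> \<xi>" if "p \<in> P" for p
    using slack[OF b[OF that]] sumM[OF b(1)[OF that]] beta_sum[of p]
    by (cases "p = M (b p)") (metis order.refl, metis less_imp_le)
  have yM: "(\<Sum>p\<in>P. g p) = (\<Sum>i\<in>{1..k}. g (M i))" if "\<And>p. p \<in> P \<Longrightarrow> p \<noteq> M (b p) \<Longrightarrow> g p = 0"
    for g :: "'a \<Rightarrow> real"
  proof -
    have "(\<Sum>p\<in>P. g p) = (\<Sum>p\<in>M ` {1..k}. g p)"
    proof (rule sum.mono_neutral_right[OF finP])
      show "M ` {1..k} \<subseteq> P" using MP by auto
      show "\<forall>p\<in>P - M ` {1..k}. g p = 0" using that b(1) by blast
    qed
    also have "\<dots> = (\<Sum>i\<in>{1..k}. g (M i))"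
      by (subst sum.reindex) (auto simp: inj_on_def Minj)
    finally show ?thesis .
  qed
  have feas0: "lp_feasible P k y0 z0"
  proof -
    have "(\<Sum>p\<in>P. z0 p q) = 1" if "q \<in> P" for q
      using finP MP[OF b(1)[OF that]] by (simp add: z0_def)
    moreover have "z0 p q \<le> y0 p" if "q \<in> P" for p q
      using bM[OF b(1)[OF that]] by (simp add: z0_def y0_def)
    moreover have "(\<Sum>p\<in>P. y0 p) = real k"
    proof -
      have "(\<Sum>p\<in>P. y0 p) = (\<Sum>i\<in>{1..k}. y0 (M i))" by (rule yM) (simp add: y0_def)
      also have "\<dots> = (\<Sum>i\<in>{1..k}. 1)" by (intro sum.cong refl) (simp add: y0_def bM)
      finally show ?thesis by simp
    qed
    ultimately show ?thesis by (auto simp: lp_feasible_def y0_def z0_def)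
  qed
  have terms0:
    "0 \<le> z p q * (dist p q - A q + \<beta> p q)" "0 \<le> \<beta> p q * (y p - z p q)"
    "0 \<le> y p * (\<xi> - (\<Sum>q\<in>P. \<beta> p q))"
    if "lp_feasible P k y z" "p \<in> P" "q \<in> P" for y z p q
    using that beta_le[OF that(2)] by (auto simp: lp_feasible_def \<beta>_def intro!: mult_nonneg_nonneg)
  have lower: "(\<Sum>q\<in>P. A q) - real k * \<xi> \<le> lp_cost P z" if "lp_feasible P k y z" for y z
  proof -
    have "0 \<le> (\<Sum>p\<in>P. \<Sum>q\<in>P. z p q * (dist p q - A q + \<beta> p q))"
      "0 \<le> (\<Sum>p\<in>P. \<Sum>q\<in>P. \<beta> p q * (y p - z p q))"
      "0 \<le> (\<Sum>p\<in>P. y p * (\<xi> - (\<Sum>q\<in>P. \<beta> p q)))"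
      by (intro sum_nonneg terms0[OF that]; assumption)+
    then show ?thesis using lp_dual_gap[OF that, of A \<xi> \<beta>] by linarith
  qed
  have opt0: "lp_cost P z0 = (\<Sum>q\<in>P. A q) - real k * \<xi>"
  proof -
    have c1: "z0 p q * (dist p q - A q + \<beta> p q) = 0" if "q \<in> P" for p q
      using near[OF b(1)[OF that] b(2)[OF that]] by (auto simp: z0_def \<beta>_def A_def)
    have c2: "\<beta> p q * (y0 p - z0 p q) = 0" if "p \<in> P" "q \<in> P" for p q
    proof (cases "p = M (b p) \<and> b p \<noteq> b q")
      case True
      then show ?thesis using far[OF b(1)[OF that(1)] b(1)[OF that(2)] _ b(2)[OF that(2)]]
        by (simp add: \<beta>_def A_def)
    next
      case False
      then have "y0 p = z0 p q" unfolding y0_def z0_def using bM[OF b(1)[OF that(2)]] by metis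
      then show ?thesis by simp
    qed
    have c3: "y0 p * (\<xi> - (\<Sum>q\<in>P. \<beta> p q)) = 0" if "p \<in> P" for p
    proof (cases "p = M (b p)")
      case True
      then have "(\<Sum>q\<in>P. \<beta> p q) = \<xi>" using sumM[OF b(1)[OF that]] beta_sum[of p] by metis
      then show ?thesis by simp
    qed (simp add: y0_def)
    have "(\<Sum>p\<in>P. \<Sum>q\<in>P. z0 p q * (dist p q - A q + \<beta> p q)) = 0"
      "(\<Sum>p\<in>P. \<Sum>q\<in>P. \<beta> p q * (y0 p - z0 p q)) = 0"
      "(\<Sum>p\<in>P. y0 p * (\<xi> - (\<Sum>q\<in>P. \<beta> p q))) = 0"
      by (intro sum.neutral ballI c1 c2 c3; assumption)+
    then show ?thesis using lp_dual_gap[OF feas0, of A \<xi> \<beta>] by linarith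
  qed
  have opt: "lp_optimal P k y0 z0"
    using feas0 lower opt0 by (auto simp: lp_optimal_def)
  have uniq: "(\<forall>p\<in>P. y p = y0 p) \<and> (\<forall>p\<in>P. \<forall>q\<in>P. z p q = z0 p q)" if "lp_optimal P k y z" for y z
  proof -
    have feas: "lp_feasible P k y z" using that by (simp add: lp_optimal_def)
    have "lp_cost P z = lp_cost P z0"
      using that opt feas feas0 by (fastforce simp: lp_optimal_def)
    then have gap: "(\<Sum>p\<in>P. \<Sum>q\<in>P. z p q * (dist p q - A q + \<beta> p q)) +
      (\<Sum>p\<in>P. \<Sum>q\<in>P. \<beta> p q * (y p - z p q)) + (\<Sum>p\<in>P. y p * (\<xi> - (\<Sum>q\<in>P. \<beta> p q))) = 0"
      using lp_dual_gap[OF feas, of A \<xi> \<beta>] opt0 by simp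
    have nn: "0 \<le> (\<Sum>p\<in>P. \<Sum>q\<in>P. z p q * (dist p q - A q + \<beta> p q))"
      "0 \<le> (\<Sum>p\<in>P. \<Sum>q\<in>P. \<beta> p q * (y p - z p q))"
      "0 \<le> (\<Sum>p\<in>P. y p * (\<xi> - (\<Sum>q\<in>P. \<beta> p q)))"
      by (intro sum_nonneg terms0[OF feas]; assumption)+
    have 1: "(\<Sum>p\<in>P. \<Sum>q\<in>P. z p q * (dist p q - A q + \<beta> p q)) = 0"
      and 3: "(\<Sum>p\<in>P. y p * (\<xi> - (\<Sum>q\<in>P. \<beta> p q))) = 0"
      using gap nn by linarith+
    have z1: "z p q * (dist p q - A q + \<beta> p q) = 0" if "p \<in> P" "q \<in> P" for p q
    proof -
      have "(\<Sum>q\<in>P. z p q * (dist p q - A q + \<beta> p q)) = 0"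
        by (rule sum_nonneg_0[OF finP _ 1 that(1)]) (intro sum_nonneg terms0(1)[OF feas]; assumption)
      from sum_nonneg_0[OF finP _ this that(2)] show ?thesis
        using terms0(1)[OF feas that(1)] by blast
    qed
    have y1: "y p * (\<xi> - (\<Sum>q\<in>P. \<beta> p q)) = 0" if "p \<in> P" for p
      by (rule sum_nonneg_0[OF finP _ 3 that]) (rule terms0(3)[OF feas]; assumption)
    have y_non: "y p = 0" if "p \<in> P" "p \<noteq> M (b p)" for p
      using y1[OF that(1)] slack[OF b[OF that(1)] that(2)] unfolding beta_sum[symmetric] by simp
    have z_non: "z p q = 0" if "p \<in> P" "q \<in> P" "p \<noteq> M (b q)" for p q
    proof (cases "p = M (b p)")
      case True
      then have "A q < dist p q"
        using far[OF b(1)[OF that(1)] b(1)[OF that(2)] _ b(2)[OF that(2)]] that(3)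
        unfolding A_def by metis
      then show ?thesis using z1[OF that(1,2)] by (auto simp: \<beta>_def)
    next
      case False
      then have "y p = 0" by (rule y_non[OF that(1)])
      moreover have "z p q \<le> y p" "0 \<le> z p q" using feas that by (auto simp: lp_feasible_def)
      ultimately show ?thesis by linarith
    qed
    have z_M: "z (M (b q)) q = 1" if "q \<in> P" for q
    proof -
      have "(\<Sum>p\<in>P. z p q) = (\<Sum>p\<in>P. if p = M (b q) then z (M (b q)) q else 0)"
        by (intro sum.cong refl) (use z_non that in auto)
      also have "\<dots> = z (M (b q)) q" using finP MP[OF b(1)[OF that]] by simp
      finally show ?thesis using feas that by (simp add: lp_feasible_def)
    qed
    \<comment> \<open>Each medoid serves itself completely, so its \<open>y\<close> is at least 1;
      as these k values sum to k, all are equal to 1.\<close>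
    have yge: "1 \<le> y (M i)" if "i \<in> {1..k}" for i
      using z_M[OF MP[OF that]] bM[OF that] feas MP[OF that] by (force simp: lp_feasible_def)
    have "(\<Sum>i\<in>{1..k}. y (M i)) = real k"
      using yM[of y] y_non feas by (simp add: lp_feasible_def)
    then have "(\<Sum>i\<in>{1..k}. y (M i) - 1) = 0" by (simp add: sum_subtractf)
    then have "y (M i) = 1" if "i \<in> {1..k}" for i
      using yge that by (subst (asm) sum_nonneg_eq_0_iff) auto
    then have "y p = y0 p" if "p \<in> P" for p
      using y_non[OF that] b(1)[OF that] by (cases "p = M (b p)") (metis y0_def)+
    moreover have "z p q = z0 p q" if "p \<in> P" "q \<in> P" for p q
      using z_non[OF that] z_M[OF that(2)] by (auto simp: z0_def)
    ultimately show ?thesis by blast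
  qed
  have "ip_feasible P k y0 z0" using feas0 by (auto simp: ip_feasible_def y0_def z0_def)
  moreover have "\<exists>!p. p \<in> S i \<and> y0 p = 1" if "i \<in> {1..k}" for i
  proof (rule ex1I[of _ "M i"])
    show "M i \<in> S i \<and> y0 (M i) = 1" using M[OF that] bM[OF that] by (simp add: y0_def)
    show "p = M i" if "p \<in> S i \<and> y0 p = 1" for p
      using that b_eq[OF \<open>i \<in> {1..k}\<close>, of p] by (auto simp: y0_def split: if_splits)
  qed
  moreover have "\<exists>i\<in>{1..k}. p \<in> S i \<and> q \<in> S i" if "q \<in> P" "z0 p q = 1" for p q
    using that(2) b[OF that(1)] M[OF b(1)[OF that(1)]] by (auto simp: z0_def split: if_splits)
  ultimately show ?thesis
    unfolding exact_recovery_def Let_def P_def[symmetric] using opt uniq by blast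
qed

section \<open>Six-point averages on the circle\<close>

lemma sum_lessThan_6: "(\<Sum>j<6. f j) = f 0 + f 1 + f 2 + f 3 + f 4 + f (5::nat)"
  for f :: "nat \<Rightarrow> real"
  by (simp add: eval_nat_numeral)

lemma cos_add_sixths:
  "cos (x + pi/3) = cos x / 2 - sqrt 3 / 2 * sin x"
  "cos (x + 2*pi/3) = - cos x / 2 - sqrt 3 / 2 * sin x"
  "cos (x + pi) = - cos x"
  "cos (x + 4*pi/3) = - cos x / 2 + sqrt 3 / 2 * sin x"
  "cos (x + 5*pi/3) = cos x / 2 + sqrt 3 / 2 * sin x"
proof -
  show 1: "cos (x + pi/3) = cos x / 2 - sqrt 3 / 2 * sin x" for x
    by (simp add: cos_add cos_60 sin_60)
  show 2: "cos (x + 2*pi/3) = - cos x / 2 - sqrt 3 / 2 * sin x" for x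
    by (simp add: cos_add cos_120 sin_120)
  show 3: "cos (x + pi) = - cos x" for x by simp
  show "cos (x + 4*pi/3) = - cos x / 2 + sqrt 3 / 2 * sin x"
    using 1[of "x + pi"] by (simp add: algebra_simps add_divide_distrib)
  show "cos (x + 5*pi/3) = cos x / 2 + sqrt 3 / 2 * sin x"
    using 2[of "x + pi"] by (simp add: algebra_simps add_divide_distrib)
qed

lemma sum_cos_sixths:
  "(\<Sum>j<6. cos (x + real j * (pi/3))) = 0" "(\<Sum>j<6. (cos (x + real j * (pi/3)))\<^sup>2) = 3"
proof -
  have *: "cos (x + pi * 2 / 3) = - cos x / 2 - sqrt 3 / 2 * sin x"
     "cos (x + pi * 4 / 3) = - cos x / 2 + sqrt 3 / 2 * sin x"
     "cos (x + pi * 5 / 3) = cos x / 2 + sqrt 3 / 2 * sin x"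
    using cos_add_sixths[of x] by (simp_all add: mult.commute)
  show "(\<Sum>j<6. cos (x + real j * (pi/3))) = 0"
    by (simp add: sum_lessThan_6 cos_add_sixths * mult.commute)
  have sq: "C\<^sup>2 + (C / 2 - sqrt 3 / 2 * S)\<^sup>2 + (- C / 2 - sqrt 3 / 2 * S)\<^sup>2 + (- C)\<^sup>2 +
    (- C / 2 + sqrt 3 / 2 * S)\<^sup>2 + (C / 2 + sqrt 3 / 2 * S)\<^sup>2 = 3 * (C\<^sup>2 + S\<^sup>2)" for C S :: real
    by (simp add: power2_sum power2_diff power_mult_distrib power_divide field_simps)
  show "(\<Sum>j<6. (cos (x + real j * (pi/3)))\<^sup>2) = 3"
    using sq[of "cos x" "sin x"] unfolding sin_cos_squared_add2
    by (simp add: sum_lessThan_6 cos_add_sixths * mult.commute)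
qed

text \<open>The parabola \<open>\<tau> (1 + 2 v)\<^sup>2 / 9\<close> majorises \<open>max 0 (\<tau> - 1 + v)\<close> on \<open>v \<le> 1\<close> and agrees
  with it at \<open>v = 1\<close>; its average only involves the first two trigonometric moments.\<close>

lemma six_point_far:
  fixes \<tau> \<rho> \<psi> :: real
  assumes \<tau>: "0 \<le> \<tau>" "\<tau> \<le> 3/4" and \<rho>: "0 \<le> \<rho>" "\<rho> \<le> 1"
  shows "(\<Sum>j<6. max 0 (\<tau> - 1 + \<rho> * cos (\<psi> + real j * (pi/3)))) \<le> 2 * \<tau>"
proof -
  let ?v = "\<lambda>j. cos (\<psi> + real j * (pi/3))"
  have par: "max 0 (\<tau> - 1 + v) \<le> \<tau> * (1 + 2 * v)\<^sup>2 / 9" if "v \<le> 1" for v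
  proof -
    \<comment> \<open>Expansion of the difference around the common point v = 1; the linear
      coefficient is nonnegative because \<tau> is at most 3/4.\<close>
    have "0 \<le> (1 - v) * (1 - 4 * \<tau> / 3) + \<tau> * (4 * (1 - v)\<^sup>2) / 9"
      using \<tau> that by (intro add_nonneg_nonneg mult_nonneg_nonneg divide_nonneg_nonneg) auto
    also have "\<dots> = \<tau> * (1 + 2 * v)\<^sup>2 / 9 - (\<tau> - 1 + v)"
      by (simp add: power2_eq_square field_simps)
    finally have "\<tau> - 1 + v \<le> \<tau> * (1 + 2 * v)\<^sup>2 / 9" by simp
    moreover have "0 \<le> \<tau> * (1 + 2 * v)\<^sup>2 / 9" using \<tau> by simp
    ultimately show ?thesis by (rule max.boundedI[rotated])
  qed
  have "\<rho> * ?v j \<le> 1" for j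
    by (metis \<rho> cos_le_one mult.commute mult_left_le_one_le mult_right_mono order.trans zero_le_one mult_1)
  then have "(\<Sum>j<6. max 0 (\<tau> - 1 + \<rho> * ?v j)) \<le> (\<Sum>j<6. \<tau> * (1 + 2 * (\<rho> * ?v j))\<^sup>2 / 9)"
    by (intro sum_mono par)
  also have "\<dots> = (\<Sum>j<6. \<tau> / 9 + 4 * \<tau> * \<rho> / 9 * ?v j + 4 * \<tau> * \<rho>\<^sup>2 / 9 * (?v j)\<^sup>2)"
    by (intro sum.cong refl) (simp add: power2_eq_square field_simps)
  also have "\<dots> = 6 * \<tau> / 9 + 4 * \<tau> * \<rho> / 9 * (\<Sum>j<6. ?v j) + 4 * \<tau> * \<rho>\<^sup>2 / 9 * (\<Sum>j<6. (?v j)\<^sup>2)"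
    by (simp add: sum.distrib sum_distrib_left)
  also have "\<dots> = 2 * \<tau> / 3 + 4 / 3 * (\<tau> * \<rho>\<^sup>2)" unfolding sum_cos_sixths by simp
  also have "\<dots> \<le> 2 * \<tau>"
    using mult_left_mono[OF power_le_one[OF \<rho>, of 2] \<tau>(1)] by simp
  finally show ?thesis .
qed

text \<open>The sum over the six shifts has period pi/3, so \<psi> may be moved into [0, pi/3]. Then
  every node lies between two neighbouring multiples of pi/3 within the single period on which
  \<open>F\<close> is convex, and interpolation bounds the sum by its two end values, which agree by
  periodicity.\<close>

lemma sum_sixths_le_at_0:
  fixes F :: "real \<Rightarrow> real"
  assumes per: "\<And>x. F (x + 2 * pi) = F x" and conv: "convex_on {0..2*pi} F"
  shows "(\<Sum>j<6. F (\<psi> + real j * (pi/3))) \<le> (\<Sum>j<6. F (real j * (pi/3)))"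
proof -
  define g where "g x = (\<Sum>j<6. F (x + real j * (pi/3)))" for x
  have gs: "g (x + pi/3) = g x" for x
    using per[of x] by (simp add: g_def sum_lessThan_6 algebra_simps add_divide_distrib)
  interpret periodic_fun_simple g "pi/3" by standard (rule gs)
  define m where "m = \<lfloor>\<psi> / (pi/3)\<rfloor>"
  define x where "x = \<psi> - of_int m * (pi/3)"
  have "g \<psi> = g x" unfolding x_def by (simp only: minus_of_int)
  have "of_int m \<le> \<psi> / (pi/3)" "\<psi> / (pi/3) < of_int m + 1" unfolding m_def by linarith+
  then have x: "0 \<le> x" "x \<le> pi/3" by (simp_all add: x_def field_simps)
  define t where "t = x / (pi/3)"
  have t: "0 \<le> t" "t \<le> 1" "x = t * (pi/3)" using x by (simp_all add: t_def field_simps)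
  have "F (x + real j * (pi/3)) \<le> (1 - t) * F (real j * (pi/3)) + t * F (real j * (pi/3) + pi/3)"
    if "j < 6" for j
  proof -
    have "real j \<le> 5" using that by simp
    then have "real j * pi \<le> 5 * pi" by (intro mult_right_mono) auto
    then have jpi: "real j * (pi/3) + pi/3 \<le> 2 * pi" "real j * (pi/3) \<le> 2 * pi"
      using pi_gt_zero by linarith+
    then have "F ((1 - t) *\<^sub>R (real j * (pi/3)) + t *\<^sub>R (real j * (pi/3) + pi/3)) \<le>
       (1 - t) * F (real j * (pi/3)) + t * F (real j * (pi/3) + pi/3)"
      using t jpi by (intro convex_onD[OF conv]) (auto intro!: add_nonneg_nonneg simp del: divide_le_eq_numeral1)
    moreover have "(1 - t) *\<^sub>R (real j * (pi/3)) + t *\<^sub>R (real j * (pi/3) + pi/3) = x + real j * (pi/3)"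
      unfolding t(3) real_scaleR_def by argo
    ultimately show ?thesis by simp
  qed
  then have "g x \<le> (\<Sum>j<6. (1 - t) * F (real j * (pi/3)) + t * F (real j * (pi/3) + pi/3))"
    unfolding g_def by (intro sum_mono) auto
  also have "\<dots> = (1 - t) * g 0 + t * g (0 + pi/3)"
    by (simp add: g_def sum.distrib sum_distrib_left add.commute)
  also have "\<dots> = g 0" unfolding gs by (simp add: algebra_simps)
  finally show ?thesis using \<open>g \<psi> = g x\<close> by (simp add: g_def)
qed

lemma max_0_convex_combination:
  fixes a A B t :: real
  assumes "0 \<le> t" "t \<le> 1"
  shows "max 0 (a - ((1 - t) * A + t * B)) \<le> (1 - t) * max 0 (a - A) + t * max 0 (a - B)"
proof -
  have "(1 - t) * (a - A) \<le> (1 - t) * max 0 (a - A)" "t * (a - B) \<le> t * max 0 (a - B)"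
    using assms by (intro mult_left_mono; simp)+
  moreover have "a - ((1 - t) * A + t * B) = (1 - t) * (a - A) + t * (a - B)"
    by (simp add: algebra_simps)
  moreover have "0 \<le> (1 - t) * max 0 (a - A) + t * max 0 (a - B)" using assms by simp
  ultimately show ?thesis by linarith
qed

lemma sin_half_concave:
  fixes x y t :: real
  assumes "0 \<le> t" "t \<le> 1" "x \<in> {0..2*pi}" "y \<in> {0..2*pi}"
  shows "(1 - t) * sin (x/2) + t * sin (y/2) \<le> sin (((1 - t) * x + t * y) / 2)"
proof -
  have "convex_on {0..2*pi} (\<lambda>x. - sin (x/2))"
  proof (rule f''_ge0_imp_convex)
    show "((\<lambda>x. - sin (x/2)) has_real_derivative - cos (x/2) / 2) (at x)" for x
      by (auto intro!: derivative_eq_intros)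
    show "((\<lambda>x. - cos (x/2) / 2) has_real_derivative sin (x/2) / 4) (at x)" for x
      by (auto intro!: derivative_eq_intros)
    show "0 \<le> sin (x/2) / 4" if "x \<in> {0..2*pi}" for x
      using that by (simp add: sin_ge_zero)
  qed simp
  from convex_onD[OF this assms] show ?thesis by simp
qed

lemma sin_twelfths: "sin (pi / 6) = 1/2" "sin (pi * 2 / 6) = sqrt 3 / 2" "sin (pi * 3 / 6) = 1"
  "sin (pi * 4 / 6) = sqrt 3 / 2" "sin (pi * 5 / 6) = 1/2"
proof -
  show "sin (pi / 6) = 1/2" by (rule sin_30)
  show "sin (pi * 2 / 6) = sqrt 3 / 2" using sin_60 by simp
  show "sin (pi * 3 / 6) = 1" by simp
  show "sin (pi * 4 / 6) = sqrt 3 / 2" using sin_120 by (simp add: mult.commute)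
  have "sin (pi * 5 / 6) = sin (pi - pi / 6)" by (rule arg_cong[of _ _ sin]) simp
  then show "sin (pi * 5 / 6) = 1/2" using sin_pi_minus[of "pi/6"] sin_30 by simp
qed

text \<open>The distance from \<open>(s, 0)\<close> to \<open>(cos \<theta>, sin \<theta>)\<close> is the hypotenuse over \<open>1 - s\<close> and
  \<open>2 sqrt s \<bar>sin (\<theta>/2)\<bar>\<close>. Any unit vector \<open>(u, v)\<close> turns it into a lower bound that is a
  concave function of \<open>\<theta>\<close> on \<open>[0, 2 \<pi>]\<close>.\<close>

lemma six_point_circle:
  fixes a s u v \<psi> :: real
  assumes s: "0 \<le> s" "s \<le> 1" and uv: "0 \<le> u" "0 \<le> v" "u\<^sup>2 + v\<^sup>2 = 1"
  shows "(\<Sum>j<6. max 0 (a - sqrt (s\<^sup>2 + 1 - 2 * s * cos (\<psi> + real j * (pi/3))))) \<le>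
    max 0 (a - u * (1 - s)) + 2 * max 0 (a - u * (1 - s) - v * sqrt s) +
    2 * max 0 (a - u * (1 - s) - v * sqrt 3 * sqrt s) + max 0 (a - u * (1 - s) - 2 * v * sqrt s)"
proof -
  define K where "K = 2 * v * sqrt s"
  define F where "F \<theta> = max 0 (a - u * (1 - s) - K * \<bar>sin (\<theta>/2)\<bar>)" for \<theta> :: real
  have K: "0 \<le> K" using s uv by (simp add: K_def)
  have dist_ge: "u * (1 - s) + K * \<bar>sin (\<theta>/2)\<bar> \<le> sqrt (s\<^sup>2 + 1 - 2 * s * cos \<theta>)" for \<theta>
  proof (rule real_le_rsqrt)
    define w where "w = 2 * sqrt s * \<bar>sin (\<theta>/2)\<bar>"
    have c: "cos \<theta> = 1 - 2 * (sin (\<theta>/2))\<^sup>2" using cos_double_sin[of "\<theta>/2"] by simp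
    have e1: "s\<^sup>2 + 1 - 2 * s * cos \<theta> = (1 - s)\<^sup>2 + w\<^sup>2"
      using s unfolding c w_def by (simp add: power_mult_distrib power2_eq_square algebra_simps)
    \<comment> \<open>Lagrange's identity: Cauchy-Schwarz for \<open>(u, v)\<close> and
      \<open>(1 - s, w)\<close> with its remainder written out.\<close>
    have e2: "(u * (1 - s) + v * w)\<^sup>2 + (u * w - v * (1 - s))\<^sup>2 = (u\<^sup>2 + v\<^sup>2) * ((1 - s)\<^sup>2 + w\<^sup>2)"
      by (simp add: power2_eq_square algebra_simps)
    have e3: "K * \<bar>sin (\<theta>/2)\<bar> = v * w" by (simp add: K_def w_def)
    show "(u * (1 - s) + K * \<bar>sin (\<theta>/2)\<bar>)\<^sup>2 \<le> s\<^sup>2 + 1 - 2 * s * cos \<theta>"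
      using zero_le_power2[of "u * w - v * (1 - s)"] e2 unfolding uv(3) mult_1_left e1 e3 by linarith
  qed
  have per: "F (\<theta> + 2 * pi) = F \<theta>" for \<theta>
    by (simp add: F_def add_divide_distrib)
  have conv: "convex_on {0..2*pi} F"
  proof (rule convex_onI)
    fix t x y :: real
    assume t: "0 < t" "t < 1" and x: "x \<in> {0..2*pi}" and y: "y \<in> {0..2*pi}"
    let ?z = "(1 - t) * x + t * y"
    have z: "?z \<in> {0..2*pi}"
      using convexD_alt[of "{0..2*pi}" x y t] x y t by simp
    have abs: "\<bar>sin (w/2)\<bar> = sin (w/2)" if "w \<in> {0..2*pi}" for w
      using that by (simp add: sin_ge_zero)
    have "K * ((1 - t) * sin (x/2) + t * sin (y/2)) \<le> K * sin (?z/2)"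
      using sin_half_concave[of t x y] t x y K by (intro mult_left_mono) auto
    then have "F ?z \<le> max 0 (a - u * (1 - s) - ((1 - t) * (K * sin (x/2)) + t * (K * sin (y/2))))"
      unfolding F_def abs[OF z] by (simp add: algebra_simps max.coboundedI2)
    also have "\<dots> \<le> (1 - t) * F x + t * F y"
      unfolding F_def abs[OF x] abs[OF y] using t by (intro max_0_convex_combination) auto
    finally show "F ((1 - t) *\<^sub>R x + t *\<^sub>R y) \<le> (1 - t) * F x + t * F y" by simp
  qed simp
  have "(\<Sum>j<6. max 0 (a - sqrt (s\<^sup>2 + 1 - 2 * s * cos (\<psi> + real j * (pi/3))))) \<le>
    (\<Sum>j<6. F (\<psi> + real j * (pi/3)))"
    unfolding F_def
  proof (intro sum_mono max.mono order.refl)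
    fix j :: nat
    show "a - sqrt (s\<^sup>2 + 1 - 2 * s * cos (\<psi> + real j * (pi/3))) \<le>
      a - u * (1 - s) - K * \<bar>sin ((\<psi> + real j * (pi/3)) / 2)\<bar>"
      using dist_ge[of "\<psi> + real j * (pi/3)"] by linarith
  qed
  also have "\<dots> \<le> (\<Sum>j<6. F (real j * (pi/3)))"
    by (rule sum_sixths_le_at_0[OF per conv])
  also have "\<dots> = (\<Sum>j<6. max 0 (a - u * (1 - s) - K * \<bar>sin (pi * real j / 6)\<bar>))"
    by (simp add: F_def mult.commute)
  also have "\<dots> = max 0 (a - u * (1 - s)) + 2 * max 0 (a - u * (1 - s) - v * sqrt s) +
    2 * max 0 (a - u * (1 - s) - v * sqrt 3 * sqrt s) + max 0 (a - u * (1 - s) - 2 * v * sqrt s)"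
    unfolding sum_lessThan_6 of_nat_numeral of_nat_0 of_nat_1 mult_zero_right mult_1_right sin_twelfths
    by (simp add: K_def algebra_simps)
  finally show ?thesis .
qed

text \<open>The unit vector \<open>(28/53, 45/53)\<close> is used for \<open>s \<le> 0.8\<close>, where \<open>sqrt s\<close> is bounded below by a chord, and
  \<open>(0, 1)\<close> beyond. The slack at \<open>s = 0.465\<close> is less than \<open>0.001\<close>.\<close>

lemma six_point_near_circle:
  fixes s \<psi> :: real
  assumes s: "0.465 \<le> s" "s \<le> 1"
  shows "(\<Sum>j<6. max 0 (1.47 - sqrt (s\<^sup>2 + 1 - 2 * s * cos (\<psi> + real j * (pi/3))))) \<le>
    6 * (0.468 - max 0 (s - 0.82) / 3)"
proof (cases "s \<le> 0.8")
  case True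
  define L where "L = 0.38699 + 0.634 * s"
  \<comment> \<open>The product replaces s^2 by its chord over [0.465, 0.8], after which
    \<open>L\<^sup>2 \<le> s\<close> is a linear inequality in s. \<open>L\<close> is the chord of
    the square root over the same interval with coefficients rounded so as to stay below it.\<close>
  have "0 \<le> (s - 0.465) * (0.8 - s)" using s True by (intro mult_nonneg_nonneg) simp_all
  also have "(s - 0.465) * (0.8 - s) = 1.265 * s - 0.372 - s\<^sup>2"
    by (simp add: power2_eq_square field_simps)
  finally have "s\<^sup>2 \<le> 1.265 * s - 0.372" by simp
  moreover have "L\<^sup>2 = 0.38699\<^sup>2 + 2 * 0.38699 * 0.634 * s + 0.634\<^sup>2 * s\<^sup>2"
    unfolding L_def by (simp only: power2_sum power_mult_distrib)
  ultimately have "L\<^sup>2 \<le> s" using s True by (simp add: power2_eq_square)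
  then have L: "L \<le> sqrt s" by (rule real_le_rsqrt)
  have 3: "1.732 \<le> sqrt (3::real)" by (rule real_le_rsqrt) (simp add: power2_eq_square)
  have "1.732 * L \<le> sqrt 3 * sqrt s" by (rule mult_mono[OF 3 L]) (use s in \<open>auto simp: L_def\<close>)
  then have w: "1.732 * L \<le> w" if "w = sqrt 3 * sqrt s" for w using that by simp
  \<comment> \<open>With \<open>q\<close> and \<open>w\<close> in place of \<open>sqrt s\<close> and
    \<open>sqrt 3 * sqrt s\<close>, each case of the maxima is linear arithmetic. The Pythagorean
    triple 28, 45, 53 gives a unit vector with rational entries.\<close>
  have num: "max 0 (1.47 - 28/53 * (1 - s)) + 2 * max 0 (1.47 - 28/53 * (1 - s) - 45/53 * q) +
      2 * max 0 (1.47 - 28/53 * (1 - s) - 45/53 * w) + max 0 (1.47 - 28/53 * (1 - s) - 2 * (45/53) * q)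
      \<le> 6 * (0.468 - max 0 (s - 0.82) / 3)" if "L \<le> q" "1.732 * L \<le> w" for q w
    using that s True unfolding L_def max_def
    by (simp add: diff_divide_distrib split: if_split)
  show ?thesis
    using six_point_circle[of s "28/53" "45/53" "1.47" \<psi>] num[OF L w[OF refl]] s
    by (simp only: power2_eq_square mult.assoc) simp
next
  case False
  \<comment> \<open>0.894 is the square root of 0.8, rounded down.\<close>
  have q1: "0.894 \<le> sqrt s" by (rule real_le_rsqrt) (use False in \<open>simp add: power2_eq_square\<close>)
  have q2: "s \<le> sqrt s" by (rule real_le_rsqrt) (use s in \<open>simp add: power2_eq_square mult_left_le\<close>)
  have "1.732 \<le> sqrt (3::real)" by (rule real_le_rsqrt) (simp add: power2_eq_square)
  then have q3: "1.732 * 0.894 \<le> sqrt 3 * sqrt s" by (rule mult_mono) (use q1 s in auto)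
  have num: "max 0 1.47 + 2 * max 0 (1.47 - q) + 2 * max 0 (1.47 - w) + max 0 (1.47 - 2 * q)
      \<le> 6 * (0.468 - max 0 (s - 0.82) / 3)" if "0.894 \<le> q" "s \<le> q" "1.732 * 0.894 \<le> w" for q w
    using that s False unfolding max_def by (simp add: diff_divide_distrib split: if_split)
  show ?thesis
    using six_point_circle[of s 0 1 "1.47" \<psi>] num[OF q1 q2 q3] s by simp
qed

text \<open>In higher dimensions a unit vector projects to the plane of rotation with some norm
  \<rho> at most 1. The sum is bounded by a convex combination of its values at \<rho> = 1, the
  circle, and \<rho> = 0, where all six distances equal \<open>sqrt (s\<^sup>2 + 1)\<close>.\<close>

lemma six_point_near:
  fixes s \<rho> \<psi> :: real
  assumes s: "0.465 \<le> s" "s \<le> 1" and \<rho>: "0 \<le> \<rho>" "\<rho> \<le> 1"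
  shows "(\<Sum>j<6. max 0 (1.47 - sqrt (s\<^sup>2 + 1 - 2 * s * (\<rho> * cos (\<psi> + real j * (pi/3)))))) \<le>
    6 * (0.468 - max 0 (s - 0.82) / 3)"
proof -
  let ?A = "sqrt (s\<^sup>2 + 1)" and ?B = "\<lambda>x. sqrt (s\<^sup>2 + 1 - 2 * s * cos x)"
  have sq: "(?B x)\<^sup>2 = s\<^sup>2 + 1 - 2 * s * cos x" for x
  proof -
    have "s * cos x \<le> s" using s by (simp add: mult_left_le)
    moreover have "0 \<le> (s - 1)\<^sup>2" by simp
    ultimately have "0 \<le> s\<^sup>2 + 1 - 2 * s * cos x" by (simp add: power2_eq_square algebra_simps)
    then show ?thesis by simp
  qed
  \<comment> \<open>Concavity of the square root in \<open>\<rho>\<close>, between the center (\<open>\<rho> = 0\<close>) and the unit circle.\<close>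
  have mix: "(1 - \<rho>) * ?A + \<rho> * ?B x \<le> sqrt (s\<^sup>2 + 1 - 2 * s * (\<rho> * cos x))" for x
  proof (rule real_le_rsqrt)
    have "((1 - \<rho>) * ?A + \<rho> * ?B x)\<^sup>2 + \<rho> * (1 - \<rho>) * (?A - ?B x)\<^sup>2 =
      (1 - \<rho>) * ?A\<^sup>2 + \<rho> * (?B x)\<^sup>2" by (simp add: power2_eq_square algebra_simps)
    also have "?A\<^sup>2 = s\<^sup>2 + 1" by simp
    also have "(1 - \<rho>) * (s\<^sup>2 + 1) + \<rho> * (?B x)\<^sup>2 = s\<^sup>2 + 1 - 2 * s * (\<rho> * cos x)"
      unfolding sq by (simp add: algebra_simps)
    finally show "((1 - \<rho>) * ?A + \<rho> * ?B x)\<^sup>2 \<le> s\<^sup>2 + 1 - 2 * s * (\<rho> * cos x)"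
      using \<rho> by (smt (verit) mult_nonneg_nonneg zero_le_power2)
  qed
  \<comment> \<open>For \<rho> = 0 there is room to spare; a linear lower bound for
    \<open>?A\<close> is chosen so that the comparison with the bound for \<rho> = 1 is linear in
    s.\<close>
  have "((2169/2500) + (9/25) * s)\<^sup>2 = (2169/2500)\<^sup>2 + 2 * (2169/2500) * (9/25) * s + (9/25)\<^sup>2 * s\<^sup>2"
    by (simp only: power2_sum power_mult_distrib)
  also have "\<dots> \<le> s\<^sup>2 + 1"
  proof -
    have "s * (93/200) \<le> s\<^sup>2" using s unfolding power2_eq_square by (intro mult_left_mono) simp_all
    moreover have "(2169/2500)\<^sup>2 + 2 * (2169/2500) * (9/25) * s + (9/25)\<^sup>2 * x \<le> x + 1"
      if "s * (93/200) \<le> x" for x using that s by (simp add: power2_eq_square)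
    ultimately show ?thesis by blast
  qed
  finally have "((2169/2500) + (9/25) * s)\<^sup>2 \<le> s\<^sup>2 + 1" .
  then have A: "(2169/2500) + (9/25) * s \<le> ?A" by (rule real_le_rsqrt)
  have "(\<Sum>j<6. max 0 (1.47 - sqrt (s\<^sup>2 + 1 - 2 * s * (\<rho> * cos (\<psi> + real j * (pi/3)))))) \<le>
    (\<Sum>j<6. (1 - \<rho>) * max 0 (1.47 - ?A) + \<rho> * max 0 (1.47 - ?B (\<psi> + real j * (pi/3))))"
  proof (intro sum_mono)
    fix j :: nat
    let ?x = "\<psi> + real j * (pi/3)"
    have "max 0 (1.47 - sqrt (s\<^sup>2 + 1 - 2 * s * (\<rho> * cos ?x))) \<le>
      max 0 (1.47 - ((1 - \<rho>) * ?A + \<rho> * ?B ?x))"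
      using mix[of ?x] by (intro max.mono order.refl diff_left_mono)
    also have "\<dots> \<le> (1 - \<rho>) * max 0 (1.47 - ?A) + \<rho> * max 0 (1.47 - ?B ?x)"
      by (rule max_0_convex_combination[OF \<rho>])
    finally show "max 0 (1.47 - sqrt (s\<^sup>2 + 1 - 2 * s * (\<rho> * cos ?x))) \<le>
      (1 - \<rho>) * max 0 (1.47 - ?A) + \<rho> * max 0 (1.47 - ?B ?x)" .
  qed
  also have "\<dots> = (1 - \<rho>) * (6 * max 0 (1.47 - ?A)) + \<rho> * (\<Sum>j<6. max 0 (1.47 - ?B (\<psi> + real j * (pi/3))))"
    by (simp add: sum.distrib sum_distrib_left)
  also have "\<dots> \<le> (1 - \<rho>) * (6 * (0.468 - max 0 (s - 0.82) / 3)) + \<rho> * (6 * (0.468 - max 0 (s - 0.82) / 3))"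
    using \<rho> A s six_point_near_circle[OF s]
    by (intro add_mono mult_left_mono) (auto simp: max_def diff_divide_distrib)
  also have "\<dots> = 6 * (0.468 - max 0 (s - 0.82) / 3)"
    unfolding distrib_right[symmetric] by simp
  finally show ?thesis .
qed

section \<open>Rotation-invariant measures on a ball\<close>

text \<open>For orthonormal e and f this is the rotation by \<theta> in their plane and the identity
  on the orthogonal complement. Written as a correction of x, it needs no completion of e, f to a
  basis.\<close>

definition plane_rotation :: "'a::real_inner \<Rightarrow> 'a \<Rightarrow> real \<Rightarrow> 'a \<Rightarrow> 'a" where
  "plane_rotation e f \<theta> x = x + ((cos \<theta> - 1) * (x \<bullet> e) - sin \<theta> * (x \<bullet> f)) *\<^sub>R e
    + (sin \<theta> * (x \<bullet> e) + (cos \<theta> - 1) * (x \<bullet> f)) *\<^sub>R f"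

lemma linear_plane_rotation: "linear (plane_rotation e f \<theta>)"
  by (intro linearI) (simp_all add: plane_rotation_def inner_left_distrib scaleR_add_left scaleR_add_right
      scaleR_diff_left scaleR_diff_right algebra_simps)

lemma plane_rotation_inner:
  assumes "e \<bullet> e = 1" "f \<bullet> f = 1" "e \<bullet> f = 0"
  shows "plane_rotation e f \<theta> x \<bullet> e = cos \<theta> * (x \<bullet> e) - sin \<theta> * (x \<bullet> f)"
    and "plane_rotation e f \<theta> x \<bullet> f = sin \<theta> * (x \<bullet> e) + cos \<theta> * (x \<bullet> f)"
  using assms by (simp_all add: plane_rotation_def inner_left_distrib inner_commute[of f e] algebra_simps)

lemma plane_rotation_add:
  assumes "e \<bullet> e = 1" "f \<bullet> f = 1" "e \<bullet> f = 0"
  shows "plane_rotation e f \<theta> (plane_rotation e f \<phi> x) = plane_rotation e f (\<theta> + \<phi>) x"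
proof -
  have "plane_rotation e f \<theta> (plane_rotation e f \<phi> x) = plane_rotation e f \<phi> x +
      ((cos \<theta> - 1) * (cos \<phi> * (x \<bullet> e) - sin \<phi> * (x \<bullet> f)) -
        sin \<theta> * (sin \<phi> * (x \<bullet> e) + cos \<phi> * (x \<bullet> f))) *\<^sub>R e +
      (sin \<theta> * (cos \<phi> * (x \<bullet> e) - sin \<phi> * (x \<bullet> f)) +
        (cos \<theta> - 1) * (sin \<phi> * (x \<bullet> e) + cos \<phi> * (x \<bullet> f))) *\<^sub>R f"
    unfolding plane_rotation_def[of e f \<theta>] plane_rotation_inner[OF assms] ..
  also have "\<dots> = plane_rotation e f (\<theta> + \<phi>) x"
    unfolding plane_rotation_def cos_add sin_add by (simp add: algebra_simps)
  finally show ?thesis .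
qed

lemma norm_plane_rotation:
  assumes "e \<bullet> e = 1" "f \<bullet> f = 1" "e \<bullet> f = 0"
  shows "norm (plane_rotation e f \<theta> x) = norm x"
proof -
  let ?A = "(cos \<theta> - 1) * (x \<bullet> e) - sin \<theta> * (x \<bullet> f)" and ?B = "sin \<theta> * (x \<bullet> e) + (cos \<theta> - 1) * (x \<bullet> f)"
  have expand: "(x + A *\<^sub>R e + B *\<^sub>R f) \<bullet> (x + A *\<^sub>R e + B *\<^sub>R f) =
    x \<bullet> x + 2 * A * (x \<bullet> e) + 2 * B * (x \<bullet> f) + A\<^sup>2 + B\<^sup>2" for A B
    using assms inner_commute[of e x] inner_commute[of f x] inner_commute[of f e]
    by (simp add: inner_left_distrib inner_right_distrib power2_eq_square distrib_left)
  have "plane_rotation e f \<theta> x \<bullet> plane_rotation e f \<theta> x =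
    x \<bullet> x + 2 * ?A * (x \<bullet> e) + 2 * ?B * (x \<bullet> f) + ?A\<^sup>2 + ?B\<^sup>2"
    unfolding plane_rotation_def by (rule expand)
  also have "\<dots> = x \<bullet> x + ((sin \<theta>)\<^sup>2 + (cos \<theta>)\<^sup>2 - 1) * ((x \<bullet> e)\<^sup>2 + (x \<bullet> f)\<^sup>2)"
    unfolding power2_eq_square by algebra
  also have "\<dots> = x \<bullet> x" by simp
  finally show ?thesis by (simp add: norm_eq_sqrt_inner)
qed

lemma rotation_matrix_plane_rotation:
  fixes e f :: "real ^ 'm"
  assumes "e \<bullet> e = 1" "f \<bullet> f = 1" "e \<bullet> f = 0"
  shows "rotation_matrix (matrix (plane_rotation e f \<theta>))"
proof -
  have orth: "orthogonal_matrix (matrix (plane_rotation e f \<theta>))" for \<theta>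
    using orthogonal_transformation_matrix[of "plane_rotation e f \<theta>"]
    by (simp add: orthogonal_transformation linear_plane_rotation norm_plane_rotation assms)
  \<comment> \<open>The determinant of a square is not \<open>-1\<close>, so half the angle suffices.\<close>
  let ?Q = "matrix (plane_rotation e f (\<theta>/2))"
  have "plane_rotation e f \<theta> = plane_rotation e f (\<theta>/2) \<circ> plane_rotation e f (\<theta>/2)"
    by (simp add: fun_eq_iff plane_rotation_add assms)
  then have "matrix (plane_rotation e f \<theta>) = ?Q ** ?Q"
    by (simp add: matrix_compose linear_plane_rotation)
  moreover have "det ?Q = 1 \<or> det ?Q = -1" by (rule det_orthogonal_matrix[OF orth])
  ultimately have "det (matrix (plane_rotation e f \<theta>)) = 1" by (auto simp: det_mul)
  with orth show ?thesis by (simp add: rotation_matrix_def)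
qed

text \<open>Polar coordinates of the projection of x to the plane. The e-component is all that
  matters later: together with the norm of x it determines the distance from a rotated point to a
  point on the e-axis.\<close>

lemma plane_rotation_polar:
  assumes "e \<bullet> e = 1" "f \<bullet> f = 1" "e \<bullet> f = 0"
  obtains \<rho> \<psi> where "0 \<le> \<rho>" "\<rho> \<le> norm x" "\<And>\<theta>. plane_rotation e f \<theta> x \<bullet> e = \<rho> * cos (\<psi> + \<theta>)"
proof
  define z where "z = Complex (x \<bullet> e) (x \<bullet> f)"
  show "0 \<le> cmod z" by simp
  \<comment> \<open>\<open>?y\<close> is the projection of x to the plane; the norm of
    \<open>x - ?y\<close> being nonnegative gives Bessel's inequality.\<close>
  let ?y = "(x \<bullet> e) *\<^sub>R e + (x \<bullet> f) *\<^sub>R f"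
  have "?y \<bullet> ?y = (x \<bullet> e)\<^sup>2 + (x \<bullet> f)\<^sup>2" "x \<bullet> ?y = (x \<bullet> e)\<^sup>2 + (x \<bullet> f)\<^sup>2"
    using assms by (simp_all add: inner_left_distrib inner_right_distrib inner_commute[of f e] power2_eq_square)
  moreover have "0 \<le> (x - ?y) \<bullet> (x - ?y)" by simp
  ultimately have "(x \<bullet> e)\<^sup>2 + (x \<bullet> f)\<^sup>2 \<le> x \<bullet> x"
    unfolding inner_diff_left inner_diff_right by (simp add: inner_commute)
  then show "cmod z \<le> norm x" by (simp add: z_def cmod_def norm_eq_sqrt_inner)
  have 1: "x \<bullet> e = cmod z * cos (Arg z)" and 2: "x \<bullet> f = cmod z * sin (Arg z)"
    using rcis_cmod_Arg[of z] by (metis Re_rcis complex.sel(1) z_def, metis Im_rcis complex.sel(2) z_def)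
  show "plane_rotation e f \<theta> x \<bullet> e = cmod z * cos (Arg z + \<theta>)" for \<theta>
    unfolding plane_rotation_inner[OF assms] 1 2 by (simp add: cos_add algebra_simps)
qed

text \<open>In dimension at least 2 there is a unit vector f orthogonal to the radial direction e.
  For p = c the direction is arbitrary, and a basis vector is taken.\<close>

lemma radial_frame:
  fixes p c :: "real ^ 'm"
  assumes "2 \<le> CARD('m)"
  obtains e f where "e \<bullet> e = 1" "f \<bullet> f = 1" "e \<bullet> f = 0" "p = c + dist p c *\<^sub>R e"
proof -
  have D: "2 \<le> DIM(real ^ 'm)" using assms by simp
  obtain b :: "real ^ 'm" where b: "b \<in> Basis" using nonempty_Basis by blast
  define e where "e = (if p = c then b else sgn (p - c))"
  have e: "norm e = 1" using b by (auto simp: e_def norm_sgn)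
  obtain g where g: "g \<noteq> 0" "orthogonal e g" using orthogonal_to_vector_exists[OF D, of e] by metis
  show thesis
  proof
    show "e \<bullet> e = 1" using e by (simp add: norm_eq_1)
    show "sgn g \<bullet> sgn g = 1" using g by (simp add: norm_sgn flip: norm_eq_1)
    show "e \<bullet> sgn g = 0" using g by (simp add: sgn_div_norm orthogonal_def)
    show "p = c + dist p c *\<^sub>R e" by (auto simp: e_def sgn_div_norm dist_norm)
  qed
qed

lemma space_prob_on_ball:
  assumes "prob_on_ball c r \<mu>"
  shows "space \<mu> = cball c r"
proof -
  have "sets \<mu> = sets (restrict_space borel (cball c r))" using assms by (simp add: prob_on_ball_def)
  from sets_eq_imp_space_eq[OF this] show ?thesis by (simp add: space_restrict_space)
qed

lemma integrable_on_ball: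
  fixes g :: "real ^ 'm \<Rightarrow> real"
  assumes \<mu>: "prob_on_ball c r \<mu>" and g: "continuous_on UNIV g"
  shows "integrable \<mu> g"
proof -
  interpret prob_space \<mu> using \<mu> by (simp add: prob_on_ball_def)
  have sets: "sets \<mu> = sets (restrict_space borel (cball c r))" using \<mu> by (simp add: prob_on_ball_def)
  have "compact (g ` cball c r)"
    by (intro compact_continuous_image compact_cball continuous_on_subset[OF g]) simp
  then obtain B where B: "\<And>x. x \<in> cball c r \<Longrightarrow> norm (g x) \<le> B"
    by (meson bounded_iff compact_imp_bounded imageI)
  have "g \<in> borel_measurable \<mu>"
    unfolding measurable_cong_sets[OF sets refl]
    by (intro measurable_restrict_space1 borel_measurable_continuous_onI g)
  then show ?thesis 
    using B space_prob_on_ball[OF \<mu>] by (intro integrable_const_bound[of _ B]) (auto intro!: AE_I2)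
qed

lemma integral_plane_rotation:
  fixes g :: "real ^ 'm \<Rightarrow> real"
  assumes \<mu>: "prob_on_ball c r \<mu>" "rotation_invariant c \<mu>" and g: "continuous_on UNIV g"
    and ef: "e \<bullet> e = 1" "f \<bullet> f = 1" "e \<bullet> f = 0"
  shows "(\<integral>x. g (c + plane_rotation e f \<theta> (x - c)) \<partial>\<mu>) = (\<integral>x. g x \<partial>\<mu>)"
proof -
  let ?T = "\<lambda>x. c + plane_rotation e f \<theta> (x - c)"
  have sets: "sets \<mu> = sets (restrict_space borel (cball c r))" using \<mu> by (simp add: prob_on_ball_def)
  have "matrix (plane_rotation e f \<theta>) *v x = plane_rotation e f \<theta> x" for x
    by (rule matrix_works) (simp add: linear_plane_rotation linear_matrix_vector_mul_eq)
  then have inv: "distr \<mu> \<mu> ?T = \<mu>"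
    using \<mu>(2) rotation_matrix_plane_rotation[OF ef, of \<theta>] by (fastforce simp: rotation_invariant_def)
  have contT: "continuous_on UNIV ?T"
    by (intro continuous_intros linear_continuous_on_compose[OF _ linear_plane_rotation])
  have T: "?T \<in> \<mu> \<rightarrow>\<^sub>M \<mu>"
    unfolding measurable_cong_sets[OF sets sets]
    by (intro measurable_restrict_space3 borel_measurable_continuous_onI contT)
      (auto simp: dist_norm norm_plane_rotation[OF ef] norm_minus_commute)
  have "g \<in> borel_measurable \<mu>" using integrable_on_ball[OF \<mu>(1) g] by simp
  from integral_distr[OF T this] show ?thesis unfolding inv by simp
qed

lemma integral_le_of_rotation_average:
  fixes g u :: "real ^ 'm \<Rightarrow> real"
  assumes \<mu>: "prob_on_ball c r \<mu>" "rotation_invariant c \<mu>"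
    and g: "continuous_on UNIV g" and u: "continuous_on UNIV u"
    and ef: "e \<bullet> e = 1" "f \<bullet> f = 1" "e \<bullet> f = 0"
    and le: "\<And>y. norm y \<le> r \<Longrightarrow> (\<Sum>j<6. g (c + plane_rotation e f (real j * (pi/3)) y)) \<le> 6 * u (c + y)"
  shows "(\<integral>x. g x \<partial>\<mu>) \<le> (\<integral>x. u x \<partial>\<mu>)"
proof -
  let ?g = "\<lambda>j x. g (c + plane_rotation e f (real j * (pi/3)) (x - c))"
  have int: "integrable \<mu> (?g j)" for j :: nat
    by (intro integrable_on_ball[OF \<mu>(1)] continuous_on_compose2[OF g] continuous_intros
        linear_continuous_on_compose[OF _ linear_plane_rotation]) auto
  have "6 * (\<integral>x. g x \<partial>\<mu>) = (\<Sum>j<6::nat. \<integral>x. ?g j x \<partial>\<mu>)"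
    by (simp add: integral_plane_rotation[OF \<mu> g ef])
  also have "\<dots> = (\<integral>x. (\<Sum>j<6. ?g j x) \<partial>\<mu>)" using int by simp
  also have "\<dots> \<le> (\<integral>x. 6 * u x \<partial>\<mu>)"
  proof (rule integral_mono)
    show "(\<Sum>j<6. ?g j x) \<le> 6 * u x" if "x \<in> space \<mu>" for x
      using le[of "x - c"] that space_prob_on_ball[OF \<mu>(1)] by (simp add: dist_norm norm_minus_commute)
  qed (use int integrable_on_ball[OF \<mu>(1) u] in auto)
  also have "\<dots> = 6 * (\<integral>x. u x \<partial>\<mu>)" by simp
  finally show ?thesis by simp
qed

text \<open>What the dual variable \<open>max 0 (\<alpha> j - dist p x)\<close> becomes in the limit
  \<alpha> = 1.47. It is 1-Lipschitz in p, which makes it accessible to a finite net.\<close>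

definition clipped :: "'a::metric_space \<Rightarrow> 'a \<Rightarrow> real" where
  "clipped p x = max 0 (1.47 - dist p x)"

lemma continuous_on_clipped: "continuous_on UNIV (clipped p)"
  unfolding clipped_def by (intro continuous_intros)

section \<open>Mean distance and clipped distance averaged over one ball\<close>

lemma dist_frame_plane_rotation:
  assumes "e \<bullet> e = 1" "f \<bullet> f = 1" "e \<bullet> f = 0"
  shows "dist (c + s *\<^sub>R e) (c + plane_rotation e f \<theta> y) =
    sqrt (s\<^sup>2 + (norm y)\<^sup>2 - 2 * s * (plane_rotation e f \<theta> y \<bullet> e))"
proof -
  let ?z = "plane_rotation e f \<theta> y"
  have "(s *\<^sub>R e - ?z) \<bullet> (s *\<^sub>R e - ?z) = s * s * (e \<bullet> e) + ?z \<bullet> ?z - 2 * s * (?z \<bullet> e)"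
    using inner_commute[of e ?z] unfolding inner_diff_left inner_diff_right by simp
  moreover have "?z \<bullet> ?z = (norm y)\<^sup>2"
    using norm_plane_rotation[OF assms, of \<theta> y] by (simp flip: power2_norm_eq_inner)
  ultimately show ?thesis
    by (simp add: dist_norm norm_eq_sqrt_inner assms power2_eq_square)
qed

text \<open>The six angles form three antipodal pairs, and by the triangle inequality the distances
  from p to two antipodal points at radius |y| sum to at least 2 |y|. This bounds the medoid cost
  from below.\<close>

lemma mean_dist_le_integral_dist:
  fixes c p :: "real ^ 'm"
  assumes m: "2 \<le> CARD('m)" and \<mu>: "prob_on_ball c r \<mu>" "rotation_invariant c \<mu>"
  shows "mean_dist c \<mu> \<le> (\<integral>x. dist p x \<partial>\<mu>)"
proof -
  obtain e f where ef: "e \<bullet> e = 1" "f \<bullet> f = 1" "e \<bullet> f = 0" and p: "p = c + dist p c *\<^sub>R e"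
    by (rule radial_frame[OF m])
  have "(\<integral>x. - dist p x \<partial>\<mu>) \<le> (\<integral>x. - dist x c \<partial>\<mu>)"
  proof (rule integral_le_of_rotation_average[OF \<mu> _ _ ef])
    fix y :: "real ^ 'm"
    define d where "d \<theta> = dist p (c + plane_rotation e f \<theta> y)" for \<theta>
    have pair: "2 * norm y \<le> d \<theta> + d (\<theta> + pi)" for \<theta>
    proof -
      let ?z = "plane_rotation e f \<theta> y" and ?s = "dist p c"
      have "plane_rotation e f (\<theta> + pi) y \<bullet> e = - (?z \<bullet> e)"
        unfolding plane_rotation_inner[OF ef] by simp
      then have "d (\<theta> + pi) = sqrt (?s\<^sup>2 + (norm y)\<^sup>2 + 2 * ?s * (?z \<bullet> e))"
        unfolding d_def by (subst p, subst dist_frame_plane_rotation[OF ef]) simp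
      also have "\<dots> = norm (?s *\<^sub>R e + ?z)"
      proof -
        have "(?s *\<^sub>R e + ?z) \<bullet> (?s *\<^sub>R e + ?z) = ?s * ?s * (e \<bullet> e) + ?z \<bullet> ?z + 2 * ?s * (?z \<bullet> e)"
          using inner_commute[of e ?z] unfolding inner_add_left inner_add_right by simp
        moreover have "?z \<bullet> ?z = (norm y)\<^sup>2"
          using norm_plane_rotation[OF ef, of \<theta> y] by (simp flip: power2_norm_eq_inner)
        ultimately show ?thesis by (simp add: norm_eq_sqrt_inner ef power2_eq_square)
      qed
      finally have "d (\<theta> + pi) = norm (?s *\<^sub>R e + ?z)" .
      moreover have "d \<theta> = norm (?s *\<^sub>R e - ?z)"
        unfolding d_def by (subst p) (simp add: dist_norm)
      moreover have "norm ((?s *\<^sub>R e + ?z) - (?s *\<^sub>R e - ?z)) = 2 * norm y"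
        using norm_plane_rotation[OF ef, of \<theta> y] by (simp flip: scaleR_2)
      ultimately show ?thesis
        using norm_triangle_ineq4[of "?s *\<^sub>R e + ?z" "?s *\<^sub>R e - ?z"] by linarith
    qed
    show "(\<Sum>j<6. - dist p (c + plane_rotation e f (real j * (pi/3)) y)) \<le> 6 * - dist (c + y) c"
      using pair[of 0] pair[of "pi/3"] pair[of "2 * (pi/3)"]
      unfolding sum_lessThan_6 d_def[symmetric] by (simp add: algebra_simps dist_norm)
  qed (intro continuous_intros)+
  then show ?thesis by (simp add: mean_dist_def)
qed

text \<open>Moving a point at radius |y| out to the sphere changes its distance to p by at most 1 -
  |y|. Integrating this loss adds 1 - E to the bound 0.468 - max 0 (s - 0.82) / 3 for the sphere, so
  the least favourable mass lies on the sphere.\<close>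

lemma integral_clipped_near:
  fixes c p :: "real ^ 'm"
  assumes m: "2 \<le> CARD('m)" and \<mu>: "prob_on_ball c 1 \<mu>" "rotation_invariant c \<mu>"
    and s: "0.465 \<le> dist p c" "dist p c \<le> 1"
  shows "(\<integral>x. clipped p x \<partial>\<mu>) \<le> 1.468 - mean_dist c \<mu> - max 0 (dist p c - 0.82) / 3"
proof -
  define s where "s = dist p c"
  obtain e f where ef: "e \<bullet> e = 1" "f \<bullet> f = 1" "e \<bullet> f = 0" and p: "p = c + s *\<^sub>R e"
    unfolding s_def by (rule radial_frame[OF m])
  interpret prob_space \<mu> using \<mu> by (simp add: prob_on_ball_def)
  have "(\<integral>x. clipped p x \<partial>\<mu>) \<le> (\<integral>x. 1.468 - max 0 (s - 0.82) / 3 - dist x c \<partial>\<mu>)"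
  proof (rule integral_le_of_rotation_average[OF \<mu> continuous_on_clipped _ ef])
    fix y :: "real ^ 'm" assume y: "norm y \<le> 1"
    \<comment> \<open>The radial projection of y to the unit sphere; the center has none, and any
      unit vector will do for it.\<close>
    define w where "w = (if y = 0 then e else sgn y)"
    have w: "norm w = 1" using ef(1) by (auto simp: w_def norm_sgn norm_eq_sqrt_inner[of e])
    have wy: "norm (w - y) = 1 - norm y"
    proof (cases "y = 0")
      case False
      then have "w - y = (1 / norm y - 1) *\<^sub>R y"
        by (simp add: w_def sgn_div_norm scaleR_left_diff_distrib divide_inverse)
      also have "norm \<dots> = (1 / norm y - 1) * norm y" using y False by simp
      finally show ?thesis using False by (simp add: algebra_simps)
    qed (use w in \<open>simp add: w_def\<close>)
    obtain \<rho> \<psi> where \<rho>: "0 \<le> \<rho>" "\<rho> \<le> norm w" and pol: "\<And>\<theta>. plane_rotation e f \<theta> w \<bullet> e = \<rho> * cos (\<psi> + \<theta>)"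
      using plane_rotation_polar[OF ef, of w] by metis
    have step: "clipped p (c + plane_rotation e f \<theta> y) \<le>
      max 0 (1.47 - sqrt (s\<^sup>2 + 1 - 2 * s * (\<rho> * cos (\<psi> + \<theta>)))) + (1 - norm y)" for \<theta>
    proof -
      have "plane_rotation e f \<theta> w - plane_rotation e f \<theta> y = plane_rotation e f \<theta> (w - y)"
        by (simp add: linear_diff[OF linear_plane_rotation])
      then have "dist (c + plane_rotation e f \<theta> y) (c + plane_rotation e f \<theta> w) = 1 - norm y"
        using norm_plane_rotation[OF ef, of \<theta> "w - y"] wy
        by (simp add: dist_norm norm_minus_commute)
      then have "dist p (c + plane_rotation e f \<theta> w) \<le> dist p (c + plane_rotation e f \<theta> y) + (1 - norm y)"
        using dist_triangle[of p "c + plane_rotation e f \<theta> w" "c + plane_rotation e f \<theta> y"] by linarith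
      moreover have "dist p (c + plane_rotation e f \<theta> w) = sqrt (s\<^sup>2 + 1 - 2 * s * (\<rho> * cos (\<psi> + \<theta>)))"
        unfolding p dist_frame_plane_rotation[OF ef] w pol by simp
      ultimately show ?thesis using y unfolding clipped_def by linarith
    qed
    have "(\<Sum>j<6. clipped p (c + plane_rotation e f (real j * (pi/3)) y)) \<le>
      (\<Sum>j<6. max 0 (1.47 - sqrt (s\<^sup>2 + 1 - 2 * s * (\<rho> * cos (\<psi> + real j * (pi/3))))) + (1 - norm y))"
      by (intro sum_mono step)
    also have "\<dots> \<le> 6 * (0.468 - max 0 (s - 0.82) / 3) + 6 * (1 - norm y)"
      using six_point_near[of s \<rho> \<psi>] s \<rho> w by (simp add: sum.distrib s_def)
    also have "\<dots> = 6 * (1.468 - max 0 (s - 0.82) / 3 - dist (c + y) c)"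
      by (simp add: dist_norm)
    finally show "(\<Sum>j<6. clipped p (c + plane_rotation e f (real j * (pi/3)) y)) \<le>
      6 * (1.468 - max 0 (s - 0.82) / 3 - dist (c + y) c)" .
  qed (intro continuous_intros)
  also have "\<dots> = 1.468 - max 0 (s - 0.82) / 3 - mean_dist c \<mu>"
  proof -
    have "integrable \<mu> (\<lambda>x. dist x c)" by (intro integrable_on_ball[OF \<mu>(1)] continuous_intros)
    then show ?thesis
      by (subst Bochner_Integration.integral_diff) (auto simp: mean_dist_def prob_space)
  qed
  finally show ?thesis by (simp add: s_def)
qed

text \<open>The distance is bounded below by its component along the axis from c to p, which turns
  the integrand into that of \<open>six_point_far\<close>; 1.72 = 2.47 - 3/4 is the condition \<tau>
  \<le> 3/4 there.\<close>

lemma integral_clipped_far: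
  fixes c p :: "real ^ 'm"
  assumes m: "2 \<le> CARD('m)" and \<mu>: "prob_on_ball c 1 \<mu>" "rotation_invariant c \<mu>"
    and R: "1.72 \<le> dist p c"
  shows "(\<integral>x. clipped p x \<partial>\<mu>) \<le> max 0 (2.47 - dist p c) / 3"
proof -
  define R where "R = dist p c"
  obtain e f where ef: "e \<bullet> e = 1" "f \<bullet> f = 1" "e \<bullet> f = 0" and p: "p = c + R *\<^sub>R e"
    unfolding R_def by (rule radial_frame[OF m])
  interpret prob_space \<mu> using \<mu> by (simp add: prob_on_ball_def)
  define \<tau> where "\<tau> = max 0 (2.47 - R)"
  have "(\<integral>x. clipped p x \<partial>\<mu>) \<le> (\<integral>x. \<tau> / 3 \<partial>\<mu>)"
  proof (rule integral_le_of_rotation_average[OF \<mu> continuous_on_clipped _ ef])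
    fix y :: "real ^ 'm" assume y: "norm y \<le> 1"
    obtain \<rho> \<psi> where \<rho>: "0 \<le> \<rho>" "\<rho> \<le> norm y" and pol: "\<And>\<theta>. plane_rotation e f \<theta> y \<bullet> e = \<rho> * cos (\<psi> + \<theta>)"
      using plane_rotation_polar[OF ef, of y] by metis
    have step: "clipped p (c + plane_rotation e f \<theta> y) \<le> max 0 (\<tau> - 1 + \<rho> * cos (\<psi> + \<theta>))" for \<theta>
    proof -
      let ?z = "plane_rotation e f \<theta> y"
      have "R - ?z \<bullet> e = (R *\<^sub>R e - ?z) \<bullet> e" by (simp add: inner_diff_left ef)
      also have "\<dots> \<le> norm (R *\<^sub>R e - ?z)"
        using norm_cauchy_schwarz[of "R *\<^sub>R e - ?z" e] ef(1)
        by (simp add: norm_eq_sqrt_inner[of e])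
      also have "\<dots> = dist p (c + ?z)" by (simp add: p dist_norm)
      finally show ?thesis unfolding clipped_def \<tau>_def pol by simp
    qed
    have "(\<Sum>j<6. clipped p (c + plane_rotation e f (real j * (pi/3)) y)) \<le>
      (\<Sum>j<6. max 0 (\<tau> - 1 + \<rho> * cos (\<psi> + real j * (pi/3))))"
      by (intro sum_mono step)
    also have "\<dots> \<le> 2 * \<tau>"
      using R \<rho> y by (intro six_point_far) (auto simp: \<tau>_def R_def max_def)
    finally show "(\<Sum>j<6. clipped p (c + plane_rotation e f (real j * (pi/3)) y)) \<le> 6 * (\<tau> / 3)" by simp
  qed (intro continuous_intros)
  then show ?thesis by (simp add: prob_space \<tau>_def R_def)
qed

section \<open>Null events\<close>

text \<open>Squaring \<open>\<bar>x - w\<bar> = \<bar>x\<bar> - C\<close>, with the origin moved to \<open>a\<close> and \<open>w = b - a\<close>, leaves the equation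
  \<open>2 (x \<bullet> w - C \<bar>x\<bar>) = \<bar>w\<bar>\<^sup>2 - C\<^sup>2\<close>, whose left-hand side is positively homogeneous.
  So a ray from \<open>a\<close> meets the hyperboloid at most once, unless \<open>\<bar>C\<bar> = \<bar>w\<bar>\<close> and the hyperboloid
  degenerates to a part of the line through \<open>a\<close> and \<open>b\<close>.\<close>

lemma hyperboloid_negligible:
  fixes a b :: "'a::euclidean_space"
  assumes dim: "2 \<le> DIM('a)" and ab: "a \<noteq> b"
  shows "negligible {x. dist x a - dist x b = C}"
proof -
  define w where "w = b - a"
  have w: "w \<noteq> 0" using ab by (simp add: w_def)
  have S: "2 * (x \<bullet> w - C * norm x) = (norm w)\<^sup>2 - C\<^sup>2" if "a + x \<in> {x. dist x a - dist x b = C}" for x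
  proof -
    have n: "norm (x - w) = norm x - C" using that by (simp add: w_def dist_norm algebra_simps)
    have "(norm (x - w))\<^sup>2 = (norm x)\<^sup>2 - 2 * C * norm x + C\<^sup>2"
      unfolding n by (simp add: power2_eq_square algebra_simps)
    moreover have "(norm (x - w))\<^sup>2 = (norm x)\<^sup>2 - 2 * (x \<bullet> w) + (norm w)\<^sup>2"
      by (simp add: power2_norm_eq_inner inner_diff_left inner_diff_right inner_commute)
    ultimately show ?thesis by simp
  qed
  show ?thesis
  proof (cases "C\<^sup>2 = (norm w)\<^sup>2")
    case False
    show ?thesis
    proof (rule starlike_negligible)
      show "closed {x. dist x a - dist x b = C}"
        by (intro closed_Collect_eq continuous_intros)
      fix t :: real and x assume tx: "a + t *\<^sub>R x \<in> {x. dist x a - dist x b = C}" "0 \<le> t"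
        and x: "a + x \<in> {x. dist x a - dist x b = C}"
      have "t * (2 * (x \<bullet> w - C * norm x)) = (norm w)\<^sup>2 - C\<^sup>2"
        using S[OF tx(1)] tx(2) by (simp add: algebra_simps)
      then have "(t - 1) * ((norm w)\<^sup>2 - C\<^sup>2) = 0" unfolding S[OF x] by (simp add: algebra_simps)
      with False show "t = 1" by auto
    qed
  next
    case True
    obtain f where f: "f \<noteq> 0" "f \<bullet> w = 0"
      using orthogonal_to_vector_exists[OF dim, of w] by (metis inner_commute orthogonal_def)
    have "{x. dist x a - dist x b = C} \<subseteq> {x. f \<bullet> x = f \<bullet> a}"
    proof
      fix z assume "z \<in> {x. dist x a - dist x b = C}"
      then have z: "a + (z - a) \<in> {x. dist x a - dist x b = C}" by simp
      define x where "x = z - a"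
      \<comment> \<open>In the degenerate case Cauchy-Schwarz holds with equality, so x is parallel
        to w or zero, and hence orthogonal to f.\<close>
      have "x \<bullet> w = C * norm x" using S[OF z] True by (simp add: x_def)
      moreover have "\<bar>C\<bar> = norm w" using True by (metis abs_norm_cancel power2_eq_iff abs_minus_cancel)
      ultimately have "\<bar>x \<bullet> w\<bar> = norm x * norm w" by (simp add: abs_mult)
      then have "norm x *\<^sub>R w = norm w *\<^sub>R x \<or> norm x *\<^sub>R w = - norm w *\<^sub>R x"
        by (simp add: norm_cauchy_schwarz_abs_eq)
      then have "f \<bullet> (norm x *\<^sub>R w) = f \<bullet> (norm w *\<^sub>R x) \<or> f \<bullet> (norm x *\<^sub>R w) = f \<bullet> (- norm w *\<^sub>R x)"
        by metis
      then have "f \<bullet> x = 0" using f w by simp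
      then show "z \<in> {x. f \<bullet> x = f \<bullet> a}" by (simp add: x_def inner_diff_right)
    qed
    then show ?thesis using negligible_hyperplane[of f "f \<bullet> a"] f negligible_subset by blast
  qed
qed

lemma lebesgue_null_imp_null_negligible:
  assumes \<mu>: "lebesgue_null_imp_null \<mu>" "prob_on_ball c r \<mu>" and N: "negligible N" "closed N"
  shows "AE x in \<mu>. x \<notin> N"
proof (rule AE_I')
  have sets: "sets \<mu> = sets (restrict_space borel (cball c r))"
    using \<mu>(2) by (simp add: prob_on_ball_def)
  have N_b: "N \<in> sets borel" using N(2) by (rule borel_closed)
  have A: "N \<inter> cball c r \<in> sets \<mu>" using N_b by (auto simp: sets sets_restrict_space)
  have "N \<in> null_sets lebesgue" using N(1) by (simp add: negligible_iff_null_sets)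
  then have "N \<in> null_sets lborel" using N_b by (simp add: null_sets_completion_iff)
  then have "N \<inter> cball c r \<in> null_sets lborel"
    by (rule null_sets_subset[rotated -1, of _ _ _, rotated]) (use N_b in auto)
  then have "emeasure lborel (N \<inter> cball c r) = 0" by (rule null_setsD1)
  with \<mu>(1) A have "emeasure \<mu> (N \<inter> cball c r) = 0" by (simp add: lebesgue_null_imp_null_def)
  with A show "N \<inter> cball c r \<in> null_sets \<mu>" by (simp add: null_setsI)
  show "{x \<in> space \<mu>. \<not> x \<notin> N} \<subseteq> N \<inter> cball c r"
    using space_prob_on_ball[OF \<mu>(2)] by blast
qed

text \<open>Fubini: to exclude an event almost surely, redraw coordinate j with all the others
  frozen.\<close>

lemma (in product_sigma_finite) AE_PiM_of_fibre:
  assumes I: "finite I" "j \<in> I" and P: "Measurable.pred (PiM I M) P"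
    and fibre: "\<And>\<omega>. \<omega> \<in> space (PiM (I - {j}) M) \<Longrightarrow> AE x in M j. P (fun_upd \<omega> j x)"
  shows "AE \<omega> in PiM I M. P \<omega>"
proof -
  let ?A = "{\<omega> \<in> space (PiM I M). \<not> P \<omega>}"
  have ins: "insert j (I - {j}) = I" using I by auto
  have A: "?A \<in> sets (PiM I M)" using P by measurable
  have "emeasure (PiM I M) ?A = (\<integral>\<^sup>+\<omega>. indicator ?A \<omega> \<partial>PiM (insert j (I - {j})) M)"
    unfolding ins using A by simp
  also have "\<dots> = (\<integral>\<^sup>+\<omega>. (\<integral>\<^sup>+x. indicator ?A (fun_upd \<omega> j x) \<partial>M j) \<partial>PiM (I - {j}) M)"
  proof (rule product_nn_integral_insert)
    show "indicator ?A \<in> borel_measurable (PiM (insert j (I - {j})) M)" unfolding ins using A by simp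
  qed (use I in auto)
  also have "\<dots> = (\<integral>\<^sup>+\<omega>. 0 \<partial>PiM (I - {j}) M)"
  proof (rule nn_integral_cong)
    fix \<omega> assume "\<omega> \<in> space (PiM (I - {j}) M)"
    from fibre[OF this] have "AE x in M j. indicator ?A (fun_upd \<omega> j x) = (0::ennreal)"
      by eventually_elim simp
    from nn_integral_cong_AE[OF this] show "(\<integral>\<^sup>+x. indicator ?A (fun_upd \<omega> j x) \<partial>M j) = 0" by simp
  qed
  finally have "?A \<in> null_sets (PiM I M)" using A by (simp add: null_setsI)
  then show ?thesis by (rule AE_I') auto
qed

section \<open>Deviation bounds and events of high probability\<close>

lemma indep_vars_PiM_coordinates:
  assumes M: "\<And>i. i \<in> I \<Longrightarrow> prob_space (M i)" and I: "I \<noteq> {}"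
  shows "prob_space.indep_vars (PiM I M) M (\<lambda>i \<omega>. \<omega> i) I"
proof -
  interpret P: prob_space "PiM I M" by (rule prob_space_PiM) (rule M)
  have "distr (PiM I M) (PiM I M) (\<lambda>x. restrict x I) = distr (PiM I M) (PiM I M) (\<lambda>x. x)"
    by (intro distr_cong refl) (auto simp: space_PiM PiE_def extensional_restrict)
  also have "\<dots> = PiM I (\<lambda>i. distr (PiM I M) (M i) (\<lambda>\<omega>. \<omega> i))"
    unfolding distr_id2[OF refl] by (intro PiM_cong refl) (simp add: distr_PiM_component M)
  finally show ?thesis using I by (subst P.indep_vars_iff_distr_eq_PiM') auto
qed

text \<open>Hoeffding's inequality. \<open>J\<close> stands for the draws from one ball, the only
  coordinates that share the law \<open>N\<close>.\<close>

lemma PiM_sum_deviation: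
  fixes g :: "'a \<Rightarrow> real" and \<epsilon> :: real
  assumes M: "\<And>i. i \<in> I \<Longrightarrow> prob_space (M i)" and J: "J \<subseteq> I" "finite J" "J \<noteq> {}"
    and MJ: "\<And>j. j \<in> J \<Longrightarrow> M j = N" and g: "g \<in> borel_measurable N"
    and B: "0 < B" "\<And>x. x \<in> space N \<Longrightarrow> \<bar>g x\<bar> \<le> B" and \<epsilon>: "0 \<le> \<epsilon>"
  shows "measure (PiM I M) {\<omega> \<in> space (PiM I M). \<bar>(\<Sum>j\<in>J. g (\<omega> j)) - card J * (\<integral>x. g x \<partial>N)\<bar> \<ge> \<epsilon> * card J}
    \<le> 2 * exp (- (\<epsilon>\<^sup>2 / (2 * B\<^sup>2) * card J))"
proof -
  interpret P: prob_space "PiM I M" by (rule prob_space_PiM) (rule M)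
  have comp: "(\<lambda>\<omega>. \<omega> j) \<in> PiM I M \<rightarrow>\<^sub>M N" if "j \<in> J" for j
    using measurable_component_singleton[of j I M] that J(1) MJ[OF that] by auto
  have "P.indep_vars M (\<lambda>i \<omega>. \<omega> i) J"
    using indep_vars_PiM_coordinates[of I M] M J P.indep_vars_subset by blast
  then have indep: "P.indep_vars (\<lambda>_. borel) (\<lambda>j \<omega>. g (\<omega> j)) J"
    by (rule P.indep_vars_compose2) (simp add: MJ g)
  have expect: "P.expectation (\<lambda>\<omega>. g (\<omega> j)) = (\<integral>x. g x \<partial>N)" if "j \<in> J" for j
  proof -
    have "distr (PiM I M) N (\<lambda>\<omega>. \<omega> j) = N"
      using distr_PiM_component[of I M j] M that J(1) MJ[OF that] by auto
    then show ?thesis using integral_distr[OF comp[OF that] g] by simp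
  qed
  interpret Hoeffding_ineq "PiM I M" J "\<lambda>j \<omega>. g (\<omega> j)" "\<lambda>_. - B" "\<lambda>_. B" "card J * (\<integral>x. g x \<partial>N)"
  proof unfold_locales
    show "AE x in PiM I M. g (x j) \<in> {- B..B}" if "j \<in> J" for j
    proof (rule AE_I2)
      fix x assume "x \<in> space (PiM I M)"
      then have "x j \<in> space N" using measurable_space[OF comp[OF that]] by blast
      then show "g (x j) \<in> {- B..B}" using B(2)[of "x j"] by auto
    qed
    show "card J * (\<integral>x. g x \<partial>N) \<equiv> \<Sum>i\<in>J. P.expectation (\<lambda>\<omega>. g (\<omega> i))"
      by (rule eq_reflection) (simp add: expect)
  qed (use J indep in auto)
  have card: "0 < real (card J)" using J by (simp add: card_gt_0_iff)
  have "(\<Sum>i\<in>J. (B - - B)\<^sup>2) > 0" using card B(1) by simp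
  from Hoeffding_ineq_abs_ge[OF _ this, of "\<epsilon> * card J"]
  have "P.prob {x \<in> space (PiM I M). \<bar>(\<Sum>i\<in>J. g (x i)) - card J * (\<integral>x. g x \<partial>N)\<bar> \<ge> \<epsilon> * card J} \<le>
     2 * exp (-2 * (\<epsilon> * card J)\<^sup>2 / (\<Sum>i\<in>J. (B - - B)\<^sup>2))" using \<epsilon> by simp
  also have "-2 * (\<epsilon> * card J)\<^sup>2 / (\<Sum>i\<in>J. (B - - B)\<^sup>2) = - (\<epsilon>\<^sup>2 / (2 * B\<^sup>2) * card J)"
    using card B(1) by (simp add: power2_eq_square field_simps)
  finally show ?thesis .
qed

section \<open>Rules for events of high probability\<close>

lemma whp_of_bad_bound:
  assumes M: "\<And>n. prob_space (M n)" and A: "\<And>n. {\<omega> \<in> space (M n). A n \<omega>} \<in> sets (M n)"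
    and bad: "\<And>n. 0 < n \<Longrightarrow> measure (M n) {\<omega> \<in> space (M n). \<not> A n \<omega>} \<le> f n" and f: "f \<longlonglongrightarrow> 0"
  shows "whp M A"
  unfolding whp_def
proof
  fix \<delta> :: real assume \<delta>: "\<delta> \<in> {0<..<1}"
  then have "eventually (\<lambda>n. f n < \<delta>) sequentially" using order_tendstoD(2)[OF f, of \<delta>] by simp
  then obtain N where N: "\<And>n. n \<ge> N \<Longrightarrow> f n < \<delta>" by (auto simp: eventually_sequentially)
  have "1 - \<delta> < measure (M n) {\<omega> \<in> space (M n). A n \<omega>}" if "n > Suc N" for n
  proof -
    interpret prob_space "M n" by (rule M)
    show ?thesis using prob_neg[OF A[of n]] bad[of n] N[of n] that by simp
  qed
  then show "\<exists>N>0. \<forall>n>N. measure (M n) {\<omega> \<in> space (M n). A n \<omega>} > 1 - \<delta>" by blast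
qed

text \<open>\<open>B\<close> has to be measurable: otherwise its \<open>measure\<close> is 0,
  however likely \<open>A\<close> is. The final step applies this with exact recovery as
  \<open>B\<close>.\<close>

lemma whp_mono:
  assumes M: "\<And>n. prob_space (M n)" and B: "\<And>n. {\<omega> \<in> space (M n). B n \<omega>} \<in> sets (M n)"
    and A: "whp M A" and imp: "\<And>n \<omega>. n \<ge> n0 \<Longrightarrow> \<omega> \<in> space (M n) \<Longrightarrow> A n \<omega> \<Longrightarrow> B n \<omega>"
  shows "whp M B"
  unfolding whp_def
proof
  fix \<delta> :: real assume "\<delta> \<in> {0<..<1}"
  with A obtain N where N: "\<And>n. n > N \<Longrightarrow> measure (M n) {\<omega> \<in> space (M n). A n \<omega>} > 1 - \<delta>"
    unfolding whp_def by blast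
  have "1 - \<delta> < measure (M n) {\<omega> \<in> space (M n). B n \<omega>}" if "n > Suc (N + n0)" for n
  proof -
    interpret prob_space "M n" by (rule M)
    have "measure (M n) {\<omega> \<in> space (M n). A n \<omega>} \<le> measure (M n) {\<omega> \<in> space (M n). B n \<omega>}"
      using imp[of n] that by (intro finite_measure_mono B) auto
    then show ?thesis using N[of n] that by simp
  qed
  then show "\<exists>N>0. \<forall>n>N. measure (M n) {\<omega> \<in> space (M n). B n \<omega>} > 1 - \<delta>" by blast
qed

lemma whp_conj:
  assumes M: "\<And>n. prob_space (M n)" and A: "\<And>n. {\<omega> \<in> space (M n). A n \<omega>} \<in> sets (M n)"
    and B: "\<And>n. {\<omega> \<in> space (M n). B n \<omega>} \<in> sets (M n)" and wA: "whp M A" and wB: "whp M B"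
  shows "whp M (\<lambda>n \<omega>. A n \<omega> \<and> B n \<omega>)"
  unfolding whp_def
proof
  fix \<delta> :: real assume "\<delta> \<in> {0<..<1}"
  then have "\<delta> / 2 \<in> {0<..<1}" by simp
  with wA wB obtain N N' where N: "\<And>n. n > N \<Longrightarrow> measure (M n) {\<omega> \<in> space (M n). A n \<omega>} > 1 - \<delta>/2"
    and N': "\<And>n. n > N' \<Longrightarrow> measure (M n) {\<omega> \<in> space (M n). B n \<omega>} > 1 - \<delta>/2"
    unfolding whp_def by meson
  have "1 - \<delta> < measure (M n) {\<omega> \<in> space (M n). A n \<omega> \<and> B n \<omega>}" if "n > Suc (N + N')" for n
  proof -
    interpret prob_space "M n" by (rule M)
    let ?A = "{\<omega> \<in> space (M n). A n \<omega>}" and ?B = "{\<omega> \<in> space (M n). B n \<omega>}"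
    have "?A \<inter> ?B = {\<omega> \<in> space (M n). A n \<omega> \<and> B n \<omega>}" by auto
    then have "measure (M n) ?A + measure (M n) ?B =
        measure (M n) (?A \<union> ?B) + measure (M n) {\<omega> \<in> space (M n). A n \<omega> \<and> B n \<omega>}"
      using measure_Un3[of ?A "M n" ?B] A B by (simp add: fmeasurable_eq_sets)
    moreover have "measure (M n) (?A \<union> ?B) \<le> 1" by simp
    moreover have "N < n" "N' < n" using that by auto
    ultimately show ?thesis using N[of n] N'[of n] by linarith
  qed
  then show "\<exists>N>0. \<forall>n>N. measure (M n) {\<omega> \<in> space (M n). A n \<omega> \<and> B n \<omega>} > 1 - \<delta>" by blast
qed

lemma whp_AE:
  assumes M: "\<And>n. prob_space (M n)" and A: "\<And>n. {\<omega> \<in> space (M n). A n \<omega>} \<in> sets (M n)"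
    and AE: "\<And>n. n \<ge> n0 \<Longrightarrow> AE \<omega> in M n. A n \<omega>"
  shows "whp M A"
  unfolding whp_def
proof
  fix \<delta> :: real assume "\<delta> \<in> {0<..<1}"
  have "1 - \<delta> < measure (M n) {\<omega> \<in> space (M n). A n \<omega>}" if "n > Suc n0" for n
  proof -
    interpret prob_space "M n" by (rule M)
    have "prob {\<omega> \<in> space (M n). A n \<omega>} = 1" using AE[of n] that A by (simp add: prob_Collect_eq_1)
    then show ?thesis using \<open>\<delta> \<in> {0<..<1}\<close> by simp
  qed
  then show "\<exists>N>0. \<forall>n>N. measure (M n) {\<omega> \<in> space (M n). A n \<omega>} > 1 - \<delta>" by blast
qed

lemma whp_ball:
  assumes M: "\<And>n. prob_space (M n)" and S: "finite S"
    and A: "\<And>n s. s \<in> S \<Longrightarrow> {\<omega> \<in> space (M n). A s n \<omega>} \<in> sets (M n)"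
    and w: "\<And>s. s \<in> S \<Longrightarrow> whp M (A s)"
  shows "whp M (\<lambda>n \<omega>. \<forall>s\<in>S. A s n \<omega>)"
  using S A w
proof (induction S)
  case empty
  then show ?case by (intro whp_AE[of _ _ 0]) (auto simp: M)
next
  case (insert s S)
  have "whp M (\<lambda>n \<omega>. A s n \<omega> \<and> (\<forall>s\<in>S. A s n \<omega>))"
  proof (rule whp_conj[OF M])
    show "{\<omega> \<in> space (M n). \<forall>s\<in>S. A s n \<omega>} \<in> sets (M n)" for n
      using insert by (intro sets.sets_Collect_finite_All) auto
  qed (use insert in auto)
  then show ?case by simp
qed

section \<open>Measurability of exact recovery\<close>

text \<open>Compactness gives a positive lower bound \<open>1 / (m + 1)\<close> for \<open>L \<omega>\<close> on \<open>F\<close>, and a weak inequality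
  only needs to be tested on a countable dense subset of \<open>F\<close>.\<close>

lemma sets_Collect_positive_on_compact:
  fixes L :: "'w \<Rightarrow> 'v::second_countable_topology \<Rightarrow> real"
  assumes F: "compact F" and cont: "\<And>\<omega>. continuous_on UNIV (L \<omega>)"
    and meas: "\<And>v. (\<lambda>\<omega>. L \<omega> v) \<in> borel_measurable M"
  shows "{\<omega> \<in> space M. \<forall>v\<in>F. 0 < L \<omega> v} \<in> sets M"
proof -
  obtain B :: "'v set set" where B: "countable B" "topological_basis B"
    using ex_countable_basis by blast
  define T where "T = (\<lambda>b. SOME x. x \<in> b \<inter> F) ` {b \<in> B. b \<inter> F \<noteq> {}}"
  have T_sub: "T \<subseteq> F"
  proof
    fix t assume "t \<in> T"
    then obtain b where "b \<inter> F \<noteq> {}" "t = (SOME x. x \<in> b \<inter> F)" by (auto simp: T_def)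
    then show "t \<in> F" using someI_ex[of "\<lambda>x. x \<in> b \<inter> F"] by auto
  qed
  have dense: "\<exists>t\<in>T. t \<in> U" if U: "open U" "U \<inter> F \<noteq> {}" for U
  proof -
    obtain x where x: "x \<in> U" "x \<in> F" using U(2) by blast
    then obtain b where b: "b \<in> B" "x \<in> b" "b \<subseteq> U"
      using topological_basisE[OF B(2) U(1)] by blast
    then have "b \<inter> F \<noteq> {}" using x by auto
    then have "(SOME x. x \<in> b \<inter> F) \<in> b \<inter> F" "(SOME x. x \<in> b \<inter> F) \<in> T"
      using someI_ex[of "\<lambda>x. x \<in> b \<inter> F"] b(1) by (auto simp: T_def)
    then show ?thesis using b(3) by blast
  qed
  have T_countable: "countable T" using B(1) by (auto simp: T_def)
  have weak: "(\<forall>v\<in>F. e \<le> L \<omega> v) \<longleftrightarrow> (\<forall>v\<in>T. e \<le> L \<omega> v)" for e \<omega>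
  proof
    assume T_ge: "\<forall>v\<in>T. e \<le> L \<omega> v"
    have "open {v. L \<omega> v < e}" by (intro open_Collect_less cont continuous_on_const)
    from dense[OF this] T_ge show "\<forall>v\<in>F. e \<le> L \<omega> v"
      by (metis (mono_tags, lifting) disjoint_iff linorder_not_le mem_Collect_eq)
  qed (use T_sub in auto)
  have strict: "(\<forall>v\<in>F. 0 < L \<omega> v) \<longleftrightarrow> (\<exists>m::nat. \<forall>v\<in>F. 1 / Suc m \<le> L \<omega> v)" for \<omega>
  proof
    assume pos: "\<forall>v\<in>F. 0 < L \<omega> v"
    show "\<exists>m::nat. \<forall>v\<in>F. 1 / Suc m \<le> L \<omega> v"
    proof (cases "F = {}")
      case False
      then obtain u where u: "u \<in> F" "\<And>v. v \<in> F \<Longrightarrow> L \<omega> u \<le> L \<omega> v"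
        using continuous_attains_inf[OF F False continuous_on_subset[OF cont]] by (metis subset_UNIV)
      with pos obtain m :: nat where "inverse (Suc m) < L \<omega> u" using reals_Archimedean by blast
      with u(2) have "\<forall>v\<in>F. 1 / Suc m \<le> L \<omega> v"
        by (metis inverse_eq_divide less_eq_real_def order.trans)
      then show ?thesis ..
    qed simp
  next
    assume "\<exists>m::nat. \<forall>v\<in>F. 1 / Suc m \<le> L \<omega> v"
    then show "\<forall>v\<in>F. 0 < L \<omega> v"
      by (metis less_le_trans of_nat_0_less_iff zero_less_Suc zero_less_divide_1_iff)
  qed
  have "{\<omega> \<in> space M. \<forall>v\<in>F. 0 < L \<omega> v} = {\<omega> \<in> space M. \<exists>m::nat. \<forall>v\<in>T. 1 / Suc m \<le> L \<omega> v}"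
    unfolding strict weak ..
  also have "\<dots> \<in> sets M"
    using T_countable meas
    by (intro sets.sets_Collect_countable_Ex sets.sets_Collect_countable_Ball borel_measurable_le) auto
  finally show ?thesis .
qed

text \<open>Optimality and uniqueness merge into one strict inequality against all other feasible
  solutions, the form in which compactness yields measurability.\<close>

lemma exact_recovery_iff_strict:
  "exact_recovery k S \<longleftrightarrow> (\<exists>y z. ip_feasible (\<Union>i\<in>{1..k}. S i) k y z \<and>
     (\<forall>i\<in>{1..k}. \<exists>!p. p \<in> S i \<and> y p = 1) \<and>
     (\<forall>p\<in>\<Union>i\<in>{1..k}. S i. \<forall>q\<in>\<Union>i\<in>{1..k}. S i. z p q = 1 \<longrightarrow> (\<exists>i\<in>{1..k}. p \<in> S i \<and> q \<in> S i)) \<and>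
     (\<forall>y' z'. lp_feasible (\<Union>i\<in>{1..k}. S i) k y' z' \<longrightarrow>
       \<not> ((\<forall>p\<in>\<Union>i\<in>{1..k}. S i. y' p = y p) \<and> (\<forall>p\<in>\<Union>i\<in>{1..k}. S i. \<forall>q\<in>\<Union>i\<in>{1..k}. S i. z' p q = z p q)) \<longrightarrow>
       lp_cost (\<Union>i\<in>{1..k}. S i) z < lp_cost (\<Union>i\<in>{1..k}. S i) z'))"
proof -
  define P where "P = (\<Union>i\<in>{1..k}. S i)"
  have key: "(lp_optimal P k y z \<and> (\<forall>y' z'. lp_optimal P k y' z' \<longrightarrow>
           (\<forall>p\<in>P. y' p = y p) \<and> (\<forall>p\<in>P. \<forall>q\<in>P. z' p q = z p q))) \<longleftrightarrow>
    (\<forall>y' z'. lp_feasible P k y' z' \<longrightarrow> \<not> ((\<forall>p\<in>P. y' p = y p) \<and> (\<forall>p\<in>P. \<forall>q\<in>P. z' p q = z p q)) \<longrightarrow>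
       lp_cost P z < lp_cost P z')" (is "?opt \<longleftrightarrow> ?strict")
    if feas: "lp_feasible P k y z" for y z
  proof
    assume ?opt
    show ?strict
    proof (intro allI impI)
      fix y' z' assume feas': "lp_feasible P k y' z'"
        and ne: "\<not> ((\<forall>p\<in>P. y' p = y p) \<and> (\<forall>p\<in>P. \<forall>q\<in>P. z' p q = z p q))"
      have le: "lp_cost P z \<le> lp_cost P z'" using \<open>?opt\<close> feas' by (simp add: lp_optimal_def)
      have "lp_cost P z \<noteq> lp_cost P z'"
      proof
        assume "lp_cost P z = lp_cost P z'"
        then have "lp_optimal P k y' z'" using \<open>?opt\<close> feas' by (simp add: lp_optimal_def)
        then show False using \<open>?opt\<close> ne by blast
      qed
      with le show "lp_cost P z < lp_cost P z'" by simp
    qed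
  next
    assume strict: ?strict
    have le: "lp_cost P z \<le> lp_cost P z'" if "lp_feasible P k y' z'" for y' z'
    proof (cases "(\<forall>p\<in>P. y' p = y p) \<and> (\<forall>p\<in>P. \<forall>q\<in>P. z' p q = z p q)")
      case True
      then have "lp_cost P z' = lp_cost P z" by (simp add: lp_cost_def)
      then show ?thesis by simp
    next
      case False
      then show ?thesis using strict that less_imp_le by blast
    qed
    have uniq: "(\<forall>p\<in>P. y' p = y p) \<and> (\<forall>p\<in>P. \<forall>q\<in>P. z' p q = z p q)" if "lp_optimal P k y' z'" for y' z'
    proof (rule ccontr)
      assume "\<not> ?thesis"
      moreover have "lp_feasible P k y' z'" using that by (simp add: lp_optimal_def)
      ultimately have "lp_cost P z < lp_cost P z'" using strict by blast
      moreover have "lp_cost P z' \<le> lp_cost P z" using that feas by (simp add: lp_optimal_def)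
      ultimately show False by simp
    qed
    show ?opt using le uniq feas unfolding lp_optimal_def[of P k y z] by blast
  qed
  show ?thesis
    unfolding exact_recovery_def Let_def P_def[symmetric]
  proof (intro iffI; elim exE conjE)
    fix y z assume a: "lp_optimal P k y z" "\<forall>y' z'. lp_optimal P k y' z' \<longrightarrow>
        (\<forall>p\<in>P. y' p = y p) \<and> (\<forall>p\<in>P. \<forall>q\<in>P. z' p q = z p q)"
      and b: "ip_feasible P k y z" "\<forall>i\<in>{1..k}. \<exists>!p. p \<in> S i \<and> y p = 1"
        "\<forall>p\<in>P. \<forall>q\<in>P. z p q = 1 \<longrightarrow> (\<exists>i\<in>{1..k}. p \<in> S i \<and> q \<in> S i)"
    have "lp_feasible P k y z" using b(1) by (simp add: ip_feasible_def)
    note iffD1[OF key[OF this] conjI[OF a]]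
    with b show "\<exists>y z. ip_feasible P k y z \<and> (\<forall>i\<in>{1..k}. \<exists>!p. p \<in> S i \<and> y p = 1) \<and>
       (\<forall>p\<in>P. \<forall>q\<in>P. z p q = 1 \<longrightarrow> (\<exists>i\<in>{1..k}. p \<in> S i \<and> q \<in> S i)) \<and>
       (\<forall>y' z'. lp_feasible P k y' z' \<longrightarrow> \<not> ((\<forall>p\<in>P. y' p = y p) \<and> (\<forall>p\<in>P. \<forall>q\<in>P. z' p q = z p q)) \<longrightarrow>
         lp_cost P z < lp_cost P z')" by (intro exI[of _ y] exI[of _ z] conjI)
  next
    fix y z assume b: "ip_feasible P k y z" "\<forall>i\<in>{1..k}. \<exists>!p. p \<in> S i \<and> y p = 1"
        "\<forall>p\<in>P. \<forall>q\<in>P. z p q = 1 \<longrightarrow> (\<exists>i\<in>{1..k}. p \<in> S i \<and> q \<in> S i)"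
      and a: "\<forall>y' z'. lp_feasible P k y' z' \<longrightarrow>
        \<not> ((\<forall>p\<in>P. y' p = y p) \<and> (\<forall>p\<in>P. \<forall>q\<in>P. z' p q = z p q)) \<longrightarrow> lp_cost P z < lp_cost P z'"
    have "lp_feasible P k y z" using b(1) by (simp add: ip_feasible_def)
    note iffD2[OF key[OF this] a]
    with b show "\<exists>y z. lp_optimal P k y z \<and> (\<forall>y' z'. lp_optimal P k y' z' \<longrightarrow>
        (\<forall>p\<in>P. y' p = y p) \<and> (\<forall>p\<in>P. \<forall>q\<in>P. z' p q = z p q)) \<and> ip_feasible P k y z \<and>
        (\<forall>i\<in>{1..k}. \<exists>!p. p \<in> S i \<and> y p = 1) \<and>
        (\<forall>p\<in>P. \<forall>q\<in>P. z p q = 1 \<longrightarrow> (\<exists>i\<in>{1..k}. p \<in> S i \<and> q \<in> S i))"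
      by (elim conjE) (intro exI[of _ y] exI[of _ z] conjI)
  qed
qed

text \<open>A solution indexed by \<open>J\<close> is a single function on the sum type \<open>'i + 'i \<times> 'i\<close>, which vanishes
  outside of \<open>J <+> J \<times> J\<close>: the values at \<open>Inl p\<close> and \<open>Inr (p, q)\<close> are \<open>y p\<close> and \<open>z p q\<close>.\<close>

definition lp_polytope :: "'i set \<Rightarrow> nat \<Rightarrow> ('i + 'i \<times> 'i \<Rightarrow> real) set" where
  "lp_polytope J k = {v. lp_feasible J k (\<lambda>p. v (Inl p)) (\<lambda>p q. v (Inr (p, q))) \<and>
     (\<forall>t. t \<notin> J <+> J \<times> J \<longrightarrow> v t = 0)}"

text \<open>The function space is a product over a possibly infinite type, so boundedness alone does
  not suffice. The box is compact by Tychonoff, its factors outside of the index set being {0};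
  inside, z is at most y, and y is at most the total k.\<close>

lemma compact_lp_polytope:
  assumes J: "finite J"
  shows "compact (lp_polytope J k)"
proof -
  let ?T = "J <+> J \<times> J"
  define Box where "Box = (\<Pi>\<^sub>E t\<in>UNIV. if t \<in> ?T then {0..real k} else {0::real})"
  have "compactin (product_topology (\<lambda>_. euclidean) UNIV) Box"
    unfolding Box_def compactin_PiE by auto
  then have Box: "compact Box" by (simp add: euclidean_product_topology)
  have coord: "continuous_on UNIV (\<lambda>v. v t)" for t :: "'a + 'a \<times> 'a"
    by (rule continuous_on_product_coordinates)
  have eq: "closed {v :: 'a + 'a \<times> 'a \<Rightarrow> real. f v = b}" if "continuous_on UNIV f" for f and b :: real
    by (intro closed_Collect_eq that continuous_on_const)
  have cl: "lp_polytope J k = {v. \<forall>q\<in>J. (\<Sum>p\<in>J. v (Inr (p, q))) = 1} \<inter>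
     {v. \<forall>p\<in>J. \<forall>q\<in>J. v (Inr (p, q)) \<le> v (Inl p)} \<inter> {v. (\<Sum>p\<in>J. v (Inl p)) = real k} \<inter>
     {v. \<forall>p\<in>J. 0 \<le> v (Inl p)} \<inter> {v. \<forall>p\<in>J. \<forall>q\<in>J. 0 \<le> v (Inr (p, q))} \<inter>
     {v. \<forall>t. t \<notin> ?T \<longrightarrow> v t = 0}"
    unfolding lp_polytope_def lp_feasible_def by blast
  have "closed (lp_polytope J k)"
    unfolding cl Collect_ball_eq Collect_all_eq Collect_imp_eq
    by (intro closed_Int closed_INT ballI closed_Un eq closed_Collect_le continuous_on_sum coord continuous_on_const)
      auto
  moreover have "lp_polytope J k \<subseteq> Box"
  proof
    fix v assume "v \<in> lp_polytope J k"
    then have v: "\<And>p q. p \<in> J \<Longrightarrow> q \<in> J \<Longrightarrow> v (Inr (p, q)) \<le> v (Inl p)" "(\<Sum>p\<in>J. v (Inl p)) = real k"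
      "\<And>p. p \<in> J \<Longrightarrow> 0 \<le> v (Inl p)" "\<And>p q. p \<in> J \<Longrightarrow> q \<in> J \<Longrightarrow> 0 \<le> v (Inr (p, q))"
      "\<And>t. t \<notin> ?T \<Longrightarrow> v t = 0"
      by (auto simp: lp_polytope_def lp_feasible_def)
    have le_k: "v (Inl p) \<le> real k" if "p \<in> J" for p
      using member_le_sum[of p J "\<lambda>p. v (Inl p)"] v(2,3) J that by simp
    have "v t \<in> {0..real k}" if "t \<in> ?T" for t
      using that
    proof (elim PlusE SigmaE)
      fix p assume "p \<in> J" "t = Inl p"
      then show ?thesis using le_k[of p] v(3)[of p] by simp
    next
      fix w p q assume "t = Inr w" "p \<in> J" "q \<in> J" "w = (p, q)"
      then show ?thesis using le_k[of p] v(1)[of p q] v(4)[of p q] by simp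
    qed
    then show "v \<in> Box" using v(5) by (simp add: Box_def PiE_UNIV_domain)
  qed
  ultimately show ?thesis using Box compact_Int_closed[of Box "lp_polytope J k"] by (simp add: Int_absorb1)
qed

text \<open>The feasible set is indexed and hence independent of the outcome, which enters only
  through the cost coefficients \<open>d\<close>.\<close>

definition strict_index_optimum :: "nat \<Rightarrow> 'i set \<Rightarrow> ('i \<Rightarrow> 'i \<Rightarrow> real) \<Rightarrow> ('i + 'i \<times> 'i \<Rightarrow> real) \<Rightarrow> bool" where
  "strict_index_optimum k J d u \<longleftrightarrow> (\<forall>v\<in>lp_polytope J k. v \<noteq> u \<longrightarrow>
     0 < (\<Sum>p\<in>J. \<Sum>q\<in>J. d p q * (v (Inr (p, q)) - u (Inr (p, q)))))"

definition recovers_index :: "nat \<Rightarrow> (nat \<Rightarrow> 'i set) \<Rightarrow> ('i + 'i \<times> 'i \<Rightarrow> real) \<Rightarrow> bool" where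
  "recovers_index k K u \<longleftrightarrow> (\<forall>i\<in>{1..k}. \<exists>!p. p \<in> K i \<and> u (Inl p) = 1) \<and>
     (\<forall>p\<in>\<Union>i\<in>{1..k}. K i. \<forall>q\<in>\<Union>i\<in>{1..k}. K i. u (Inr (p, q)) = 1 \<longrightarrow> (\<exists>i\<in>{1..k}. p \<in> K i \<and> q \<in> K i))"

lemma Ex1_image:
  assumes inj: "inj_on f A"
  shows "(\<exists>!b. b \<in> f ` A \<and> Q b) \<longleftrightarrow> (\<exists>!a. a \<in> A \<and> Q (f a))"
proof
  assume "\<exists>!b. b \<in> f ` A \<and> Q b"
  then obtain a where a: "a \<in> A" "Q (f a)" and uniq: "\<And>b. b \<in> f ` A \<Longrightarrow> Q b \<Longrightarrow> b = f a" by blast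
  show "\<exists>!a. a \<in> A \<and> Q (f a)"
  proof (rule ex1I[of _ a])
    show "a' = a" if "a' \<in> A \<and> Q (f a')" for a'
      using uniq[of "f a'"] inj_onD[OF inj, of a' a] that a(1) by blast
  qed (use a in blast)
next
  assume "\<exists>!a. a \<in> A \<and> Q (f a)"
  then show "\<exists>!b. b \<in> f ` A \<and> Q b" by blast
qed

text \<open>Feasibility, cost and recovery are invariant under renaming points along the injection
  f. \<open>vec\<close> encodes a solution, remembering exactly its values on the image of
  \<open>J\<close>; \<open>yy\<close> and \<open>zz\<close> decode it.\<close>

lemma exact_recovery_index:
  fixes f :: "'i \<Rightarrow> 'a::metric_space"
  assumes inj: "inj_on f J" and J: "J = (\<Union>i\<in>{1..k}. K i)" and S: "\<And>i. i \<in> {1..k} \<Longrightarrow> S i = f ` K i"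
  shows "exact_recovery k S \<longleftrightarrow> (\<exists>u\<in>lp_polytope J k. (\<forall>t. u t \<in> {0, 1}) \<and> recovers_index k K u \<and>
    strict_index_optimum k J (\<lambda>p q. dist (f p) (f q)) u)"
proof -
  have P: "(\<Union>i\<in>{1..k}. S i) = f ` J" using S by (auto simp: J)
  define g where "g = inv_into J f"
  have g: "g (f p) = p" if "p \<in> J" for p using inv_into_f_f[OF inj that] by (simp add: g_def)
  define vec where "vec y z t = (case t of Inl p \<Rightarrow> if p \<in> J then y (f p) else 0
    | Inr (p, q) \<Rightarrow> if p \<in> J \<and> q \<in> J then z (f p) (f q) else (0::real))"
    for y :: "'a \<Rightarrow> real" and z t
  have vecL: "vec y z (Inl p) = y (f p)" if "p \<in> J" for y z p
    using that by (simp add: vec_def)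
  have vecR: "vec y z (Inr (p, q)) = z (f p) (f q)" if "p \<in> J" "q \<in> J" for y z p q
    using that by (simp add: vec_def)
  define yy where "yy v p = v (Inl (g p))" for v :: "'i + 'i \<times> 'i \<Rightarrow> real" and p
  define zz where "zz v p q = v (Inr (g p, g q))" for v :: "'i + 'i \<times> 'i \<Rightarrow> real" and p q
  have feas_f: "lp_feasible (f ` J) k y z \<longleftrightarrow> lp_feasible J k (\<lambda>p. y (f p)) (\<lambda>p q. z (f p) (f q))" for y z
    unfolding lp_feasible_def by (simp add: sum.reindex[OF inj])
  have feas_cong: "lp_feasible J k y z \<longleftrightarrow> lp_feasible J k y' z'"
    if "\<And>p. p \<in> J \<Longrightarrow> y p = y' p" "\<And>p q. p \<in> J \<Longrightarrow> q \<in> J \<Longrightarrow> z p q = z' p q" for y z y' z'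
    unfolding lp_feasible_def using that by (simp cong: sum.cong)
  have vec_in: "vec y z \<in> lp_polytope J k \<longleftrightarrow> lp_feasible (f ` J) k y z" for y z
  proof -
    have "vec y z t = 0" if "t \<notin> J <+> J \<times> J" for t
      using that by (auto simp: vec_def split: sum.split)
    moreover have "lp_feasible J k (\<lambda>p. vec y z (Inl p)) (\<lambda>p q. vec y z (Inr (p, q))) \<longleftrightarrow>
      lp_feasible J k (\<lambda>p. y (f p)) (\<lambda>p q. z (f p) (f q))"
      by (rule feas_cong) (simp_all add: vec_def)
    ultimately show ?thesis by (simp add: lp_polytope_def feas_f)
  qed
  have vec_inv: "vec (yy v) (zz v) = v" if "v \<in> lp_polytope J k" for v
  proof
    have "v t = 0" if "t \<notin> J <+> J \<times> J" for t
      using \<open>v \<in> lp_polytope J k\<close> that unfolding lp_polytope_def by blast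
    then have "v (Inl p) = 0" if "p \<notin> J" for p using that by blast
    moreover have "v (Inr (p, q)) = 0" if "\<not> (p \<in> J \<and> q \<in> J)" for p q
      using that \<open>\<And>t. t \<notin> J <+> J \<times> J \<Longrightarrow> v t = 0\<close>[of "Inr (p, q)"] by blast
    ultimately show "vec (yy v) (zz v) t = v t" for t
      by (cases t) (auto simp: vec_def yy_def zz_def g)
  qed
  have all_vec: "(\<forall>v\<in>lp_polytope J k. Q v) \<longleftrightarrow> (\<forall>y z. vec y z \<in> lp_polytope J k \<longrightarrow> Q (vec y z))" for Q
  proof (intro iffI ballI allI impI)
    fix v assume "\<forall>y z. vec y z \<in> lp_polytope J k \<longrightarrow> Q (vec y z)" and v: "v \<in> lp_polytope J k"
    then have "vec (yy v) (zz v) \<in> lp_polytope J k \<longrightarrow> Q (vec (yy v) (zz v))" by blast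
    then show "Q v" unfolding vec_inv[OF v] using v by blast
  qed blast
  have ex_vec: "(\<exists>v\<in>lp_polytope J k. Q v) \<longleftrightarrow> (\<exists>y z. vec y z \<in> lp_polytope J k \<and> Q (vec y z))" for Q
    using all_vec[of "\<lambda>v. \<not> Q v"] by blast
  have vec_eq: "vec y z = vec y' z' \<longleftrightarrow> (\<forall>p\<in>f`J. y p = y' p) \<and> (\<forall>p\<in>f`J. \<forall>q\<in>f`J. z p q = z' p q)" for y z y' z'
  proof
    assume eq: "vec y z = vec y' z'"
    have "vec y z (Inl p) = vec y' z' (Inl p)" "vec y z (Inr (p, q)) = vec y' z' (Inr (p, q))" for p q
      unfolding eq by simp_all
    then have "y (f p) = y' (f p)" "z (f p) (f q) = z' (f p) (f q)" if "p \<in> J" "q \<in> J" for p q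
      using vecL[OF that(1), of y z] vecL[OF that(1), of y' z'] vecR[OF that, of y z] vecR[OF that, of y' z']
      by simp_all
    then show "(\<forall>p\<in>f`J. y p = y' p) \<and> (\<forall>p\<in>f`J. \<forall>q\<in>f`J. z p q = z' p q)"
      by blast
  next
    assume "(\<forall>p\<in>f`J. y p = y' p) \<and> (\<forall>p\<in>f`J. \<forall>q\<in>f`J. z p q = z' p q)"
    then show "vec y z = vec y' z'" by (auto simp: vec_def fun_eq_iff split: sum.split)
  qed
  have cost: "lp_cost (f ` J) z < lp_cost (f ` J) z' \<longleftrightarrow>
    0 < (\<Sum>p\<in>J. \<Sum>q\<in>J. dist (f p) (f q) * (vec y' z' (Inr (p, q)) - vec y z (Inr (p, q))))" for y z y' z'
  proof -
    have "(\<Sum>p\<in>J. \<Sum>q\<in>J. dist (f p) (f q) * (vec y' z' (Inr (p, q)) - vec y z (Inr (p, q)))) =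
      (\<Sum>p\<in>J. \<Sum>q\<in>J. dist (f p) (f q) * z' (f p) (f q) - dist (f p) (f q) * z (f p) (f q))"
      by (intro sum.cong refl) (simp add: vec_def algebra_simps)
    also have "\<dots> = lp_cost (f ` J) z' - lp_cost (f ` J) z"
      by (simp add: lp_cost_def sum.reindex[OF inj] sum_subtractf)
    finally show ?thesis by simp
  qed
  have strict: "strict_index_optimum k J (\<lambda>p q. dist (f p) (f q)) (vec y z) \<longleftrightarrow>
    (\<forall>y' z'. lp_feasible (f ` J) k y' z' \<longrightarrow>
       \<not> ((\<forall>p\<in>f ` J. y' p = y p) \<and> (\<forall>p\<in>f ` J. \<forall>q\<in>f ` J. z' p q = z p q)) \<longrightarrow>
       lp_cost (f ` J) z < lp_cost (f ` J) z')" for y z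
  proof -
    have "strict_index_optimum k J (\<lambda>p q. dist (f p) (f q)) (vec y z) \<longleftrightarrow>
      (\<forall>y' z'. vec y' z' \<in> lp_polytope J k \<longrightarrow> vec y' z' \<noteq> vec y z \<longrightarrow>
        0 < (\<Sum>p\<in>J. \<Sum>q\<in>J. dist (f p) (f q) * (vec y' z' (Inr (p, q)) - vec y z (Inr (p, q)))))"
      unfolding strict_index_optimum_def by (rule all_vec)
    then show ?thesis unfolding vec_in vec_eq cost[symmetric] .
  qed
  have ip: "ip_feasible (f ` J) k y z \<longleftrightarrow> vec y z \<in> lp_polytope J k \<and> (\<forall>t. vec y z t \<in> {0, 1})" for y z
  proof -
    have "(\<forall>t. vec y z t \<in> {0, 1}) \<longleftrightarrow>
      (\<forall>p\<in>f`J. y p \<in> {0, 1}) \<and> (\<forall>p\<in>f`J. \<forall>q\<in>f`J. z p q \<in> {0, 1})" (is "?l \<longleftrightarrow> ?r")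
    proof
      assume ?l
      then have "vec y z (Inl p) \<in> {0, 1}" "vec y z (Inr (p, q)) \<in> {0, 1}" for p q by blast+
      then have "y (f p) \<in> {0, 1}" "z (f p) (f q) \<in> {0, 1}" if "p \<in> J" "q \<in> J" for p q
        using \<open>?l\<close>[THEN spec, of "Inl p"] \<open>?l\<close>[THEN spec, of "Inr (p, q)"]
        unfolding vecL[OF that(1)] vecR[OF that] by simp_all
      then show ?r by blast
    next
      assume ?r
      then show ?l by (auto simp: vec_def split: sum.split)
    qed
    then show ?thesis by (simp add: ip_feasible_def vec_in)
  qed
  have KJ: "p \<in> J" if "i \<in> {1..k}" "p \<in> K i" for i p using that by (auto simp: J)
  have SK: "f p \<in> S i \<longleftrightarrow> p \<in> K i" if "i \<in> {1..k}" "p \<in> J" for i p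
    using inj_on_image_mem_iff[OF inj that(2)] S[OF that(1)] KJ[OF that(1)] by (simp add: subset_iff)
  have recov: "recovers_index k K (vec y z) \<longleftrightarrow> (\<forall>i\<in>{1..k}. \<exists>!p. p \<in> S i \<and> y p = 1) \<and>
     (\<forall>p\<in>f ` J. \<forall>q\<in>f ` J. z p q = 1 \<longrightarrow> (\<exists>i\<in>{1..k}. p \<in> S i \<and> q \<in> S i))" for y z
  proof -
    have "(\<exists>!p. p \<in> K i \<and> vec y z (Inl p) = 1) \<longleftrightarrow> (\<exists>!p. p \<in> S i \<and> y p = 1)" if i: "i \<in> {1..k}" for i
    proof -
      have "(\<exists>!p. p \<in> K i \<and> vec y z (Inl p) = 1) \<longleftrightarrow> (\<exists>!p. p \<in> K i \<and> y (f p) = 1)"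
        using KJ[OF i] vecL by (metis (no_types, lifting))
      also have "\<dots> \<longleftrightarrow> (\<exists>!p. p \<in> S i \<and> y p = 1)"
        unfolding S[OF i] by (rule Ex1_image[OF inj_on_subset[OF inj], symmetric]) (use KJ[OF i] in blast)
      finally show ?thesis .
    qed
    moreover have "(\<forall>p\<in>J. \<forall>q\<in>J. vec y z (Inr (p, q)) = 1 \<longrightarrow> (\<exists>i\<in>{1..k}. p \<in> K i \<and> q \<in> K i)) \<longleftrightarrow>
      (\<forall>p\<in>f ` J. \<forall>q\<in>f ` J. z p q = 1 \<longrightarrow> (\<exists>i\<in>{1..k}. p \<in> S i \<and> q \<in> S i))"
    proof -
      have "(\<exists>i\<in>{1..k}. p \<in> K i \<and> q \<in> K i) \<longleftrightarrow> (\<exists>i\<in>{1..k}. f p \<in> S i \<and> f q \<in> S i)"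
        if "p \<in> J" "q \<in> J" for p q using SK that by blast
      then show ?thesis by (simp add: vecR del: One_nat_def)
    qed
    ultimately show ?thesis unfolding recovers_index_def J[symmetric] by simp
  qed
  have "exact_recovery k S \<longleftrightarrow> (\<exists>y z. vec y z \<in> lp_polytope J k \<and> (\<forall>t. vec y z t \<in> {0, 1}) \<and>
     recovers_index k K (vec y z) \<and> strict_index_optimum k J (\<lambda>p q. dist (f p) (f q)) (vec y z))"
    unfolding exact_recovery_iff_strict P strict recov ip conj_assoc ..
  then show ?thesis unfolding ex_vec .
qed

text \<open>The polytope without \<open>u\<close> is not compact in general, but it is a countable
  union of the compact sets \<open>D t m\<close> of solutions that differ from \<open>u\<close> by
  at least 1 / (m + 1) in coordinate t. Countability of the index type makes the coordinates t
  countable.\<close>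

lemma sets_Collect_strict_index_optimum:
  fixes u :: "'i::countable + 'i \<times> 'i \<Rightarrow> real"
  assumes J: "finite J"
    and d: "\<And>p q. p \<in> J \<Longrightarrow> q \<in> J \<Longrightarrow> (\<lambda>\<omega>. d \<omega> p q) \<in> borel_measurable M"
  shows "{\<omega> \<in> space M. strict_index_optimum k J (d \<omega>) u} \<in> sets M"
proof -
  define L where "L \<omega> v = (\<Sum>p\<in>J. \<Sum>q\<in>J. d \<omega> p q * (v (Inr (p, q)) - u (Inr (p, q))))" for \<omega> and v :: "'i + 'i \<times> 'i \<Rightarrow> real"
  define D where "D t m = lp_polytope J k \<inter> {v. 1 / real (Suc m) \<le> \<bar>v t - u t\<bar>}" for t m
  have "compact (D t m)" for t m
    unfolding D_def
    by (intro compact_Int_closed compact_lp_polytope J closed_Collect_le continuous_intros continuous_on_product_coordinates)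
  moreover have "continuous_on UNIV (L \<omega>)" for \<omega>
    unfolding L_def by (intro continuous_intros continuous_on_product_coordinates)
  moreover have "(\<lambda>\<omega>. L \<omega> v) \<in> borel_measurable M" for v
    unfolding L_def using d by measurable
  ultimately have sets: "{\<omega> \<in> space M. \<forall>v\<in>D t m. 0 < L \<omega> v} \<in> sets M" for t m
    by (rule sets_Collect_positive_on_compact)
  have D: "v \<noteq> u \<longleftrightarrow> (\<exists>t m. v \<in> D t m)" if "v \<in> lp_polytope J k" for v
  proof
    assume "v \<noteq> u"
    then obtain t where "v t \<noteq> u t" by blast
    then obtain m where "inverse (real (Suc m)) < \<bar>v t - u t\<bar>"
      using reals_Archimedean[of "\<bar>v t - u t\<bar>"] by auto
    then have "v \<in> D t m" using that by (simp add: D_def inverse_eq_divide)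
    then show "\<exists>t m. v \<in> D t m" by blast
  next
    assume "\<exists>t m. v \<in> D t m"
    then obtain t m where "1 / real (Suc m) \<le> \<bar>v t - u t\<bar>" by (auto simp: D_def)
    moreover have "0 < 1 / real (Suc m)" by simp
    ultimately show "v \<noteq> u" by auto
  qed
  have "D t m \<subseteq> lp_polytope J k" for t m by (simp add: D_def)
  then have "strict_index_optimum k J (d \<omega>) u \<longleftrightarrow> (\<forall>t m. \<forall>v\<in>D t m. 0 < L \<omega> v)" for \<omega>
    unfolding strict_index_optimum_def L_def[symmetric] using D by blast
  then show ?thesis by (simp add: sets sets.sets_Collect_countable_All)
qed

text \<open>Since draws may coincide, the program lives on the values over a set \<open>J\<close> of indices on which
  \<open>\<omega>\<close> is injective; the event is the finite union over the possible \<open>J\<close> and \<open>K\<close>.\<close>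

lemma sets_Collect_exact_recovery:
  fixes M :: "(nat \<times> nat \<Rightarrow> 'a::metric_space) measure"
  assumes meas: "\<And>a b. a \<in> (SIGMA i:{1..k}. {1..ns i}) \<Longrightarrow> b \<in> (SIGMA i:{1..k}. {1..ns i}) \<Longrightarrow>
    (\<lambda>\<omega>. dist (\<omega> a) (\<omega> b)) \<in> borel_measurable M"
  shows "{\<omega> \<in> space M. exact_recovery k (drawn ns \<omega>)} \<in> sets M"
proof -
  define I where "I = (SIGMA i:{1..k}. {1..ns i})"
  have finI: "finite I" by (simp add: I_def)
  define A where "A i = {i} \<times> {1..ns i}" for i
  have AI: "A i \<subseteq> I" if "i \<in> {1..k}" for i using that by (auto simp: A_def I_def)
  have IA: "I = (\<Union>i\<in>{1..k}. A i)" by (auto simp: A_def I_def)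
  have drawn: "drawn ns \<omega> i = \<omega> ` A i" for \<omega> :: "nat \<times> nat \<Rightarrow> 'a" and i
    by (auto simp: drawn_def A_def)
  define V where "V J = {u \<in> lp_polytope J k. \<forall>t. u t \<in> {0, 1}}" for J :: "(nat \<times> nat) set"
  define R where "R J K \<omega> \<longleftrightarrow> inj_on \<omega> J \<and> \<omega> ` J = \<omega> ` I \<and> (\<forall>i\<in>{1..k}. \<omega> ` K i = \<omega> ` A i) \<and>
      (\<exists>u\<in>V J. recovers_index k K u \<and> strict_index_optimum k J (\<lambda>p q. dist (\<omega> p) (\<omega> q)) u)"
    for J K and \<omega> :: "nat \<times> nat \<Rightarrow> 'a"
  define KK where "KK J = {K \<in> {1..k} \<rightarrow>\<^sub>E Pow J. (\<Union>i\<in>{1..k}. K i) = J}" for J :: "(nat \<times> nat) set"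
  have R: "exact_recovery k (drawn ns \<omega>) \<longleftrightarrow>
    (\<exists>u\<in>V J. recovers_index k K u \<and> strict_index_optimum k J (\<lambda>p q. dist (\<omega> p) (\<omega> q)) u)"
    if "inj_on \<omega> J" "K \<in> KK J" "\<And>i. i \<in> {1..k} \<Longrightarrow> \<omega> ` K i = \<omega> ` A i" for \<omega> :: "nat \<times> nat \<Rightarrow> 'a" and J K
  proof -
    have "J = (\<Union>i\<in>{1..k}. K i)" using that(2) by (simp add: KK_def)
    from exact_recovery_index[OF that(1) this, of "drawn ns \<omega>"] show ?thesis
      using that(3) by (auto simp: drawn V_def)
  qed
  have iff: "exact_recovery k (drawn ns \<omega>) \<longleftrightarrow> (\<exists>J\<in>Pow I. \<exists>K\<in>KK J. R J K \<omega>)" for \<omega> :: "nat \<times> nat \<Rightarrow> 'a"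
  proof
    assume ex: "exact_recovery k (drawn ns \<omega>)"
    obtain J where J: "J \<subseteq> I" "inj_on \<omega> J" "\<omega> ` I = \<omega> ` J"
      using subset_image_inj[of "\<omega> ` I" \<omega> I] by auto
    \<comment> \<open>\<open>K i\<close> represents the points drawn from ball i. It may differ from
      the intersection of \<open>A i\<close> with \<open>J\<close>, since the chosen representative
      of a point can carry the index of another draw with the same value.\<close>
    define K where "K = (\<lambda>i\<in>{1..k}. {j \<in> J. \<omega> j \<in> \<omega> ` A i})"
    have KA: "\<omega> ` K i = \<omega> ` A i" if "i \<in> {1..k}" for i
    proof
      show "\<omega> ` A i \<subseteq> \<omega> ` K i"
      proof
        fix x assume x: "x \<in> \<omega> ` A i"
        then have "x \<in> \<omega> ` J" using AI[OF that] J(3) by blast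
        then obtain j where j: "j \<in> J" "x = \<omega> j" by blast
        then have "j \<in> K i" using x that by (simp add: K_def)
        with j(2) show "x \<in> \<omega> ` K i" by blast
      qed
    qed (use that in \<open>auto simp: K_def\<close>)
    have "J \<subseteq> (\<Union>i\<in>{1..k}. K i)"
    proof
      fix j assume j: "j \<in> J"
      then obtain i where "i \<in> {1..k}" "j \<in> A i" using J(1) IA by blast
      then show "j \<in> (\<Union>i\<in>{1..k}. K i)" using j by (auto simp: K_def)
    qed
    then have "K \<in> KK J" by (auto simp: KK_def K_def)
    then show "\<exists>J\<in>Pow I. \<exists>K\<in>KK J. R J K \<omega>"
    proof (intro bexI)
      have "\<exists>u\<in>V J. recovers_index k K u \<and> strict_index_optimum k J (\<lambda>p q. dist (\<omega> p) (\<omega> q)) u"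
        by (rule iffD1[OF R[OF J(2) \<open>K \<in> KK J\<close> KA] ex])
      then show "R J K \<omega>" unfolding R_def using J(2) J(3)[symmetric] KA by (intro conjI ballI)
    qed (use J(1) \<open>K \<in> KK J\<close> in simp_all)
  next
    assume "\<exists>J\<in>Pow I. \<exists>K\<in>KK J. R J K \<omega>"
    then obtain J K where K: "K \<in> KK J" and RJK: "R J K \<omega>" by blast
    note RJK = RJK[unfolded R_def]
    show "exact_recovery k (drawn ns \<omega>)"
    proof (rule iffD2[OF R[OF conjunct1[OF RJK] K]])
      show "\<omega> ` K i = \<omega> ` A i" if "i \<in> {1..k}" for i using RJK that by (elim conjE) (rule bspec)
    qed (use RJK in \<open>elim conjE\<close>)
  qed
  have finV: "finite (V J)" if "finite J" for J
  proof (rule finite_subset)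
    show "V J \<subseteq> {u. \<forall>t. (t \<in> J <+> J \<times> J \<longrightarrow> u t \<in> {0, 1}) \<and> (t \<notin> J <+> J \<times> J \<longrightarrow> u t = 0)}"
      by (auto simp: V_def lp_polytope_def)
    show "finite {u. \<forall>t. (t \<in> J <+> J \<times> J \<longrightarrow> u t \<in> {0, 1::real}) \<and> (t \<notin> J <+> J \<times> J \<longrightarrow> u t = 0)}"
      using that by (intro finite_set_of_finite_funs) auto
  qed
  have finKK: "finite (KK J)" if "finite J" for J
    unfolding KK_def using that by (intro finite_Collect_conjI disjI1) (auto intro!: finite_PiE)
  have eq: "Measurable.pred M (\<lambda>\<omega>. \<omega> a = \<omega> b)" if "a \<in> I" "b \<in> I" for a b
  proof -
    have "(\<lambda>\<omega>. \<omega> a = \<omega> b) = (\<lambda>\<omega>. dist (\<omega> a) (\<omega> b) = 0)" by simp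
    also have "Measurable.pred M \<dots>" using meas that unfolding I_def by measurable
    finally show ?thesis .
  qed
  have img: "Measurable.pred M (\<lambda>\<omega>. \<omega> ` X = \<omega> ` Y)" if "X \<subseteq> I" "Y \<subseteq> I" for X Y
  proof -
    have "(\<lambda>\<omega>. \<omega> ` X = \<omega> ` Y) = (\<lambda>\<omega>::nat \<times> nat \<Rightarrow> 'a. (\<forall>a\<in>X. \<exists>b\<in>Y. \<omega> a = \<omega> b) \<and> (\<forall>b\<in>Y. \<exists>a\<in>X. \<omega> a = \<omega> b))"
      by (rule ext) (auto simp: set_eq_iff image_iff, metis+)
    also have "Measurable.pred M \<dots>"
      using that finite_subset[OF that(1) finI] finite_subset[OF that(2) finI]
      by (intro pred_intros_logic pred_intros_finite eq) auto
    finally show ?thesis .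
  qed
  have "Measurable.pred M (R J K)" if J: "J \<subseteq> I" and K: "K \<in> KK J" for J K
  proof -
    have finJ: "finite J" using finite_subset[OF J finI] .
    have "(\<Union>i\<in>{1..k}. K i) = J" using K by (simp add: KK_def)
    then have KI: "K i \<subseteq> I" if "i \<in> {1..k}" for i using J that by blast
    have "Measurable.pred M (\<lambda>\<omega>. \<forall>a\<in>J. \<forall>b\<in>J. \<omega> a = \<omega> b \<longrightarrow> a = b)"
      using J finJ by (intro pred_intros_logic pred_intros_finite eq) auto
    then have inj: "Measurable.pred M (\<lambda>\<omega>. inj_on \<omega> J)" unfolding inj_on_def .
    have "Measurable.pred M (\<lambda>\<omega>. strict_index_optimum k J (\<lambda>p q. dist (\<omega> p) (\<omega> q)) u)" for u
      unfolding pred_def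
      by (rule sets_Collect_strict_index_optimum[OF finJ], rule meas) (use J in \<open>auto simp: I_def\<close>)
    then show ?thesis
      unfolding R_def using J KI AI finV[OF finJ] by (intro pred_intros_logic pred_intros_finite inj img) auto
  qed
  then have "Measurable.pred M (\<lambda>\<omega>. \<exists>J\<in>Pow I. \<exists>K\<in>KK J. R J K \<omega>)"
    using finI finKK finite_subset[OF _ finI] by (intro pred_intros_finite) auto
  then show ?thesis unfolding iff pred_def .
qed

section \<open>Typical samples\<close>

text \<open>Seen from p, the vectors v and w both point so far away from u that u has inner product
  less than (1 + 6.1009 - 10.8241) = -3.7232 with v + w. The parallelogram law gives |v + w|^2 < 4 *
  6.1009 - 10.8241 = 13.5795, which is less than 3.7232^2, against Cauchy-Schwarz with |u| at most
  1.\<close>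

lemma no_three_separated_centers:
  fixes a b d p :: "'a::real_inner"
  assumes "dist p a \<le> 1" "dist p b < 2.47" "dist p d < 2.47"
    and "3.29 < dist a b" "3.29 < dist a d" "3.29 < dist b d"
  shows False
proof -
  define u v w where "u = a - p" and "v = b - p" and "w = d - p"
  have sq: "x\<^sup>2 < y\<^sup>2" if "0 \<le> x" "x < y" for x y :: real using that by (simp add: power_strict_mono)
  have u: "u \<bullet> u \<le> 1"
    using assms(1) by (simp add: u_def dist_norm norm_minus_commute abs_square_le_1 flip: power2_norm_eq_inner)
  have "(norm v)\<^sup>2 < 2.47\<^sup>2" "(norm w)\<^sup>2 < 2.47\<^sup>2"
    using assms(2,3) by (intro sq; simp add: v_def w_def dist_norm norm_minus_commute)+
  moreover have "(2.47::real)\<^sup>2 = 6.1009" by (simp add: power2_eq_square)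
  ultimately have vw: "v \<bullet> v < 6.1009" "w \<bullet> w < 6.1009" unfolding power2_norm_eq_inner by metis+
  have "3.29\<^sup>2 < (norm (u - v))\<^sup>2" "3.29\<^sup>2 < (norm (u - w))\<^sup>2" "3.29\<^sup>2 < (norm (v - w))\<^sup>2"
    using assms(4-6) by (intro sq; simp add: u_def v_def w_def dist_norm)+
  moreover have "(3.29::real)\<^sup>2 = 10.8241" by (simp add: power2_eq_square)
  ultimately have far: "10.8241 < (u - v) \<bullet> (u - v)" "10.8241 < (u - w) \<bullet> (u - w)" "10.8241 < (v - w) \<bullet> (v - w)"
    unfolding power2_norm_eq_inner by metis+
  have 1: "u \<bullet> (v + w) < - 3.7232"
    using u vw far(1,2) by (simp add: inner_diff_left inner_diff_right inner_add_right inner_commute)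
  have 2: "(v + w) \<bullet> (v + w) < 13.5795"
    using vw far(3) by (simp add: inner_diff_left inner_diff_right inner_add_left inner_add_right inner_commute)
  have "(u \<bullet> (v + w))\<^sup>2 \<le> (u \<bullet> u) * ((v + w) \<bullet> (v + w))" by (rule Cauchy_Schwarz_ineq)
  also have "\<dots> \<le> 1 * ((v + w) \<bullet> (v + w))" using u by (intro mult_right_mono) auto
  also have "\<dots> < 13.5795" using 2 by simp
  finally have "(- (u \<bullet> (v + w)))\<^sup>2 < 13.5795" by simp
  moreover have "3.7232\<^sup>2 < (- (u \<bullet> (v + w)))\<^sup>2" by (rule sq) (use 1 in auto)
  ultimately show False by (simp add: power2_eq_square)
qed

text \<open>All assumptions on single balls range over every index, so that facts on
  \<open>\<mu> i\<close> carry no side condition; only the separation is confined to {1..k}.\<close>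

locale ball_model =
  fixes c :: "nat \<Rightarrow> real ^ 'm" and \<mu> :: "nat \<Rightarrow> (real ^ 'm) measure" and k :: nat and E :: real
  assumes dim: "2 \<le> CARD('m)" and k: "1 \<le> k"
    and ball: "\<And>i. prob_on_ball (c i) 1 (\<mu> i)"
    and rot: "\<And>i. rotation_invariant (c i) (\<mu> i)"
    and charges: "\<And>i. charges_center (c i) 1 (\<mu> i)"
    and null: "\<And>i. lebesgue_null_imp_null (\<mu> i)"
    and mean: "\<And>i. mean_dist (c i) (\<mu> i) = E"
    and sep: "\<And>i j. i \<in> {1..k} \<Longrightarrow> j \<in> {1..k} \<Longrightarrow> i \<noteq> j \<Longrightarrow> 3.29 < dist (c i) (c j)"
begin

text \<open>The bonus max 0 (s - 0.82) / 3 of the own ball pays for the one other ball that can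
  contribute: its center has distance R > 3.29 - s from p, so 2.47 - R < s - 0.82.\<close>

lemma sum_integral_clipped:
  assumes i: "i \<in> {1..k}" and s: "0.465 \<le> dist p (c i)" "dist p (c i) \<le> 1"
  shows "(\<Sum>j\<in>{1..k}. \<integral>x. clipped p x \<partial>\<mu> j) \<le> 1.468 - E"
proof -
  define m where "m = max 0 (dist p (c i) - 0.82)"
  define J where "J = {1..k} - {i}"
  have far: "3.29 < dist p (c i) + dist p (c j)" if "j \<in> J" for j
    using sep[OF i, of j] that dist_triangle3[of "c i" "c j" p] by (auto simp: J_def dist_commute)
  have near: "(\<integral>x. clipped p x \<partial>\<mu> i) \<le> 1.468 - E - m / 3"
    using integral_clipped_near[OF dim ball rot s] by (simp add: mean m_def)
  have each: "(\<integral>x. clipped p x \<partial>\<mu> j) \<le> max 0 (2.47 - dist p (c j)) / 3" if "j \<in> J" for j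
    using integral_clipped_far[OF dim ball rot, of p j] far[OF that] s by simp
  have "(\<Sum>j\<in>J. max 0 (2.47 - dist p (c j)) / 3) \<le> m / 3"
  proof (cases "\<exists>j\<in>J. dist p (c j) < 2.47")
    case True
    then obtain j where j: "j \<in> J" "dist p (c j) < 2.47" by blast
    have "max 0 (2.47 - dist p (c l)) = 0" if l: "l \<in> J" "l \<noteq> j" for l
    proof -
      have "\<not> dist p (c l) < 2.47"
        using no_three_separated_centers[OF s(2) j(2), of "c l"] sep[of i j] sep[of i l] sep[of j l] i j(1) l
        by (auto simp: J_def)
      then show ?thesis by simp
    qed
    then have "(\<Sum>l\<in>J. max 0 (2.47 - dist p (c l)) / 3) = (\<Sum>l\<in>J. if l = j then (2.47 - dist p (c j)) / 3 else 0)"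
      using j(2) by (intro sum.cong refl) auto
    also have "\<dots> = (2.47 - dist p (c j)) / 3" using j(1) by (simp add: J_def)
    also have "\<dots> \<le> m / 3" using far[OF j(1)] by (simp add: m_def max_def)
    finally show ?thesis .
  next
    case False
    then have "(\<Sum>j\<in>J. max 0 (2.47 - dist p (c j)) / 3) = 0" by (intro sum.neutral) auto
    then show ?thesis by (simp add: m_def)
  qed
  moreover have "(\<Sum>j\<in>J. \<integral>x. clipped p x \<partial>\<mu> j) \<le> (\<Sum>j\<in>J. max 0 (2.47 - dist p (c j)) / 3)"
    by (intro sum_mono each)
  moreover have "(\<Sum>j\<in>{1..k}. \<integral>x. clipped p x \<partial>\<mu> j) = (\<integral>x. clipped p x \<partial>\<mu> i) + (\<Sum>j\<in>J. \<integral>x. clipped p x \<partial>\<mu> j)"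
    unfolding J_def using i by (intro sum.remove) auto
  ultimately show ?thesis using near by linarith
qed

text \<open>Removing the clipping in the near estimate leaves a gap of 1.47 - 1.468. This gap keeps
  the medoid within 0.465 of its center.\<close>

lemma integral_dist_far_from_center:
  assumes s: "0.465 \<le> dist p (c i)" "dist p (c i) \<le> 1"
  shows "E + 0.002 \<le> (\<integral>x. dist p x \<partial>\<mu> i)"
proof -
  interpret prob_space "\<mu> i" using ball[of i] by (simp add: prob_on_ball_def)
  have int: "integrable (\<mu> i) (\<lambda>x. dist p x)" by (intro integrable_on_ball[OF ball] continuous_intros)
  have "1.47 - (\<integral>x. dist p x \<partial>\<mu> i) = (\<integral>x. 1.47 - dist p x \<partial>\<mu> i)"
    using int by (simp add: prob_space)
  also have "\<dots> \<le> (\<integral>x. clipped p x \<partial>\<mu> i)"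
    using int integrable_on_ball[OF ball continuous_on_clipped]
    by (intro integral_mono) (auto simp: clipped_def)
  also have "\<dots> \<le> 1.468 - E - max 0 (dist p (c i) - 0.82) / 3"
    using integral_clipped_near[OF dim ball rot s] unfolding mean .
  also have "\<dots> \<le> 1.468 - E" by simp
  finally show ?thesis by simp
qed

lemma integral_dist_near_center: "(\<integral>x. dist p x \<partial>\<mu> i) \<le> E + dist p (c i)"
proof -
  interpret prob_space "\<mu> i" using ball[of i] by (simp add: prob_on_ball_def)
  have int: "integrable (\<mu> i) (\<lambda>x. dist x q)" "integrable (\<mu> i) (\<lambda>x. dist q x)" for q
    by (intro integrable_on_ball[OF ball] continuous_intros)+
  have "(\<integral>x. dist p x \<partial>\<mu> i) \<le> (\<integral>x. dist x (c i) + dist p (c i) \<partial>\<mu> i)"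
  proof (intro integral_mono)
    show "dist p x \<le> dist x (c i) + dist p (c i)" for x
      using dist_triangle2[of p x "c i"] by simp
  qed (use int in auto)
  also have "\<dots> = E + dist p (c i)" using int mean[of i] by (simp add: prob_space mean_dist_def)
  finally show ?thesis .
qed

text \<open>The deterministic core. For each ball, replacing \<alpha> by 1.47 costs at most 2
  \<epsilon> per point and the deviation from the mean another \<epsilon>; the total 3 k \<epsilon>
  must stay below the margin 0.002.\<close>

lemma exact_recovery_of_typical_sample:
  fixes \<omega> :: "nat \<times> nat \<Rightarrow> real ^ 'm"
  assumes n: "0 < n" and \<epsilon>: "0 \<le> \<epsilon>" "3 * real k * \<epsilon> < 0.002"
    and in_ball: "\<And>i l. i \<in> {1..k} \<Longrightarrow> l \<in> {1..n} \<Longrightarrow> \<omega> (i, l) \<in> cball (c i) 1"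
    and distinct: "\<And>i l l'. i \<in> {1..k} \<Longrightarrow> l \<in> {1..n} \<Longrightarrow> l' \<in> {1..n} \<Longrightarrow> l \<noteq> l' \<Longrightarrow> \<omega> (i, l) \<noteq> \<omega> (i, l')"
    and no_tie: "\<And>i l l'. i \<in> {1..k} \<Longrightarrow> l \<in> {1..n} \<Longrightarrow> l' \<in> {1..n} \<Longrightarrow> l \<noteq> l' \<Longrightarrow>
      (\<Sum>h\<in>{1..n}. dist (\<omega> (i, l)) (\<omega> (i, h))) \<noteq> (\<Sum>h\<in>{1..n}. dist (\<omega> (i, l')) (\<omega> (i, h)))"
    and center: "\<And>i. i \<in> {1..k} \<Longrightarrow> \<exists>l\<in>{1..n}. dist (\<omega> (i, l)) (c i) \<le> \<epsilon>"
    and clipped_dev: "\<And>i p. i \<in> {1..k} \<Longrightarrow> p \<in> (\<Union>j\<in>{1..k}. cball (c j) 1) \<Longrightarrow>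
      \<bar>(\<Sum>l\<in>{1..n}. clipped p (\<omega> (i, l))) - n * (\<integral>x. clipped p x \<partial>\<mu> i)\<bar> \<le> \<epsilon> * n"
    and dist_dev: "\<And>i p. i \<in> {1..k} \<Longrightarrow> p \<in> (\<Union>j\<in>{1..k}. cball (c j) 1) \<Longrightarrow>
      \<bar>(\<Sum>l\<in>{1..n}. dist p (\<omega> (i, l))) - n * (\<integral>x. dist p x \<partial>\<mu> i)\<bar> \<le> \<epsilon> * n"
  shows "exact_recovery k (drawn (\<lambda>_. n) \<omega>)"
proof -
  define A where "A i = drawn (\<lambda>_. n) \<omega> i" for i
  have A: "A i = (\<lambda>l. \<omega> (i, l)) ` {1..n}" for i by (auto simp: A_def drawn_def)
  have finA: "finite (A i)" for i by (simp add: A)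
  have inj: "inj_on (\<lambda>l. \<omega> (i, l)) {1..n}" if "i \<in> {1..k}" for i
    using distinct[OF that] by (meson inj_onI)
  have sumA: "(\<Sum>q\<in>A i. g q) = (\<Sum>l\<in>{1..n}. g (\<omega> (i, l)))" if "i \<in> {1..k}" for i and g :: "real ^ 'm \<Rightarrow> real"
    unfolding A sum.reindex[OF inj[OF that]] by (simp add: o_def)
  have cardA: "card (A i) = n" if "i \<in> {1..k}" for i
    unfolding A card_image[OF inj[OF that]] by simp
  have A_ball: "dist q (c i) \<le> 1" if "i \<in> {1..k}" "q \<in> A i" for i q
    using that in_ball[OF that(1)] unfolding A by (auto simp: dist_commute)
  have A_Un: "q \<in> (\<Union>j\<in>{1..k}. cball (c j) 1)" if "i \<in> {1..k}" "q \<in> A i" for i q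
    using A_ball[OF that] that(1) by (auto simp: dist_commute)
  define cost where "cost i p = (\<Sum>q\<in>A i. dist p q)" for i p
  define M where "M i = arg_min_on (cost i) (A i)" for i
  have M: "M i \<in> A i" and M_le: "p \<in> A i \<Longrightarrow> cost i (M i) \<le> cost i p" if "i \<in> {1..k}" for i p
  proof -
    have "A i \<noteq> {}" using n by (simp add: A)
    then show "M i \<in> A i" "p \<in> A i \<Longrightarrow> cost i (M i) \<le> cost i p"
      unfolding M_def using finA by (auto intro: arg_min_if_finite arg_min_least)
  qed
  have M_less: "cost i (M i) < cost i p" if i: "i \<in> {1..k}" and p: "p \<in> A i" "p \<noteq> M i" for i p
  proof -
    obtain l l' where l: "l \<in> {1..n}" "p = \<omega> (i, l)" "l' \<in> {1..n}" "M i = \<omega> (i, l')"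
      using p(1) M[OF i] unfolding A by blast
    then have "cost i p \<noteq> cost i (M i)"
      using no_tie[OF i l(1,3)] p(2) unfolding cost_def sumA[OF i] by auto
    with M_le[OF i p(1)] show ?thesis by simp
  qed
  have \<epsilon>3: "3 * \<epsilon> < 0.002"
  proof -
    have "\<epsilon> \<le> real k * \<epsilon>" using mult_right_mono[of 1 "real k" \<epsilon>] k \<epsilon>(1) by simp
    then show ?thesis using \<epsilon>(2) by simp
  qed
  have dev: "\<bar>cost i p - n * (\<integral>x. dist p x \<partial>\<mu> i)\<bar> \<le> \<epsilon> * n"
    if "i \<in> {1..k}" "j \<in> {1..k}" "p \<in> A j" for i j p
    unfolding cost_def sumA[OF that(1)] by (rule dist_dev[OF that(1) A_Un[OF that(2,3)]])
  have upper: "cost i (M i) \<le> n * (E + 2 * \<epsilon>)" if i: "i \<in> {1..k}" for i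
  proof -
    obtain p where p: "p \<in> A i" "dist p (c i) \<le> \<epsilon>" using center[OF i] unfolding A by blast
    have "cost i (M i) \<le> n * (\<integral>x. dist p x \<partial>\<mu> i) + \<epsilon> * n"
      using M_le[OF i p(1)] dev[OF i i p(1)] by linarith
    also have "\<dots> \<le> n * (E + \<epsilon>) + \<epsilon> * n"
      using integral_dist_near_center[where p = p and i = i] p(2) \<epsilon>(1) by (intro add_mono mult_left_mono) auto
    finally show ?thesis by (simp add: algebra_simps)
  qed
  have lower: "n * (E - \<epsilon>) \<le> cost i (M i)" if i: "i \<in> {1..k}" for i
  proof -
    have "n * E \<le> n * (\<integral>x. dist (M i) x \<partial>\<mu> i)"
      using mean_dist_le_integral_dist[OF dim ball rot, of i "M i"] mean[of i] by (intro mult_left_mono) auto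
    then show ?thesis using dev[OF i i M[OF i]] by (simp add: algebra_simps)
  qed
  \<comment> \<open>Otherwise the medoid would cost at least n (E + 0.002 - \<epsilon>), more than
    the n (E + 2 \<epsilon>) guaranteed by a sample point close to the center.\<close>
  have M_close: "dist (M i) (c i) < 0.465" if i: "i \<in> {1..k}" for i
  proof (rule ccontr)
    assume "\<not> dist (M i) (c i) < 0.465"
    then have "n * (E + 0.002) \<le> n * (\<integral>x. dist (M i) x \<partial>\<mu> i)"
      using A_ball[OF i M[OF i]] by (intro mult_left_mono integral_dist_far_from_center) auto
    then have "n * (E + 0.002) - \<epsilon> * n \<le> n * (E + 2 * \<epsilon>)"
      using dev[OF i i M[OF i]] upper[OF i] by linarith
    then have "n * 0.002 \<le> n * (3 * \<epsilon>)" by (simp add: algebra_simps)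
    then show False using n \<epsilon>3 by simp
  qed
  define \<alpha> where "\<alpha> i = 1.47 - E + cost i (M i) / n" for i
  have \<alpha>: "1.47 - \<epsilon> \<le> \<alpha> i" "\<alpha> i \<le> 1.47 + 2 * \<epsilon>" if "i \<in> {1..k}" for i
    using upper[OF that] lower[OF that] n by (simp_all add: \<alpha>_def field_simps)
  have sum_\<alpha>: "(\<Sum>q\<in>A i. \<alpha> i - dist p q) = n * (1.47 - E) + (cost i (M i) - cost i p)" if "i \<in> {1..k}" for i p
    using n by (simp add: sum_subtractf cardA[OF that] cost_def \<alpha>_def distrib_left)
  have near: "dist p q \<le> \<alpha> i" if "i \<in> {1..k}" "q \<in> A i" "dist p (c i) \<le> 0.465" for i p q
    using A_ball[OF that(1,2)] that(3) dist_triangle2[of p q "c i"] \<alpha>(1)[OF that(1)] \<epsilon>3 \<epsilon>(1) by simp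
  have far: "\<alpha> j < dist p q" if "i \<in> {1..k}" "j \<in> {1..k}" "i \<noteq> j" "q \<in> A j" "dist p (c i) \<le> 0.465" for i j p q
  proof -
    have "dist (c i) (c j) \<le> dist p (c i) + dist p q + dist q (c j)"
      using dist_triangle[of "c i" "c j" p] dist_triangle[of p "c j" q] by (simp add: dist_commute)
    then show ?thesis using sep[OF that(1-3)] A_ball[OF that(2,4)] that(5) \<alpha>(2)[OF that(2)] \<epsilon>3 by simp
  qed
  have disj: "A i \<inter> A j = {}" if "i \<in> {1..k}" "j \<in> {1..k}" "i \<noteq> j" for i j
  proof -
    have sep_q: "3.29 < dist q (c i) + dist q (c j)" for q
      using sep[OF that] dist_triangle3[of "c i" "c j" q] by (simp add: dist_commute)
    have False if q: "q \<in> A i" "q \<in> A j" for q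
      using sep_q[of q] A_ball[OF \<open>i \<in> {1..k}\<close> q(1)] A_ball[OF \<open>j \<in> {1..k}\<close> q(2)] by simp
    then show ?thesis by blast
  qed
  have "exact_recovery k A"
  proof (rule exact_recovery_of_dual_certificate[where M = M and \<alpha> = \<alpha> and \<xi> = "n * (1.47 - E)"])
    show "(\<Sum>q\<in>A i. \<alpha> i - dist (M i) q) = n * (1.47 - E)" if "i \<in> {1..k}" for i
      using sum_\<alpha>[OF that, of "M i"] by simp
    show "dist (M i) q \<le> \<alpha> i" if "i \<in> {1..k}" "q \<in> A i" for i q
      using near[OF that] M_close[OF that(1)] by simp
    show "\<alpha> j < dist (M i) q" if "i \<in> {1..k}" "j \<in> {1..k}" "i \<noteq> j" "q \<in> A j" for i j q
      using far[OF that] M_close[OF that(1)] by simp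
    fix i p assume i: "i \<in> {1..k}" and p: "p \<in> A i" "p \<noteq> M i"
    show "(\<Sum>j\<in>{1..k}. \<Sum>q\<in>A j. max 0 (\<alpha> j - dist p q)) < n * (1.47 - E)"
    proof (cases "dist p (c i) \<le> 0.465")
      \<comment> \<open>Here clipping is inactive in the own ball and total in the others, so the
        sum equals \<xi> minus the excess of the cost of p over that of the medoid.\<close>
      case True
      have "(\<Sum>q\<in>A j. max 0 (\<alpha> j - dist p q)) = (if j = i then \<Sum>q\<in>A i. \<alpha> i - dist p q else 0)"
        if j: "j \<in> {1..k}" for j
      proof (cases "j = i")
        case True
        have "(\<Sum>q\<in>A i. max 0 (\<alpha> i - dist p q)) = (\<Sum>q\<in>A i. \<alpha> i - dist p q)"
          by (intro sum.cong refl) (use near[OF i] \<open>dist p (c i) \<le> 0.465\<close> in force)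
        then show ?thesis using True by simp
      next
        case False
        have "(\<Sum>q\<in>A j. max 0 (\<alpha> j - dist p q)) = (\<Sum>q\<in>A j. 0)"
          by (intro sum.cong refl) (use far[OF i j] False \<open>dist p (c i) \<le> 0.465\<close> in force)
        then show ?thesis using False by simp
      qed
      then have "(\<Sum>j\<in>{1..k}. \<Sum>q\<in>A j. max 0 (\<alpha> j - dist p q)) =
          (\<Sum>j\<in>{1..k}. if j = i then \<Sum>q\<in>A i. \<alpha> i - dist p q else 0)"
        by (intro sum.cong refl)
      also have "\<dots> = n * (1.47 - E) + (cost i (M i) - cost i p)" using i sum_\<alpha>[OF i, of p] by simp
      also have "\<dots> < n * (1.47 - E)" using M_less[OF i p] by simp
      finally show ?thesis .
    next
      case False
      have "(\<Sum>q\<in>A j. max 0 (\<alpha> j - dist p q)) \<le> n * (\<integral>x. clipped p x \<partial>\<mu> j) + 3 * \<epsilon> * n"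
        if j: "j \<in> {1..k}" for j
      proof -
        have "(\<Sum>q\<in>A j. max 0 (\<alpha> j - dist p q)) \<le> (\<Sum>q\<in>A j. clipped p q + 2 * \<epsilon>)"
          using \<alpha>(2)[OF j] \<epsilon>(1) by (intro sum_mono) (auto simp: clipped_def)
        also have "\<dots> = (\<Sum>q\<in>A j. clipped p q) + 2 * \<epsilon> * n"
          by (simp add: sum.distrib cardA[OF j])
        also have "\<dots> = (\<Sum>l\<in>{1..n}. clipped p (\<omega> (j, l))) + 2 * \<epsilon> * n"
          unfolding sumA[OF j] ..
        also have "\<dots> \<le> n * (\<integral>x. clipped p x \<partial>\<mu> j) + 3 * \<epsilon> * n"
          using clipped_dev[OF j A_Un[OF i p(1)]] by linarith
        finally show ?thesis .
      qed
      then have "(\<Sum>j\<in>{1..k}. \<Sum>q\<in>A j. max 0 (\<alpha> j - dist p q)) \<le>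
        (\<Sum>j\<in>{1..k}. n * (\<integral>x. clipped p x \<partial>\<mu> j) + 3 * \<epsilon> * n)" by (intro sum_mono)
      also have "\<dots> = n * (\<Sum>j\<in>{1..k}. \<integral>x. clipped p x \<partial>\<mu> j) + n * (3 * real k * \<epsilon>)"
        by (simp add: sum.distrib sum_distrib_left)
      also have "\<dots> \<le> n * (1.468 - E) + n * (3 * real k * \<epsilon>)"
        using sum_integral_clipped[OF i] False A_ball[OF i p(1)] by (intro add_right_mono mult_left_mono) auto
      also have "\<dots> < n * (1.468 - E) + n * 0.002" using \<epsilon>(2) n by (intro add_strict_left_mono mult_strict_left_mono) auto
      also have "\<dots> = n * (1.47 - E)" by (simp add: algebra_simps)
      finally show ?thesis .
    qed
  qed (use finA disj M in auto)
  then show ?thesis by (simp add: A_def[abs_def])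
qed

end

section \<open>Samples are typical with high probability\<close>

context ball_model
begin

lemma esbm_eq: "esbm k \<mu> ns = PiM (SIGMA i:{1..k}. {1..ns i}) (\<lambda>x. \<mu> (fst x))"
  unfolding esbm_def by (simp add: case_prod_beta')

lemma prob_space_\<mu>: "prob_space (\<mu> i)"
  using ball[of i] by (simp add: prob_on_ball_def)

lemma prob_space_esbm: "prob_space (esbm k \<mu> ns)"
  unfolding esbm_eq by (intro prob_space_PiM prob_space_\<mu>)

lemma measurable_draw:
  assumes "i \<in> {1..k}" "l \<in> {1..ns i}"
  shows "(\<lambda>\<omega>. \<omega> (i, l)) \<in> esbm k \<mu> ns \<rightarrow>\<^sub>M \<mu> i"
  unfolding esbm_eq
  using measurable_component_singleton[of "(i, l)" "SIGMA i:{1..k}. {1..ns i}" "\<lambda>x. \<mu> (fst x)"] assms by simp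

lemma borel_measurable_draw:
  assumes "i \<in> {1..k}" "l \<in> {1..ns i}"
  shows "(\<lambda>\<omega>. \<omega> (i, l)) \<in> borel_measurable (esbm k \<mu> ns)"
proof -
  have "sets (\<mu> i) = sets (restrict_space borel (cball (c i) 1))" using ball by (simp add: prob_on_ball_def)
  then have "(\<lambda>x. x) \<in> \<mu> i \<rightarrow>\<^sub>M borel"
    unfolding measurable_cong_sets[OF \<open>sets (\<mu> i) = _\<close> refl] by (intro measurable_restrict_space1) simp
  from measurable_compose[OF measurable_draw[of i l ns, OF assms] this] show ?thesis .
qed

lemma draw_in_ball:
  assumes "\<omega> \<in> space (esbm k \<mu> ns)" "i \<in> {1..k}" "l \<in> {1..ns i}"
  shows "\<omega> (i, l) \<in> cball (c i) 1"
  using measurable_space[OF measurable_draw[of i l ns, OF assms(2,3)] assms(1)] space_prob_on_ball[OF ball] by blast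

lemma borel_measurable_sum_draws:
  fixes g :: "real ^ 'm \<Rightarrow> real"
  assumes "i \<in> {1..k}" "continuous_on UNIV g"
  shows "(\<lambda>\<omega>. \<Sum>l\<in>{1..n}. g (\<omega> (i, l))) \<in> borel_measurable (esbm k \<mu> (\<lambda>_. n))"
  using assms
  by (intro borel_measurable_sum measurable_compose[OF borel_measurable_draw borel_measurable_continuous_onI]) auto

lemma sets_deviation:
  fixes g :: "real ^ 'm \<Rightarrow> real" and \<epsilon> :: real
  assumes "i \<in> {1..k}" "continuous_on UNIV g"
  shows "{\<omega> \<in> space (esbm k \<mu> (\<lambda>_. n)). \<bar>(\<Sum>l\<in>{1..n}. g (\<omega> (i, l))) - n * (\<integral>x. g x \<partial>\<mu> i)\<bar> \<le> \<epsilon> * n}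
    \<in> sets (esbm k \<mu> (\<lambda>_. n))"
proof -
  have *: "{\<omega> \<in> space M. \<bar>f \<omega> - a\<bar> \<le> b} \<in> sets M" if "f \<in> borel_measurable M"
    for f :: "(nat \<times> nat \<Rightarrow> real ^ 'm) \<Rightarrow> real" and M a b using that by measurable
  show ?thesis by (rule *[OF borel_measurable_sum_draws[OF assms]])
qed

lemma whp_deviation:
  fixes g :: "real ^ 'm \<Rightarrow> real" and \<epsilon> :: real
  assumes i: "i \<in> {1..k}" and g: "continuous_on UNIV g" and \<epsilon>: "0 < \<epsilon>"
  shows "whp (\<lambda>n. esbm k \<mu> (\<lambda>_. n)) (\<lambda>n \<omega>. \<bar>(\<Sum>l\<in>{1..n}. g (\<omega> (i, l))) - n * (\<integral>x. g x \<partial>\<mu> i)\<bar> \<le> \<epsilon> * n)"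
proof -
  have "compact (g ` cball (c i) 1)"
    by (intro compact_continuous_image compact_cball continuous_on_subset[OF g]) simp
  then obtain B where B: "0 < B" "\<And>x. x \<in> cball (c i) 1 \<Longrightarrow> \<bar>g x\<bar> \<le> B"
    using compact_imp_bounded bounded_pos by (metis (no_types, lifting) imageI real_norm_def)
  show ?thesis
  proof (rule whp_of_bad_bound[OF prob_space_esbm sets_deviation[OF i g]])
    fix n :: nat assume n: "0 < n"
    interpret prob_space "esbm k \<mu> (\<lambda>_. n)" by (rule prob_space_esbm)
    let ?D = "\<lambda>\<omega>. \<bar>(\<Sum>l\<in>{1..n}. g (\<omega> (i, l))) - n * (\<integral>x. g x \<partial>\<mu> i)\<bar>"
    define J where "J = Pair i ` {1..n}"
    have J: "card J = n" "(\<Sum>j\<in>J. g (\<omega> j)) = (\<Sum>l\<in>{1..n}. g (\<omega> (i, l)))" for \<omega>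
      by (simp_all add: J_def card_image sum.reindex inj_on_def)
    have "prob {\<omega> \<in> space (esbm k \<mu> (\<lambda>_. n)). \<not> ?D \<omega> \<le> \<epsilon> * n} \<le>
      prob {\<omega> \<in> space (esbm k \<mu> (\<lambda>_. n)). ?D \<omega> \<ge> \<epsilon> * n}"
      using borel_measurable_sum_draws[OF i g, of n] by (intro finite_measure_mono) (auto, measurable)
    also have "\<dots> \<le> 2 * exp (- (\<epsilon>\<^sup>2 / (2 * B\<^sup>2) * n))"
    proof -
      let ?P = "PiM (SIGMA i:{1..k}. {1..n}) (\<lambda>x. \<mu> (fst x))"
      have "measure ?P {\<omega> \<in> space ?P. \<bar>(\<Sum>j\<in>J. g (\<omega> j)) - card J * (\<integral>x. g x \<partial>\<mu> i)\<bar> \<ge> \<epsilon> * card J}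
        \<le> 2 * exp (- (\<epsilon>\<^sup>2 / (2 * B\<^sup>2) * card J))"
      proof (rule PiM_sum_deviation)
        show "g \<in> borel_measurable (\<mu> i)" using integrable_on_ball[OF ball g] by simp
        show "\<bar>g x\<bar> \<le> B" if "x \<in> space (\<mu> i)" for x
          using B(2) that space_prob_on_ball[OF ball] by blast
      qed (use prob_space_\<mu> i n \<epsilon> B(1) in \<open>auto simp: J_def\<close>)
      then show ?thesis unfolding esbm_eq[of "\<lambda>_. n", symmetric] J .
    qed
    finally show "prob {\<omega> \<in> space (esbm k \<mu> (\<lambda>_. n)). \<not> ?D \<omega> \<le> \<epsilon> * n} \<le> 2 * exp (- (\<epsilon>\<^sup>2 / (2 * B\<^sup>2) * n))" .
  next
    have "(\<lambda>n. 2 * exp (- (\<epsilon>\<^sup>2 / (2 * B\<^sup>2))) ^ n) \<longlonglongrightarrow> 2 * 0"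
      using \<epsilon> B by (intro tendsto_mult_left LIMSEQ_power_zero) simp
    then show "(\<lambda>n. 2 * exp (- (\<epsilon>\<^sup>2 / (2 * B\<^sup>2) * real n))) \<longlonglongrightarrow> 0"
      by (simp add: mult.commute flip: exp_of_nat_mult)
  qed
qed

section \<open>Almost sure genericity of the draws, and positive mass near the centers\<close>

lemma AE_of_fibre:
  assumes "i \<in> {1..k}" "l \<in> {1..n}" "Measurable.pred (esbm k \<mu> (\<lambda>_. n)) P"
    and "\<And>\<omega>. AE x in \<mu> i. P (fun_upd \<omega> (i, l) x)"
  shows "AE \<omega> in esbm k \<mu> (\<lambda>_. n). P \<omega>"
proof -
  interpret product_sigma_finite "\<lambda>x :: nat \<times> nat. \<mu> (fst x)"
    using prob_space_\<mu> by (auto simp: product_sigma_finite_def intro: prob_space_imp_sigma_finite)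
  show ?thesis
    unfolding esbm_eq
  proof (rule AE_PiM_of_fibre[of _ "(i, l)"])
    show "AE x in \<mu> (fst (i, l)). P (fun_upd \<omega> (i, l) x)" for \<omega>
      unfolding fst_conv by (rule assms(4))
  qed (use assms(1-3) in \<open>auto simp: esbm_eq\<close>)
qed

lemma pred_draws_eq:
  assumes "i \<in> {1..k}" "l \<in> {1..ns i}" "l' \<in> {1..ns i}"
  shows "Measurable.pred (esbm k \<mu> ns) (\<lambda>\<omega>. \<omega> (i, l) = \<omega> (i, l'))"
proof -
  have "(\<lambda>\<omega>. dist (\<omega> (i, l)) (\<omega> (i, l'))) \<in> borel_measurable (esbm k \<mu> ns)"
    using assms by (intro borel_measurable_dist borel_measurable_draw)
  then have "Measurable.pred (esbm k \<mu> ns) (\<lambda>\<omega>. dist (\<omega> (i, l)) (\<omega> (i, l')) = 0)"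
    by (intro borel_measurable_eq[unfolded pred_def[symmetric]] borel_measurable_const)
  then show ?thesis by simp
qed

lemma AE_draws_distinct:
  assumes i: "i \<in> {1..k}" and l: "l \<in> {1..n}" "l' \<in> {1..n}" "l \<noteq> l'"
  shows "AE \<omega> in esbm k \<mu> (\<lambda>_. n). \<omega> (i, l) \<noteq> \<omega> (i, l')"
proof (rule AE_of_fibre[OF i l(2)])
  show "Measurable.pred (esbm k \<mu> (\<lambda>_. n)) (\<lambda>\<omega>. \<omega> (i, l) \<noteq> \<omega> (i, l'))"
    using l by (intro pred_intros_logic pred_draws_eq i)
  have "AE x in \<mu> i. x \<notin> {\<omega> (i, l)}" for \<omega> :: "nat \<times> nat \<Rightarrow> real ^ 'm"
    by (intro lebesgue_null_imp_null_negligible[OF null ball]) auto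
  then show "AE x in \<mu> i. fun_upd \<omega> (i, l') x (i, l) \<noteq> fun_upd \<omega> (i, l') x (i, l')" for \<omega>
    using l(3) by (simp add: eq_commute)
qed

text \<open>A third draw m is redrawn. Its position x enters the two costs only through its
  distances to draws l and l', so a tie places x on a hyperboloid with these as foci, a null set by
  (a3). The premise makes the foci distinct, and n \<ge> 3 provides m.\<close>

lemma AE_no_tie:
  assumes i: "i \<in> {1..k}" and l: "l \<in> {1..n}" "l' \<in> {1..n}" and n: "3 \<le> n"
  shows "AE \<omega> in esbm k \<mu> (\<lambda>_. n). \<omega> (i, l) \<noteq> \<omega> (i, l') \<longrightarrow>
    (\<Sum>h\<in>{1..n}. dist (\<omega> (i, l)) (\<omega> (i, h))) \<noteq> (\<Sum>h\<in>{1..n}. dist (\<omega> (i, l')) (\<omega> (i, h)))"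
proof -
  have "card {l, l'} < card {1..n}" using n card_insert_le_m1[of 2 "{l'}" l] by simp
  then have "\<not> {1..n} \<subseteq> {l, l'}" by (meson card_mono finite.emptyI finite.insertI not_less)
  then obtain m where m: "m \<in> {1..n}" "m \<noteq> l" "m \<noteq> l'" by blast
  show ?thesis
  proof (rule AE_of_fibre[OF i m(1)])
    have draw: "(\<lambda>\<omega>. \<omega> (i, h)) \<in> borel_measurable (esbm k \<mu> (\<lambda>_. n))" if "h \<in> {1..n}" for h
      using that by (intro borel_measurable_draw i)
    have "(\<lambda>\<omega>. \<Sum>h\<in>{1..n}. dist (\<omega> (i, j)) (\<omega> (i, h))) \<in> borel_measurable (esbm k \<mu> (\<lambda>_. n))"
      if "j \<in> {1..n}" for j
      using draw that by (intro borel_measurable_sum borel_measurable_dist) auto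
    note sums = this[OF l(1)] this[OF l(2)]
    show "Measurable.pred (esbm k \<mu> (\<lambda>_. n)) (\<lambda>\<omega>. \<omega> (i, l) \<noteq> \<omega> (i, l') \<longrightarrow>
      (\<Sum>h\<in>{1..n}. dist (\<omega> (i, l)) (\<omega> (i, h))) \<noteq> (\<Sum>h\<in>{1..n}. dist (\<omega> (i, l')) (\<omega> (i, h))))"
      using l by (intro pred_intros_logic pred_draws_eq i borel_measurable_eq[unfolded pred_def[symmetric]] sums)
    fix \<omega> :: "nat \<times> nat \<Rightarrow> real ^ 'm"
    define R where "R p = (\<Sum>h\<in>{1..n} - {m}. dist p (\<omega> (i, h)))" for p
    have sum: "(\<Sum>h\<in>{1..n}. dist p (fun_upd \<omega> (i, m) x (i, h))) = dist x p + R p" for p x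
      using sum.remove[OF _ m(1), of "\<lambda>h. dist p (fun_upd \<omega> (i, m) x (i, h))"]
      by (simp add: R_def dist_commute)
    show "AE x in \<mu> i. fun_upd \<omega> (i, m) x (i, l) \<noteq> fun_upd \<omega> (i, m) x (i, l') \<longrightarrow>
      (\<Sum>h\<in>{1..n}. dist (fun_upd \<omega> (i, m) x (i, l)) (fun_upd \<omega> (i, m) x (i, h))) \<noteq>
      (\<Sum>h\<in>{1..n}. dist (fun_upd \<omega> (i, m) x (i, l')) (fun_upd \<omega> (i, m) x (i, h)))"
    proof (cases "\<omega> (i, l) = \<omega> (i, l')")
      case False
      let ?H = "{x. dist x (\<omega> (i, l)) - dist x (\<omega> (i, l')) = R (\<omega> (i, l')) - R (\<omega> (i, l))}"
      have "AE x in \<mu> i. x \<notin> ?H"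
        by (intro lebesgue_null_imp_null_negligible[OF null ball] hyperboloid_negligible
            closed_Collect_eq continuous_intros False) (use dim in simp)
      then show ?thesis unfolding sum using m by (auto elim!: eventually_mono)
    qed (use m in simp)
  qed
qed

text \<open>By (a2) the bump around the center has positive mean. Being continuous, it obeys the
  same deviation bound as the distances, and this yields a sample point within \<epsilon> of the
  center.\<close>

lemma integral_bump_pos:
  assumes "0 < \<epsilon>"
  shows "0 < (\<integral>x. max 0 (\<epsilon> - dist x (c i)) \<partial>\<mu> i)"
proof -
  interpret prob_space "\<mu> i" by (rule prob_space_\<mu>)
  let ?U = "cball (c i) 1 \<inter> ball (c i) \<epsilon>"
  have "openin (top_of_set (cball (c i) 1)) ?U" by (intro openin_open_Int) simp
  then have U: "0 < measure (\<mu> i) ?U" using charges[of i] assms by (simp add: charges_center_def)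
  have int: "integrable (\<mu> i) (\<lambda>x. max 0 (\<epsilon> - dist x (c i)))"
    by (intro integrable_on_ball[OF ball] continuous_intros)
  have "(\<integral>x. max 0 (\<epsilon> - dist x (c i)) \<partial>\<mu> i) \<noteq> 0"
  proof
    assume "(\<integral>x. max 0 (\<epsilon> - dist x (c i)) \<partial>\<mu> i) = 0"
    then have "AE x in \<mu> i. max 0 (\<epsilon> - dist x (c i)) = 0"
      using integral_nonneg_eq_0_iff_AE[OF int] by simp
    then have "AE x in \<mu> i. x \<notin> ?U" by eventually_elim (auto simp: dist_commute)
    moreover have "?U \<in> sets (\<mu> i)" using U measure_notin_sets by fastforce
    ultimately have "measure (\<mu> i) ?U = 0" by (simp add: prob_eq_0)
    with U show False by simp
  qed
  moreover have "0 \<le> (\<integral>x. max 0 (\<epsilon> - dist x (c i)) \<partial>\<mu> i)" by simp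
  ultimately show ?thesis by linarith
qed

end

text \<open>The sample points p are themselves random, so deviations must be controlled uniformly in
  p. Passing from the net point t to p changes the sum and n times the integral by at most
  \<epsilon> n each; with the deviation at t this makes 3 \<epsilon> n.\<close>

lemma deviation_of_net:
  fixes G :: "'a::metric_space \<Rightarrow> 'a \<Rightarrow> real"
  assumes "prob_space M" and int: "\<And>p. integrable M (G p)"
    and lip: "\<And>p q x. \<bar>G p x - G q x\<bar> \<le> dist p q"
    and t: "\<bar>(\<Sum>l\<in>{1..n}. G t (w l)) - real n * (\<integral>x. G t x \<partial>M)\<bar> \<le> \<epsilon> * real n" and pt: "dist t p \<le> \<epsilon>"
  shows "\<bar>(\<Sum>l\<in>{1..n}. G p (w l)) - real n * (\<integral>x. G p x \<partial>M)\<bar> \<le> 3 * \<epsilon> * real n"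
proof -
  interpret prob_space M by fact
  have "\<bar>(\<Sum>l\<in>{1..n}. G p (w l)) - (\<Sum>l\<in>{1..n}. G t (w l))\<bar> = \<bar>\<Sum>l\<in>{1..n}. G p (w l) - G t (w l)\<bar>"
    by (simp add: sum_subtractf)
  also have "\<dots> \<le> (\<Sum>l\<in>{1..n}. \<epsilon>)"
    by (rule order.trans[OF sum_abs]) (intro sum_mono order.trans[OF lip], use pt in \<open>simp add: dist_commute\<close>)
  finally have 1: "\<bar>(\<Sum>l\<in>{1..n}. G p (w l)) - (\<Sum>l\<in>{1..n}. G t (w l))\<bar> \<le> \<epsilon> * n" by (simp add: mult.commute)
  have "\<bar>\<integral>x. G t x - G p x \<partial>M\<bar> \<le> (\<integral>x. \<bar>G t x - G p x\<bar> \<partial>M)" by (rule integral_abs_bound)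
  also have "\<dots> \<le> (\<integral>x. \<epsilon> \<partial>M)"
    using int by (intro integral_mono order.trans[OF lip pt]) auto
  finally have "\<bar>(\<integral>x. G t x \<partial>M) - (\<integral>x. G p x \<partial>M)\<bar> \<le> \<epsilon>" using int by (simp add: prob_space)
  then have "real n * \<bar>(\<integral>x. G t x \<partial>M) - (\<integral>x. G p x \<partial>M)\<bar> \<le> real n * \<epsilon>" by (intro mult_left_mono) auto
  then have 2: "\<bar>real n * (\<integral>x. G t x \<partial>M) - real n * (\<integral>x. G p x \<partial>M)\<bar> \<le> \<epsilon> * n"
    by (simp add: abs_mult mult.commute flip: right_diff_distrib)
  from 1 2 t show ?thesis by (simp add: abs_le_iff)
qed

lemma (in ball_model) whp_exact_recovery:
  "whp (\<lambda>n. esbm k \<mu> (\<lambda>_. n)) (\<lambda>n \<omega>. exact_recovery k (drawn (\<lambda>_. n) \<omega>))"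
proof -
  let ?E = "\<lambda>n. esbm k \<mu> (\<lambda>_. n)"
  \<comment> \<open>The net triples \<epsilon>, so the error to be absorbed is 3 k (3 \<epsilon>) =
    0.0018 < 0.002.\<close>
  define \<epsilon> where "\<epsilon> = 0.0002 / real k"
  have \<epsilon>: "0 < \<epsilon>" "3 * real k * (3 * \<epsilon>) < 0.002" using k by (simp_all add: \<epsilon>_def)
  define K where "K = (\<Union>j\<in>{1..k}. cball (c j) 1)"
  have "compact K" unfolding K_def by (intro compact_UN) auto
  then obtain T where T: "finite T" "K \<subseteq> (\<Union>t\<in>T. ball t \<epsilon>)"
    using \<epsilon>(1) unfolding compact_eq_totally_bounded by meson
  define bump where "bump i x = max 0 (\<epsilon> - dist x (c i))" for i x
  have bump: "continuous_on UNIV (bump i)" "0 < (\<integral>x. bump i x \<partial>\<mu> i)" for i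
    unfolding bump_def by (intro continuous_intros, rule integral_bump_pos[OF \<epsilon>(1)])
  have dist_cont: "continuous_on UNIV (dist t)" for t :: "real ^ 'm" by (intro continuous_intros)
  have dist_lip: "\<bar>dist p x - dist q x\<bar> \<le> dist p q" for p q x :: "real ^ 'm"
    using abs_dist_diff_le[of p x q] by (simp add: dist_commute)
  define dev where "dev g \<delta> i n \<omega> \<longleftrightarrow> \<bar>(\<Sum>l\<in>{1..n}. g (\<omega> (i, l))) - n * (\<integral>x. g x \<partial>\<mu> i)\<bar> \<le> \<delta> * n"
    for g :: "real ^ 'm \<Rightarrow> real" and \<delta> :: real and i n :: nat and \<omega> :: "nat \<times> nat \<Rightarrow> real ^ 'm"
  have dev_sets: "{\<omega> \<in> space (?E n). dev g \<delta> i n \<omega>} \<in> sets (?E n)"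
    if "i \<in> {1..k}" "continuous_on UNIV g" for g \<delta> i n
    unfolding dev_def by (rule sets_deviation[OF that])
  have dev_whp: "whp ?E (dev g \<delta> i)" if "i \<in> {1..k}" "continuous_on UNIV g" "0 < \<delta>" for g \<delta> i
    unfolding dev_def by (rule whp_deviation[OF that])
  define net where "net n \<omega> \<longleftrightarrow> (\<forall>(i, t)\<in>{1..k} \<times> T. dev (clipped t) \<epsilon> i n \<omega> \<and> dev (dist t) \<epsilon> i n \<omega>)" for n \<omega>
  \<comment> \<open>A deviation of at most half the mean keeps the sum of the bumps positive, so
    some draw lies within \<epsilon> of the center.\<close>
  define hit where "hit n \<omega> \<longleftrightarrow> (\<forall>i\<in>{1..k}. dev (bump i) ((\<integral>x. bump i x \<partial>\<mu> i) / 2) i n \<omega>)" for n \<omega>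
  define generic where "generic n \<omega> \<longleftrightarrow> (\<forall>i\<in>{1..k}. \<forall>l\<in>{1..n}. \<forall>l'\<in>{1..n}. l \<noteq> l' \<longrightarrow> \<omega> (i, l) \<noteq> \<omega> (i, l') \<and>
    (\<Sum>h\<in>{1..n}. dist (\<omega> (i, l)) (\<omega> (i, h))) \<noteq> (\<Sum>h\<in>{1..n}. dist (\<omega> (i, l')) (\<omega> (i, h))))"
    for n and \<omega> :: "nat \<times> nat \<Rightarrow> real ^ 'm"
  have net_sets: "{\<omega> \<in> space (?E n). net n \<omega>} \<in> sets (?E n)" for n
    unfolding net_def using T(1)
    by (intro sets.sets_Collect_finite_All) (auto intro!: sets.sets_Collect_conj dev_sets continuous_on_clipped dist_cont)
  have net_whp: "whp ?E net"
    unfolding net_def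
  proof (rule whp_ball[OF prob_space_esbm])
    fix s n assume "s \<in> {1..k} \<times> T"
    then show "{\<omega> \<in> space (?E n). case s of (i, t) \<Rightarrow> dev (clipped t) \<epsilon> i n \<omega> \<and> dev (dist t) \<epsilon> i n \<omega>} \<in> sets (?E n)"
      by (auto intro!: sets.sets_Collect_conj dev_sets continuous_on_clipped dist_cont)
  next
    fix s assume "s \<in> {1..k} \<times> T"
    then obtain i t where s: "s = (i, t)" "i \<in> {1..k}" by blast
    show "whp ?E (\<lambda>n \<omega>. case s of (i, t) \<Rightarrow> dev (clipped t) \<epsilon> i n \<omega> \<and> dev (dist t) \<epsilon> i n \<omega>)"
      unfolding s prod.case
      by (intro whp_conj prob_space_esbm dev_sets dev_whp s(2) continuous_on_clipped dist_cont \<epsilon>(1))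
  qed (use T(1) in simp)
  have hit_sets: "{\<omega> \<in> space (?E n). hit n \<omega>} \<in> sets (?E n)" for n
    unfolding hit_def by (intro sets.sets_Collect_finite_All dev_sets bump) auto
  have hit_whp: "whp ?E hit"
    unfolding hit_def by (rule whp_ball[OF prob_space_esbm]) (auto intro!: dev_sets dev_whp bump)
  have sum_meas: "(\<lambda>\<omega>. \<Sum>h\<in>{1..n}. dist (\<omega> (i, l)) (\<omega> (i, h))) \<in> borel_measurable (?E n)"
    if "i \<in> {1..k}" "l \<in> {1..n}" for i l n
    using that by (intro borel_measurable_sum borel_measurable_dist borel_measurable_draw) auto
  have pair_pred: "Measurable.pred (?E n) (\<lambda>\<omega>. l \<noteq> l' \<longrightarrow> \<omega> (i, l) \<noteq> \<omega> (i, l') \<and>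
    (\<Sum>h\<in>{1..n}. dist (\<omega> (i, l)) (\<omega> (i, h))) \<noteq> (\<Sum>h\<in>{1..n}. dist (\<omega> (i, l')) (\<omega> (i, h))))"
    if "i \<in> {1..k}" "l \<in> {1..n}" "l' \<in> {1..n}" for i l l' n
  proof (rule pred_intros_imp')
    show "Measurable.pred (?E n) (\<lambda>\<omega>. \<omega> (i, l) \<noteq> \<omega> (i, l') \<and>
      (\<Sum>h\<in>{1..n}. dist (\<omega> (i, l)) (\<omega> (i, h))) \<noteq> (\<Sum>h\<in>{1..n}. dist (\<omega> (i, l')) (\<omega> (i, h))))"
      using that
      by (intro pred_intros_logic pred_draws_eq borel_measurable_eq[unfolded pred_def[symmetric]] sum_meas)
  qed
  have generic_sets: "{\<omega> \<in> space (?E n). generic n \<omega>} \<in> sets (?E n)" for n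
    unfolding generic_def
    by (intro sets.sets_Collect_finite_All pair_pred[unfolded pred_def]; (simp; fail)?)
  have generic_whp: "whp ?E generic"
  proof (rule whp_AE[OF prob_space_esbm generic_sets])
    fix n :: nat assume n: "3 \<le> n"
    have "AE \<omega> in ?E n. l \<noteq> l' \<longrightarrow> \<omega> (i, l) \<noteq> \<omega> (i, l') \<and>
        (\<Sum>h\<in>{1..n}. dist (\<omega> (i, l)) (\<omega> (i, h))) \<noteq> (\<Sum>h\<in>{1..n}. dist (\<omega> (i, l')) (\<omega> (i, h)))"
      if i: "i \<in> {1..k}" and l: "l \<in> {1..n}" "l' \<in> {1..n}" for i l l'
    proof (cases "l = l'")
      case False
      from AE_draws_distinct[OF i l False] AE_no_tie[OF i l n] show ?thesis
        by eventually_elim blast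
    qed simp
    then show "AE \<omega> in ?E n. generic n \<omega>"
      unfolding generic_def by (intro AE_finite_allI) auto
  qed
  have typical: "exact_recovery k (drawn (\<lambda>_. n) \<omega>)"
    if n: "1 \<le> n" and \<omega>: "\<omega> \<in> space (?E n)" and good: "net n \<omega> \<and> hit n \<omega> \<and> generic n \<omega>" for n \<omega>
  proof (rule exact_recovery_of_typical_sample[where \<epsilon> = "3 * \<epsilon>"])
    have near_net: "\<exists>t\<in>T. dist t p \<le> \<epsilon>" if "p \<in> K" for p
      using T(2) that by (force simp: less_imp_le)
    show "\<omega> (i, l) \<in> cball (c i) 1" if "i \<in> {1..k}" "l \<in> {1..n}" for i l
      by (rule draw_in_ball[OF \<omega>]) (use that in auto)
    show "\<omega> (i, l) \<noteq> \<omega> (i, l')"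
      "(\<Sum>h\<in>{1..n}. dist (\<omega> (i, l)) (\<omega> (i, h))) \<noteq> (\<Sum>h\<in>{1..n}. dist (\<omega> (i, l')) (\<omega> (i, h)))"
      if "i \<in> {1..k}" "l \<in> {1..n}" "l' \<in> {1..n}" "l \<noteq> l'" for i l l'
      using good that unfolding generic_def by blast+
    show "\<exists>l\<in>{1..n}. dist (\<omega> (i, l)) (c i) \<le> 3 * \<epsilon>" if i: "i \<in> {1..k}" for i
    proof (rule ccontr)
      assume "\<not> ?thesis"
      then have "bump i (\<omega> (i, l)) = 0" if "l \<in> {1..n}" for l
        using that \<epsilon>(1) by (force simp: bump_def)
      then have "(\<Sum>l\<in>{1..n}. bump i (\<omega> (i, l))) = 0" by (intro sum.neutral) blast
      moreover have "dev (bump i) ((\<integral>x. bump i x \<partial>\<mu> i) / 2) i n \<omega>" using good i by (simp add: hit_def)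
      ultimately have "n * (\<integral>x. bump i x \<partial>\<mu> i) \<le> (\<integral>x. bump i x \<partial>\<mu> i) / 2 * n"
        using bump(2)[of i] by (simp add: dev_def abs_mult)
      then show False using bump(2)[of i] n by (simp add: field_simps)
    qed
    fix i p assume i: "i \<in> {1..k}" and "p \<in> (\<Union>j\<in>{1..k}. cball (c j) 1)"
    then obtain t where t: "t \<in> T" "dist t p \<le> \<epsilon>" using near_net by (auto simp: K_def)
    have good_t: "dev (clipped t) \<epsilon> i n \<omega>" "dev (dist t) \<epsilon> i n \<omega>"
      using good i t(1) by (auto simp: net_def)
    show "\<bar>(\<Sum>l\<in>{1..n}. clipped p (\<omega> (i, l))) - n * (\<integral>x. clipped p x \<partial>\<mu> i)\<bar> \<le> 3 * \<epsilon> * n"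
    proof (rule deviation_of_net[where G = clipped and t = t and w = "\<lambda>l. \<omega> (i, l)"])
      show "\<bar>clipped p x - clipped q x\<bar> \<le> dist p q" for p q x :: "real ^ 'm"
        using dist_lip[of p x q] by (simp add: clipped_def max_def abs_le_iff)
    qed (use good_t(1) t(2) in \<open>auto simp: dev_def intro: prob_space_\<mu> integrable_on_ball[OF ball continuous_on_clipped]\<close>)
    show "\<bar>(\<Sum>l\<in>{1..n}. dist p (\<omega> (i, l))) - n * (\<integral>x. dist p x \<partial>\<mu> i)\<bar> \<le> 3 * \<epsilon> * n"
    proof (rule deviation_of_net[where G = dist and t = t and w = "\<lambda>l. \<omega> (i, l)"])
      show "\<bar>dist p x - dist q x\<bar> \<le> dist p q" for p q x :: "real ^ 'm"
        by (rule dist_lip)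
    qed (use good_t(2) t(2) in \<open>auto simp: dev_def intro: prob_space_\<mu> integrable_on_ball[OF ball dist_cont]\<close>)
  qed (use n \<epsilon> in auto)
  show ?thesis
  proof (rule whp_mono[OF prob_space_esbm])
    show "whp ?E (\<lambda>n \<omega>. net n \<omega> \<and> hit n \<omega> \<and> generic n \<omega>)"
      by (intro whp_conj prob_space_esbm sets.sets_Collect_conj net_sets hit_sets generic_sets
          net_whp hit_whp generic_whp)
    show "{\<omega> \<in> space (?E n). exact_recovery k (drawn (\<lambda>_. n) \<omega>)} \<in> sets (?E n)" for n
      by (rule sets_Collect_exact_recovery) (auto intro!: borel_measurable_dist borel_measurable_draw)
  qed (rule typical)
qed

theorem theorem6:
  fixes k :: nat
    and c :: "nat \<Rightarrow> real ^ 'm"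
    and r :: "nat \<Rightarrow> real"
    and \<mu> :: "nat \<Rightarrow> (real ^ 'm) measure"
  assumes "CARD('m) \<ge> 2"
    and "k \<ge> 1"
    and "\<And>i. i \<in> {1..k} \<Longrightarrow> prob_on_ball (c i) (r i) (\<mu> i)"
    and "\<And>i. i \<in> {1..k} \<Longrightarrow> rotation_invariant (c i) (\<mu> i)"
    and "\<And>i. i \<in> {1..k} \<Longrightarrow> charges_center (c i) (r i) (\<mu> i)"
    and "\<And>i. i \<in> {1..k} \<Longrightarrow> lebesgue_null_imp_null (\<mu> i)"
    and "\<And>i. i \<in> {1..k} \<Longrightarrow> r i = 1"
    and "\<And>i j. i \<in> {1..k} \<Longrightarrow> j \<in> {1..k} \<Longrightarrow> mean_dist (c i) (\<mu> i) = mean_dist (c j) (\<mu> j)"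
    and "\<And>i j. i \<in> {1..k} \<Longrightarrow> j \<in> {1..k} \<Longrightarrow> i \<noteq> j \<Longrightarrow> dist (c i) (c j) > 2 + 1.29"
  shows "whp (\<lambda>n. esbm k \<mu> (\<lambda>_. n)) (\<lambda>n \<omega>. exact_recovery k (drawn (\<lambda>_. n) \<omega>))"
proof -
  \<comment> \<open>Indices outside of {1..k} are redirected to ball 1 to meet the unrestricted
    assumptions of the locale; the product measure only involves indices that \<open>h\<close>
    fixes.\<close>
  define h where "h i = (if i \<in> {1..k} then i else 1)" for i
  have h: "h i \<in> {1..k}" for i using assms(2) by (simp add: h_def)
  interpret ball_model "\<lambda>i. c (h i)" "\<lambda>i. \<mu> (h i)" k "mean_dist (c 1) (\<mu> 1)"
  proof
    fix i
    show "prob_on_ball (c (h i)) 1 (\<mu> (h i))" using assms(3,7)[OF h[of i]] by simp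
    show "charges_center (c (h i)) 1 (\<mu> (h i))" using assms(5,7)[OF h[of i]] by simp
    show "mean_dist (c (h i)) (\<mu> (h i)) = mean_dist (c 1) (\<mu> 1)" using assms(2) by (intro assms(8) h) simp
    show "3.29 < dist (c (h i)) (c (h j))" if "i \<in> {1..k}" "j \<in> {1..k}" "i \<noteq> j" for j
      using assms(9)[OF that] that by (simp add: h_def)
  qed (use assms h in auto)
  have "esbm k (\<lambda>i. \<mu> (h i)) ns = esbm k \<mu> ns" for ns
    unfolding esbm_def by (intro PiM_cong refl) (auto simp: h_def)
  with whp_exact_recovery show ?thesis by simp
qed

end
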